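(* Let $(V,\omega)$ be a $2n$-dimensional real symplectic space, $L_1,L_2,L_3\in\Lambda(V,\omega)$, $\psi:[0,T]\to\mathrm{Sp}(V,\omega)$ of class $\mathscr C^1$ with $\psi(0)=\mathrm{Id}$, and $\ell_i(t)=\psi(t)L_i$ for $i=1,2$. Assume: (1) $\ell_2$ is an $L_3$-plus curve; (2) $\iota(L_1,L_2,L_3)=n-\dim(L_1\cap L_2)$; (3) $\iota^{\mathrm{CLM}}(L_3,\ell_1(t);t\in[0,T])=0$. Then $\iota^{\mathrm{CLM}}(L_3,\ell_2(t);t\in[0,T])=0$.
   Context: $\Lambda(V,\omega)$ is the Lagrangian Grassmannian of $(V,\omega)$. For $L_0\in\Lambda(V,\omega)$ and a continuous path $\ell:[a,b]\to\Lambda(V,\omega)$, $\iota^{\mathrm{CLM}}(L_0,\ell(t);t\in[a,b])\in\mathbb Z$ denotes the Cappell–Lee–Miller Maslov index: the intersection index of $\ell$ with the Maslov cycle $\Sigma(L_0)=\{L: L\cap L_0\neq\{0\}\}$; it is invariant under fixed-endpoint homotopies, additive under concatenation, and for $\mathscr C^1$ paths with only regular crossings equals $n_+(\Gamma(\ell,L_0,a))+\sum_{a<t<b}\operatorname{sgn}\Gamma(\ell,L_0,t)-n_-(\Gamma(\ell,L_0,b))$, where a crossing is $t_0$ with $\ell(t_0)\cap L_0\ne\{0\}$, the crossing form on $\ell(t_0)\cap L_0$ is $\Gamma(\ell,L_0,t_0)[v]=\frac{d}{dt}|_{t=t_0}\omega(v,w(t))$ with $w(t)$ the unique vector in a fixed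 Lagrangian $W$ transversal to $\ell(t_0)$ such that $v+w(t)\in\ell(t)$, and regular means nondegenerate. A $\mathscr C^1$ curve $\ell$ is an $L_0$-plus curve if at each crossing the crossing form is positive definite. Triple index: for $\alpha,\beta,\gamma\in\Lambda(V,\omega)$ let $Q(\alpha,\beta;\gamma)$ be the quadratic form on $\alpha\cap(\beta+\gamma)$ given by $Q(\alpha,\beta;\gamma)(x)=\omega(y,z)$ where $x=y+z$ with $y\in\beta$, $z\in\gamma$ (independent of the decomposition); then $\iota(\alpha,\beta,\gamma)=n_+\big(Q(\alpha,\beta;\gamma)\big)+\dim(\alpha\cap\gamma)-\dim(\alpha\cap\beta\cap\gamma)$, where $n_+$ is the positive inertia index. *)

theory Defs
  imports "HOL-Analysis.Analysis"
begin

definition symplectic_form :: "('a::euclidean_space \<Rightarrow> 'a \<Rightarrow> real) \<Rightarrow> bool" where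
  "symplectic_form \<omega> \<longleftrightarrow>
     (\<forall>x. linear (\<omega> x)) \<and> (\<forall>y. linear (\<lambda>x. \<omega> x y)) \<and>
     (\<forall>x y. \<omega> x y = - \<omega> y x) \<and>
     (\<forall>x. (\<forall>y. \<omega> x y = 0) \<longrightarrow> x = 0)"

definition symp_compl :: "('a::euclidean_space \<Rightarrow> 'a \<Rightarrow> real) \<Rightarrow> 'a set \<Rightarrow> 'a set" where
  "symp_compl \<omega> L = {y. \<forall>x\<in>L. \<omega> x y = 0}"

definition lagrangian :: "('a::euclidean_space \<Rightarrow> 'a \<Rightarrow> real) \<Rightarrow> 'a set \<Rightarrow> bool" where
  "lagrangian \<omega> L \<longleftrightarrow> subspace L \<and> symp_compl \<omega> L = L"

definition symplectic_map :: "('a::euclidean_space \<Rightarrow> 'a \<Rightarrow> real) \<Rightarrow> ('a \<Rightarrow>\<^sub>L 'a) \<Rightarrow> bool" where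
  "symplectic_map \<omega> A \<longleftrightarrow> bij (blinfun_apply A) \<and>
     (\<forall>x y. \<omega> (blinfun_apply A x) (blinfun_apply A y) = \<omega> x y)"

definition subspace_gap :: "'a::euclidean_space set \<Rightarrow> 'a set \<Rightarrow> real" where
  "subspace_gap L M = max (SUP x\<in>{x\<in>L. norm x \<le> 1}. infdist x M)
                           (SUP y\<in>{y\<in>M. norm y \<le> 1}. infdist y L)"

definition subspaces_continuous_on :: "'b::metric_space set \<Rightarrow> ('b \<Rightarrow> 'a::euclidean_space set) \<Rightarrow> bool" where
  "subspaces_continuous_on S F \<longleftrightarrow>
     (\<forall>p\<in>S. \<forall>e>0. \<exists>d>0. \<forall>q\<in>S. dist q p < d \<longrightarrow> subspace_gap (F q) (F p) < e)"

definition lag_path :: "('a::euclidean_space \<Rightarrow> 'a \<Rightarrow> real) \<Rightarrow> (real \<Rightarrow> 'a set) \<Rightarrow> real \<Rightarrow> real \<Rightarrow> bool" where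
  "lag_path \<omega> l a b \<longleftrightarrow> (\<forall>t\<in>{a..b}. lagrangian \<omega> (l t)) \<and> subspaces_continuous_on {a..b} l"

definition C1_on :: "real set \<Rightarrow> (real \<Rightarrow> 'b::real_normed_vector) \<Rightarrow> bool" where
  "C1_on S f \<longleftrightarrow> (\<exists>f'. (\<forall>t\<in>S. (f has_vector_derivative f' t) (at t within S)) \<and> continuous_on S f')"

definition lag_C1 :: "('a::euclidean_space \<Rightarrow> 'a \<Rightarrow> real) \<Rightarrow> (real \<Rightarrow> 'a set) \<Rightarrow> real \<Rightarrow> real \<Rightarrow> bool" where
  "lag_C1 \<omega> l a b \<longleftrightarrow> (\<forall>t\<in>{a..b}. lagrangian \<omega> (l t)) \<and>
     (\<exists>Z::real \<Rightarrow> ('a \<Rightarrow>\<^sub>L 'a). C1_on {a..b} Z \<and> (\<forall>t\<in>{a..b}. l t = range (blinfun_apply (Z t))))"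

definition lag_homotopic :: "('a::euclidean_space \<Rightarrow> 'a \<Rightarrow> real) \<Rightarrow> (real \<Rightarrow> 'a set) \<Rightarrow> (real \<Rightarrow> 'a set) \<Rightarrow> real \<Rightarrow> real \<Rightarrow> bool" where
  "lag_homotopic \<omega> l m a b \<longleftrightarrow>
     (\<exists>H::real \<times> real \<Rightarrow> 'a set.
        (\<forall>s\<in>{0..1}. \<forall>t\<in>{a..b}. lagrangian \<omega> (H (s,t))) \<and>
        subspaces_continuous_on ({0..1} \<times> {a..b}) H \<and>
        (\<forall>t\<in>{a..b}. H (0,t) = l t \<and> H (1,t) = m t) \<and>
        (\<forall>s\<in>{0..1}. H (s,a) = l a \<and> H (s,b) = l b))"

definition polar :: "('a::real_vector \<Rightarrow> real) \<Rightarrow> 'a \<Rightarrow> 'a \<Rightarrow> real" where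
  "polar Q x y = (Q (x + y) - Q x - Q y) / 2"

definition n_plus :: "('a::euclidean_space \<Rightarrow> real) \<Rightarrow> 'a set \<Rightarrow> nat" where
  "n_plus Q S = Max {dim U | U. subspace U \<and> U \<subseteq> S \<and> (\<forall>u\<in>U. u \<noteq> 0 \<longrightarrow> Q u > 0)}"

definition n_minus :: "('a::euclidean_space \<Rightarrow> real) \<Rightarrow> 'a set \<Rightarrow> nat" where
  "n_minus Q S = Max {dim U | U. subspace U \<and> U \<subseteq> S \<and> (\<forall>u\<in>U. u \<noteq> 0 \<longrightarrow> Q u < 0)}"

definition qf_signature :: "('a::euclidean_space \<Rightarrow> real) \<Rightarrow> 'a set \<Rightarrow> int" where
  "qf_signature Q S = int (n_plus Q S) - int (n_minus Q S)"

definition qf_nondegenerate :: "('a::euclidean_space \<Rightarrow> real) \<Rightarrow> 'a set \<Rightarrow> bool" where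
  "qf_nondegenerate Q S \<longleftrightarrow> (\<forall>x\<in>S. (\<forall>y\<in>S. polar Q x y = 0) \<longrightarrow> x = 0)"

definition is_crossing :: "'a::euclidean_space set \<Rightarrow> (real \<Rightarrow> 'a set) \<Rightarrow> real \<Rightarrow> bool" where
  "is_crossing L0 l t \<longleftrightarrow> l t \<inter> L0 \<noteq> {0}"

text \<open>Crossing form Gamma(l, L0, t0) on l(t0) \<inter> L0, computed with a fixed Lagrangian W
  transversal to l(t0); derivatives are taken within [a,b].\<close>
definition crossing_form :: "('a::euclidean_space \<Rightarrow> 'a \<Rightarrow> real) \<Rightarrow> (real \<Rightarrow> 'a set) \<Rightarrow> real \<Rightarrow> real \<Rightarrow> real \<Rightarrow> 'a \<Rightarrow> real" where
  "crossing_form \<omega> l a b t0 v =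
     (let W = (SOME W. lagrangian \<omega> W \<and> W \<inter> l t0 = {0})
      in vector_derivative (\<lambda>t. \<omega> v (THE w. w \<in> W \<and> v + w \<in> l t)) (at t0 within {a..b}))"

definition regular_crossings :: "('a::euclidean_space \<Rightarrow> 'a \<Rightarrow> real) \<Rightarrow> 'a set \<Rightarrow> (real \<Rightarrow> 'a set) \<Rightarrow> real \<Rightarrow> real \<Rightarrow> bool" where
  "regular_crossings \<omega> L0 l a b \<longleftrightarrow>
     (\<forall>t\<in>{a..b}. is_crossing L0 l t \<longrightarrow> qf_nondegenerate (crossing_form \<omega> l a b t) (l t \<inter> L0))"

definition plus_curve :: "('a::euclidean_space \<Rightarrow> 'a \<Rightarrow> real) \<Rightarrow> 'a set \<Rightarrow> (real \<Rightarrow> 'a set) \<Rightarrow> real \<Rightarrow> real \<Rightarrow> bool" where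
  "plus_curve \<omega> L0 l a b \<longleftrightarrow> lag_C1 \<omega> l a b \<and>
     (\<forall>t\<in>{a..b}. is_crossing L0 l t \<longrightarrow>
        (\<forall>v\<in>l t \<inter> L0. v \<noteq> 0 \<longrightarrow> crossing_form \<omega> l a b t v > 0))"

definition crossing_sum :: "('a::euclidean_space \<Rightarrow> 'a \<Rightarrow> real) \<Rightarrow> 'a set \<Rightarrow> (real \<Rightarrow> 'a set) \<Rightarrow> real \<Rightarrow> real \<Rightarrow> int" where
  "crossing_sum \<omega> L0 l a b =
     int (n_plus (crossing_form \<omega> l a b a) (l a \<inter> L0))
     + (\<Sum>t\<in>{t\<in>{a<..<b}. is_crossing L0 l t}. qf_signature (crossing_form \<omega> l a b t) (l t \<inter> L0))
     - int (n_minus (crossing_form \<omega> l a b b) (l b \<inter> L0))"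

text \<open>The CLM index of a continuous Lagrangian path is the crossing-form count of any
  C^1 path with only regular crossings that is homotopic to it with fixed endpoints
  (well defined by homotopy invariance, existence of regular perturbations and the
  crossing-form formula).\<close>
definition iota_CLM :: "('a::euclidean_space \<Rightarrow> 'a \<Rightarrow> real) \<Rightarrow> 'a set \<Rightarrow> (real \<Rightarrow> 'a set) \<Rightarrow> real \<Rightarrow> real \<Rightarrow> int" where
  "iota_CLM \<omega> L0 l a b =
     (THE k. \<exists>m. lag_C1 \<omega> m a b \<and> regular_crossings \<omega> L0 m a b \<and>
                  lag_homotopic \<omega> l m a b \<and> k = crossing_sum \<omega> L0 m a b)"

definition triple_Q :: "('a::euclidean_space \<Rightarrow> 'a \<Rightarrow> real) \<Rightarrow> 'a set \<Rightarrow> 'a set \<Rightarrow> 'a set \<Rightarrow> 'a \<Rightarrow> real" where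
  "triple_Q \<omega> \<alpha> \<beta> \<gamma> x = (SOME r. \<exists>y z. y \<in> \<beta> \<and> z \<in> \<gamma> \<and> x = y + z \<and> r = \<omega> y z)"

definition triple_index :: "('a::euclidean_space \<Rightarrow> 'a \<Rightarrow> real) \<Rightarrow> 'a set \<Rightarrow> 'a set \<Rightarrow> 'a set \<Rightarrow> nat" where
  "triple_index \<omega> \<alpha> \<beta> \<gamma> =
     n_plus (triple_Q \<omega> \<alpha> \<beta> \<gamma>) (\<alpha> \<inter> {y + z | y z. y \<in> \<beta> \<and> z \<in> \<gamma>})
     + dim (\<alpha> \<inter> \<gamma>) - dim (\<alpha> \<inter> \<beta> \<inter> \<gamma>)"

end

theory Submission
  imports Defs
begin

text \<open>
  For transversal Lagrangians \<open>W\<close> and \<open>l\<close> let \<open>q(v) = \<omega>(\<pi> v, v)\<close>, where \<open>\<pi>\<close> projects onto \<open>W\<close> along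
  \<open>l\<close>. On a Lagrangian \<open>L\<close> its kernel is \<open>L \<inter> l + L \<inter> W\<close>. Along a path \<open>l(t)\<close> that stays
  transversal to \<open>W\<close> the increment of \<open>n\<^sub>+(q|L)\<close> does not depend on \<open>W\<close>, because a change of chart
  alters \<open>n\<^sub>+\<close> by forms of constant nullity. These local increments glue over a simply connected
  parameter space, which gives a homotopy invariant integer. At a regular crossing \<open>n\<^sub>+\<close> jumps by the inertia
  indices of the crossing form, so this integer is the Cappell-Lee-Miller index. A regular
  representative of any \<open>C\<^sup>1\<close> path is obtained by composing it with a fast positive rotation.

  Fix \<open>W\<close> transversal to \<open>L1\<close> and \<open>L2\<close> and use the chart \<open>\<psi>(t) W\<close>, which moves with both paths.
  The difference of the two indices is then the increment over \<open>[0, T]\<close> of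
  \<open>n\<^sub>+(q2|\<psi>(t)\<^sup>-\<^sup>1 L3) - n\<^sub>+(q1|\<psi>(t)\<^sup>-\<^sup>1 L3)\<close> with fixed forms \<open>q1\<close>, \<open>q2\<close>.
  By subadditivity this quantity never exceeds \<open>n\<^sub>+(q2 - q1)\<close>, and the hypothesis on the triple
  index says that the bound is attained at \<open>t = 0\<close>. Hence the index of the second path is at most
  that of the first, and it is nonnegative because the second path is a plus curve.
\<close>

section \<open>Inertia of quadratic forms\<close>

text \<open>Two features of the definitions shape the proof. The index is a definite description
  over regular \<open>C^1\<close> representatives, so its vanishing for the first path carries
  information only once a representative is known to exist; that path may have degenerate crossings,
  and this is why the rotations are built. The second path is a plus curve and represents itself.
  Secondly, the endpoint convention counts \<open>n_+\<close> at the start and \<open>n_-\<close> at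
  the end. The positive index of \<open>q\<close> has exactly these one-sided jumps: at a regular
  crossing it rises by \<open>n_+\<close> of the crossing form when leaving to the right and by
  \<open>n_-\<close> when leaving to the left. Hence \<open>n_+\<close> is used rather than a
  signature, and no endpoint correction occurs. The form \<open>q\<close> is the very function
  differentiated in the crossing form, since the vector \<open>w(t)\<close> there is
  \<open>- \<pi> v\<close>. The triple index enters through its extreme value: it forces
  \<open>L1 \<subseteq> L2 + L3\<close> and makes \<open>\<omega>(y, z)\<close> nonnegative on every
  decomposition \<open>x = y + z\<close> of a vector of \<open>L1\<close>, and this number is the
  defect when \<open>q1\<close> and \<open>q2\<close> are compared on \<open>L3\<close>.\<close>

definition quadform :: "('a::real_vector \<Rightarrow> real) \<Rightarrow> bool" where
  "quadform q \<longleftrightarrow> bilinear (polar q) \<and> (\<forall>x. polar q x x = q x)"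

definition form_radical :: "('a::real_vector \<Rightarrow> real) \<Rightarrow> 'a set \<Rightarrow> 'a set" where
  "form_radical q S = {x\<in>S. \<forall>y\<in>S. polar q x y = 0}"

definition posdef_on :: "('a::real_vector \<Rightarrow> real) \<Rightarrow> 'a set \<Rightarrow> bool" where
  "posdef_on q U \<longleftrightarrow> (\<forall>u\<in>U. u \<noteq> 0 \<longrightarrow> q u > 0)"

lemma polar_commute: "polar q x y = polar q y x"
  by (simp add: polar_def add.commute)

lemma polar_bilinear:
  assumes "bilinear b"
  shows "polar (\<lambda>x. b x x) x y = (b x y + b y x) / 2"
  by (simp add: polar_def bilinear_ladd[OF assms] bilinear_radd[OF assms])

lemma quadform_bilinear:
  assumes "bilinear b"
  shows "quadform (\<lambda>x. b x x)"
proof -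
  have "bilinear (\<lambda>x y. (b x y + b y x) / 2)"
    unfolding bilinear_def linear_iff
    by (simp add: bilinear_ladd[OF assms] bilinear_radd[OF assms]
        bilinear_lmul[OF assms] bilinear_rmul[OF assms] field_simps)
  moreover have "polar (\<lambda>x. b x x) = (\<lambda>x y. (b x y + b y x) / 2)"
    by (intro ext polar_bilinear assms)
  ultimately show ?thesis by (simp add: quadform_def)
qed

lemma quadform_add:
  assumes "quadform q"
  shows "q (x + y) = q x + 2 * polar q x y + q y"
  by (simp add: polar_def field_simps)

lemma quadform_scale:
  assumes "quadform q"
  shows "q (c *\<^sub>R x) = c\<^sup>2 * q x"
proof -
  have b: "bilinear (polar q)" and d: "\<And>x. polar q x x = q x"
    using assms by (auto simp: quadform_def)
  have "q (c *\<^sub>R x) = polar q (c *\<^sub>R x) (c *\<^sub>R x)" by (simp add: d)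
  also have "\<dots> = c\<^sup>2 * q x"
    unfolding bilinear_lmul[OF b] bilinear_rmul[OF b] by (simp add: power2_eq_square d)
  finally show ?thesis .
qed

lemma quadform_zero:
  assumes "quadform q" shows "q 0 = 0"
  using quadform_scale[OF assms, of 0 0] by simp

lemma quadform_minus:
  assumes "quadform q" shows "quadform (\<lambda>x. - q x)"
proof -
  have b: "bilinear (polar q)" and d: "\<And>x. polar q x x = q x"
    using assms by (auto simp: quadform_def)
  have "bilinear (\<lambda>x y. - polar q x y)"
    using b unfolding bilinear_def linear_iff by simp
  from quadform_bilinear[OF this] show ?thesis by (simp add: d)
qed

lemma quadform_comp_linear:
  assumes "quadform q" "linear f" shows "quadform (\<lambda>x. q (f x))"
proof -
  have b: "bilinear (polar q)" and d: "\<And>x. polar q x x = q x"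
    using assms by (auto simp: quadform_def)
  have "bilinear (\<lambda>x y. polar q (f x) (f y))"
    using b assms(2) unfolding bilinear_def linear_iff by simp
  from quadform_bilinear[OF this] show ?thesis by (simp add: d)
qed

lemma quadform_diff:
  assumes "quadform q" "quadform r" shows "quadform (\<lambda>x. q x - r x)"
proof -
  have b: "bilinear (polar q)" and d: "\<And>x. polar q x x = q x"
    and b': "bilinear (polar r)" and d': "\<And>x. polar r x x = r x"
    using assms by (auto simp: quadform_def)
  have "bilinear (\<lambda>x y. polar q x y - polar r x y)"
    using b b' unfolding bilinear_def linear_iff by (simp add: algebra_simps)
  from quadform_bilinear[OF this] show ?thesis by (simp add: d d')
qed

lemma quadform_bounded:
  fixes q :: "'a::euclidean_space \<Rightarrow> real"
  assumes "quadform q"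
  obtains B where "B > 0" "\<And>x y. \<bar>polar q x y\<bar> \<le> B * norm x * norm y"
  using bilinear_bounded_pos[of "polar q"] assms by (auto simp: quadform_def)

lemma n_minus_eq: "n_minus q S = n_plus (\<lambda>x. - q x) S"
  by (simp add: n_minus_def n_plus_def)

lemma n_plus_set_finite:
  fixes S :: "'a::euclidean_space set"
  shows "finite {dim U | U. subspace U \<and> U \<subseteq> S \<and> (\<forall>u\<in>U. u \<noteq> 0 \<longrightarrow> q u > (0::real))}"
proof (rule finite_subset)
  show "{dim U | U. subspace U \<and> U \<subseteq> S \<and> (\<forall>u\<in>U. u \<noteq> 0 \<longrightarrow> q u > (0::real))} \<subseteq> {..DIM('a)}"
    by (auto simp: dim_subset_UNIV)
qed simp

lemma n_plus_ge:
  assumes "subspace U" "U \<subseteq> S" "posdef_on q U"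
  shows "dim U \<le> n_plus q S"
  unfolding n_plus_def
  by (rule Max_ge[OF n_plus_set_finite]) (use assms in \<open>auto simp: posdef_on_def\<close>)

lemma n_plus_attained:
  assumes "subspace S"
  obtains U where "subspace U" "U \<subseteq> S" "posdef_on q U" "dim U = n_plus q S"
proof -
  let ?A = "{dim U | U. subspace U \<and> U \<subseteq> S \<and> (\<forall>u\<in>U. u \<noteq> 0 \<longrightarrow> q u > 0)}"
  have "\<exists>U. subspace U \<and> U \<subseteq> S \<and> (\<forall>u\<in>U. u \<noteq> 0 \<longrightarrow> q u > 0)"
    by (rule exI[of _ "{0}"]) (use assms subspace_0 in auto)
  then have "?A \<noteq> {}" by blast
  from Max_in[OF n_plus_set_finite this] have "n_plus q S \<in> ?A" by (simp add: n_plus_def)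
  then obtain U where "subspace U" "U \<subseteq> S" "\<forall>u\<in>U. u \<noteq> 0 \<longrightarrow> q u > 0" "dim U = n_plus q S"
    by auto
  with that show ?thesis by (auto simp: posdef_on_def)
qed

lemma n_plus_eq_0:
  assumes "subspace S" "\<And>x. x \<in> S \<Longrightarrow> q x \<le> 0"
  shows "n_plus q S = 0"
proof -
  obtain U where U: "subspace U" "U \<subseteq> S" "posdef_on q U" "dim U = n_plus q S"
    using n_plus_attained[OF assms(1)] by blast
  have "U \<subseteq> {0}" using U assms(2) by (force simp: posdef_on_def)
  then show ?thesis using U(4) by (metis dim_eq_0)
qed

text \<open>A vector of a positive subspace killed by \<open>f\<close> would have
  \<open>r (f u) = r 0 \<le> 0\<close>, so \<open>f\<close> is injective there. Later comparisons
  between forms on different spaces reduce to finding a suitable \<open>f\<close>.\<close>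

lemma n_plus_le_map:
  fixes q :: "'a::euclidean_space \<Rightarrow> real" and r :: "'b::euclidean_space \<Rightarrow> real"
  assumes S: "subspace S" and f: "linear f" "f ` S \<subseteq> T" and r0: "r 0 \<le> 0"
    and pos: "\<And>x. x \<in> S \<Longrightarrow> q x > 0 \<Longrightarrow> r (f x) > 0"
  shows "n_plus q S \<le> n_plus r T"
proof -
  obtain U where U: "subspace U" "U \<subseteq> S" "posdef_on q U" "dim U = n_plus q S"
    using n_plus_attained[OF S] by blast
  have p: "r (f u) > 0" if "u \<in> U" "u \<noteq> 0" for u
    using that U pos by (auto simp: posdef_on_def)
  have "inj_on f U"
    using p r0 by (subst linear_inj_on_iff_eq_0[OF f(1) U(1)]) force
  then have "dim (f ` U) = dim U"
    using U(1) by (intro dim_image_eq[OF f(1)]) (simp add: span_eq_iff[THEN iffD2])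
  moreover have "dim (f ` U) \<le> n_plus r T"
  proof (rule n_plus_ge)
    show "subspace (f ` U)" using f(1) U(1) by (rule linear_subspace_image)
    show "f ` U \<subseteq> T" using U f by blast
    show "posdef_on r (f ` U)" using p linear_0[OF f(1)] by (auto simp: posdef_on_def)
  qed
  ultimately show ?thesis using U(4) by simp
qed

lemma n_plus_mono:
  assumes "subspace S" "S \<subseteq> T" "q 0 \<le> 0"
  shows "n_plus q S \<le> n_plus q T"
  by (rule n_plus_le_map[where f = id]) (use assms linear_id in auto)

lemma n_plus_image:
  fixes q :: "'a::euclidean_space \<Rightarrow> real" and f :: "'a \<Rightarrow> 'a"
  assumes S: "subspace S" and f: "linear f" "inj_on f S" and q: "q 0 \<le> 0"
  shows "n_plus q (f ` S) = n_plus (\<lambda>x. q (f x)) S"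
proof (rule antisym)
  obtain g where g: "linear g" "\<forall>v\<in>S. g (f v) = v"
    using linear_exists_left_inverse_on[OF f(1) S f(2)] by blast
  show "n_plus q (f ` S) \<le> n_plus (\<lambda>x. q (f x)) S"
    by (rule n_plus_le_map[OF linear_subspace_image[OF f(1) S] g(1)])
       (use g f q in \<open>auto simp: linear_0\<close>)
  show "n_plus (\<lambda>x. q (f x)) S \<le> n_plus q (f ` S)"
    by (rule n_plus_le_map[OF S f(1)]) (use q in auto)
qed

text \<open>A positive and a nonpositive subspace meet only in 0. Upper bounds for
  \<open>n_plus\<close> come from exhibiting large nonpositive subspaces.\<close>

lemma dim_posdef_nonpos:
  fixes q :: "'a::euclidean_space \<Rightarrow> real"
  assumes "subspace U" "subspace N" "subspace S" "U \<subseteq> S" "N \<subseteq> S"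
    and "posdef_on q U" "\<And>x. x \<in> N \<Longrightarrow> q x \<le> 0"
  shows "dim U + dim N \<le> dim S"
proof -
  have "U \<inter> N \<subseteq> {0}" using assms(6,7) by (force simp: posdef_on_def)
  then have "dim (U \<inter> N) = 0" by (metis dim_eq_0)
  with dim_sums_Int[OF assms(1,2)] have "dim {x + y |x y. x \<in> U \<and> y \<in> N} = dim U + dim N" by linarith
  moreover have "dim {x + y |x y. x \<in> U \<and> y \<in> N} \<le> dim S"
    by (rule dim_subset) (use assms in \<open>auto intro: subspace_add\<close>)
  ultimately show ?thesis by simp
qed

lemma bilinear_repr:
  fixes b :: "'a::euclidean_space \<Rightarrow> 'b::euclidean_space \<Rightarrow> real"
  assumes "bilinear b"
  obtains G where "linear G" "\<And>x y. b x y = G x \<bullet> y"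
proof
  let ?G = "\<lambda>x. \<Sum>e\<in>Basis. b x e *\<^sub>R e"
  show "linear ?G"
    by (rule linearI)
       (simp_all add: bilinear_ladd[OF assms] bilinear_lmul[OF assms] scaleR_add_left sum.distrib
          scaleR_sum_right)
  fix x y
  have l: "linear (b x)" using assms by (simp add: bilinear_def)
  have "b x y = b x (\<Sum>e\<in>Basis. (y \<bullet> e) *\<^sub>R e)" by (simp add: euclidean_representation)
  also have "\<dots> = (\<Sum>e\<in>Basis. (y \<bullet> e) * b x e)"
    by (simp add: linear_sum[OF l] linear_cmul[OF l])
  also have "\<dots> = ?G x \<bullet> y"
    by (subst inner_sum_left) (simp add: inner_commute mult.commute)
  finally show "b x y = ?G x \<bullet> y" .
qed

lemma dim_annihilator:
  fixes b :: "'a::euclidean_space \<Rightarrow> 'a \<Rightarrow> real"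
  assumes "bilinear b" "subspace U" "subspace S"
  shows "subspace {x\<in>S. \<forall>u\<in>U. b u x = 0}" "dim S \<le> dim {x\<in>S. \<forall>u\<in>U. b u x = 0} + dim U"
proof -
  obtain G where G: "linear G" "\<And>x y. b x y = G x \<bullet> y" using bilinear_repr[OF assms(1)] by blast
  let ?M = "{y\<in>UNIV. \<forall>x\<in>G ` U. orthogonal x y}"
  have sM: "subspace ?M"
    by (auto simp: subspace_def orthogonal_def inner_add_right)
  have "dim ?M + dim (G ` U) = DIM('a)"
    using dim_subspace_orthogonal_to_vectors[OF linear_subspace_image[OF G(1) assms(2)] subspace_UNIV]
    by simp
  moreover have "dim (G ` U) \<le> dim U" by (rule dim_image_le[OF G(1)])
  moreover have "dim {x + y |x y. x \<in> S \<and> y \<in> ?M} + dim (S \<inter> ?M) = dim S + dim ?M"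
    by (rule dim_sums_Int[OF assms(3) sM])
  moreover have "dim {x + y |x y. x \<in> S \<and> y \<in> ?M} \<le> DIM('a)" by (rule dim_subset_UNIV)
  moreover have eq: "{x\<in>S. \<forall>u\<in>U. b u x = 0} = S \<inter> ?M" by (auto simp: G(2) orthogonal_def)
  ultimately show "dim S \<le> dim {x\<in>S. \<forall>u\<in>U. b u x = 0} + dim U" by simp
  show "subspace {x\<in>S. \<forall>u\<in>U. b u x = 0}" unfolding eq by (rule subspace_inter[OF assms(3) sM])
qed

text \<open>\<open>N\<close> is the annihilator in \<open>S\<close> of a maximal positive
  \<open>U\<close>. A vector \<open>x\<close> of \<open>N\<close> with \<open>q x > 0\<close> would
  be orthogonal to \<open>U\<close> for the polar form, so \<open>U + span {x}\<close> would be a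
  larger positive subspace.\<close>

lemma inertia_decomposition:
  fixes q :: "'a::euclidean_space \<Rightarrow> real"
  assumes q: "quadform q" and S: "subspace S"
  obtains U N where "subspace U" "subspace N" "U \<subseteq> S" "N \<subseteq> S" "posdef_on q U"
    "\<And>x. x \<in> N \<Longrightarrow> q x \<le> 0" "dim U = n_plus q S" "n_plus q S + dim N = dim S"
    "\<And>u x. u \<in> U \<Longrightarrow> x \<in> N \<Longrightarrow> polar q u x = 0"
proof -
  have b: "bilinear (polar q)" and d: "\<And>x. polar q x x = q x"
    using q by (auto simp: quadform_def)
  obtain U where U: "subspace U" "U \<subseteq> S" "posdef_on q U" "dim U = n_plus q S"
    using n_plus_attained[OF S] by blast
  define N where "N = {x\<in>S. \<forall>u\<in>U. polar q u x = 0}"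
  have N: "subspace N" "dim S \<le> dim N + dim U"
    using dim_annihilator[OF b U(1) S] by (simp_all add: N_def)
  have nonpos: "q x \<le> 0" if x: "x \<in> N" for x
  proof (rule ccontr)
    assume "\<not> q x \<le> 0"
    then have qx: "q x > 0" by simp
    let ?U = "{u + y |u y. u \<in> U \<and> y \<in> span {x}}"
    have "U \<inter> span {x} \<subseteq> {0}"
    proof
      fix y assume y: "y \<in> U \<inter> span {x}"
      then obtain c where c: "y = c *\<^sub>R x" by (auto simp: span_singleton)
      have "polar q y x = 0" using x y by (auto simp: N_def)
      then have "c * q x = 0" by (simp add: c bilinear_lmul[OF b] d)
      then show "y \<in> {0}" using qx c by simp
    qed
    then have "dim (U \<inter> span {x}) = 0" by (metis dim_eq_0)
    moreover have "x \<noteq> 0" using qx quadform_zero[OF q] by auto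
    ultimately have "dim ?U = dim U + 1"
      using dim_sums_Int[OF U(1) subspace_span[of "{x}"]] dim_singleton[of x] by (simp del: dim_eq_0)
    moreover have "dim ?U \<le> n_plus q S"
    proof (rule n_plus_ge)
      show "subspace ?U" by (rule subspace_sums[OF U(1) subspace_span])
      show "?U \<subseteq> S" using U(2) x S unfolding N_def
        by (auto simp: span_singleton intro!: subspace_add subspace_scale)
      show "posdef_on q ?U" unfolding posdef_on_def
      proof (intro ballI impI)
        fix v assume "v \<in> ?U" and v0: "v \<noteq> 0"
        then obtain u c where v: "v = u + c *\<^sub>R x" "u \<in> U" by (auto simp: span_singleton)
        have "polar q u (c *\<^sub>R x) = 0" using x v(2) by (simp add: bilinear_rmul[OF b] N_def)
        then have e: "q v = q u + c\<^sup>2 * q x"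
          unfolding v(1) quadform_add[OF q] by (simp add: quadform_scale[OF q])
        show "q v > 0"
        proof (cases "u = 0")
          case True
          then have "c \<noteq> 0" using v v0 by auto
          then show ?thesis using e qx True quadform_zero[OF q] by simp
        next
          case False
          then have "q u > 0" using U(3) v(2) by (auto simp: posdef_on_def)
          then show ?thesis using e qx by (simp add: add_pos_nonneg)
        qed
      qed
    qed
    ultimately show False using U(4) by simp
  qed
  have "dim U + dim N \<le> dim S"
    by (rule dim_posdef_nonpos[OF U(1) N(1) S U(2) _ U(3) nonpos]) (auto simp: N_def)
  then have "n_plus q S + dim N = dim S" using N(2) U(4) by simp
  with U N nonpos show ?thesis by (intro that[of U N]) (auto simp: N_def)
qed

text \<open>The product of the positive parts and the product of the nonpositive parts of the two
  decompositions have complementary dimensions, which bounds the index from both sides.\<close>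

lemma n_plus_Times:
  fixes q :: "'a::euclidean_space \<Rightarrow> real" and r :: "'b::euclidean_space \<Rightarrow> real"
  assumes q: "quadform q" and r: "quadform r" and S: "subspace S" and T: "subspace T"
  shows "n_plus (\<lambda>(x, y). q x + r y) (S \<times> T) = n_plus q S + n_plus r T"
proof -
  obtain U N where U: "subspace U" "subspace N" "U \<subseteq> S" "N \<subseteq> S" "posdef_on q U"
    "\<And>x. x \<in> N \<Longrightarrow> q x \<le> 0" "dim U = n_plus q S" "n_plus q S + dim N = dim S"
    using inertia_decomposition[OF q S] by metis
  obtain V M where V: "subspace V" "subspace M" "V \<subseteq> T" "M \<subseteq> T" "posdef_on r V"
    "\<And>x. x \<in> M \<Longrightarrow> r x \<le> 0" "dim V = n_plus r T" "n_plus r T + dim M = dim T"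
    using inertia_decomposition[OF r T] by metis
  let ?f = "\<lambda>(x, y). q x + r y"
  have "dim (U \<times> V) \<le> n_plus ?f (S \<times> T)"
  proof (rule n_plus_ge)
    show "posdef_on ?f (U \<times> V)"
      unfolding posdef_on_def
    proof (clarify)
      fix u v assume "u \<in> U" "v \<in> V" "(u, v) \<noteq> 0"
      moreover have "q u \<ge> 0" "r v \<ge> 0"
        using U(5) V(5) calculation quadform_zero[OF q] quadform_zero[OF r]
        unfolding posdef_on_def by (metis order.refl less_imp_le)+
      ultimately show "0 < q u + r v"
        using U(5) V(5) by (auto simp: posdef_on_def zero_prod_def add_pos_nonneg add_nonneg_pos)
    qed
  qed (use U V in \<open>auto intro: subspace_Times\<close>)
  moreover obtain P where P: "subspace P" "P \<subseteq> S \<times> T" "posdef_on ?f P" "dim P = n_plus ?f (S \<times> T)"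
    using n_plus_attained[OF subspace_Times[OF S T]] by blast
  have "dim P + dim (N \<times> M) \<le> dim (S \<times> T)"
  proof (rule dim_posdef_nonpos[OF P(1) subspace_Times[OF U(2) V(2)] subspace_Times[OF S T] P(2) _ P(3)])
    show "?f x \<le> 0" if "x \<in> N \<times> M" for x
      using that U(6) V(6) by (auto simp: add_nonpos_nonpos)
  qed (use U V in auto)
  ultimately show ?thesis
    using P(4) U V dim_Times[OF U(1) V(1)] dim_Times[OF U(2) V(2)] dim_Times[OF S T] by linarith
qed

text \<open>The sum is the restriction of the form \<open>q x + r y\<close> to the diagonal of
  \<open>S \<times> S\<close>.\<close>

lemma n_plus_add_le:
  fixes q r :: "'a::euclidean_space \<Rightarrow> real"
  assumes q: "quadform q" and r: "quadform r" and S: "subspace S"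
  shows "n_plus (\<lambda>x. q x + r x) S \<le> n_plus q S + n_plus r S"
proof -
  have "n_plus (\<lambda>x. q x + r x) S \<le> n_plus (\<lambda>(x, y). q x + r y) (S \<times> S)"
    by (rule n_plus_le_map[OF S, where f = "\<lambda>x. (x, x)"])
       (auto simp: zero_prod_def quadform_zero[OF q] quadform_zero[OF r] intro!: linearI)
  then show ?thesis using n_plus_Times[OF q r S S] by simp
qed

lemma subspace_form_radical:
  assumes "quadform q" "subspace S" shows "subspace (form_radical q S)"
proof -
  have b: "bilinear (polar q)" using assms by (auto simp: quadform_def)
  show ?thesis using assms(2)
    by (auto simp: form_radical_def subspace_def bilinear_ladd[OF b] bilinear_lmul[OF b] bilinear_lzero[OF b])
qed

text \<open>Along the line \<open>c x + y\<close> the form is affine in \<open>c\<close> with slope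
  \<open>2 * polar q x y\<close>; a nonzero slope would make it positive somewhere on
  \<open>N\<close>. The chosen \<open>c\<close> is where its value is 1.\<close>

lemma nonpos_isotropic_in_form_radical:
  fixes q :: "'a::euclidean_space \<Rightarrow> real"
  assumes q: "quadform q" and N: "subspace N" "\<And>x. x \<in> N \<Longrightarrow> q x \<le> 0"
    and x: "x \<in> N" "q x = 0" and y: "y \<in> N"
  shows "polar q x y = 0"
proof (rule ccontr)
  have b: "bilinear (polar q)" using q by (auto simp: quadform_def)
  assume "polar q x y \<noteq> 0"
  define p where "p = polar q x y"
  define c where "c = (1 - q y) / (2 * p)"
  have p: "p \<noteq> 0" by (simp add: p_def \<open>polar q x y \<noteq> 0\<close>)
  have "q (c *\<^sub>R x + y) = 2 * c * p + q y"
    unfolding quadform_add[OF q] quadform_scale[OF q] by (simp add: x bilinear_lmul[OF b] p_def)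
  also have "\<dots> = 1" using p by (simp add: c_def field_simps)
  finally have "q (c *\<^sub>R x + y) = 1" .
  moreover have "q (c *\<^sub>R x + y) \<le> 0"
    by (rule N(2)) (use N x y in \<open>auto intro: subspace_add subspace_scale\<close>)
  ultimately show False by simp
qed

text \<open>Sylvester's law with nullity. A maximal negative subspace plus the radical is
  nonpositive, which gives one inequality. For the other, isotropic vectors of the nonpositive part
  \<open>N\<close> already lie in the radical, so a subspace of \<open>N\<close> avoiding the
  radical is negative definite.\<close>

theorem inertia_sum:
  fixes q :: "'a::euclidean_space \<Rightarrow> real"
  assumes q: "quadform q" and S: "subspace S"
  shows "n_plus q S + n_minus q S + dim (form_radical q S) = dim S"
proof (rule antisym)
  have b: "bilinear (polar q)" and d: "\<And>x. polar q x x = q x"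
    using q by (auto simp: quadform_def)
  obtain U N where U: "subspace U" "subspace N" "U \<subseteq> S" "N \<subseteq> S" "posdef_on q U"
    "\<And>x. x \<in> N \<Longrightarrow> q x \<le> 0" "dim U = n_plus q S" "n_plus q S + dim N = dim S"
    "\<And>u x. u \<in> U \<Longrightarrow> x \<in> N \<Longrightarrow> polar q u x = 0"
    using inertia_decomposition[OF q S] by metis
  note sR = subspace_form_radical[OF q S]
  obtain M where M: "subspace M" "M \<subseteq> S" "posdef_on (\<lambda>x. - q x) M" "dim M = n_minus q S"
    unfolding n_minus_eq using n_plus_attained[OF S] by blast
  let ?R = "form_radical q S"
  let ?MR = "{x + y |x y. x \<in> M \<and> y \<in> ?R}"
  have Rq: "q x = 0" if "x \<in> ?R" for x using that d[of x] by (auto simp: form_radical_def)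
  have "M \<inter> ?R \<subseteq> {0}" using M(3) Rq by (force simp: posdef_on_def)
  then have "dim (M \<inter> ?R) = 0" by (metis dim_eq_0)
  then have dMR: "dim ?MR = dim M + dim ?R" using dim_sums_Int[OF M(1) sR] by linarith
  have MRS: "?MR \<subseteq> S" using M(2) S by (auto simp: form_radical_def intro: subspace_add)
  have MRn: "q x \<le> 0" if xMR: "x \<in> ?MR" for x
  proof -
    obtain m r where x: "x = m + r" "m \<in> M" "r \<in> ?R" using xMR by blast
    have "polar q m r = 0" using x M(2) polar_commute[of q m r] by (auto simp: form_radical_def)
    then have "q x = q m" using x Rq by (simp add: quadform_add[OF q])
    also have "\<dots> \<le> 0"
      using M(3) x(2) quadform_zero[OF q] by (cases "m = 0") (auto simp: posdef_on_def)
    finally show ?thesis .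
  qed
  have "dim U + dim ?MR \<le> dim S"
    by (rule dim_posdef_nonpos[OF U(1) subspace_sums[OF M(1) sR] S U(3) MRS U(5) MRn])
  then show "n_plus q S + n_minus q S + dim (form_radical q S) \<le> dim S"
    using dMR M U by simp
  have "U \<inter> N \<subseteq> {0}" using U(5,6) by (force simp: posdef_on_def)
  then have "dim (U \<inter> N) = 0" by (metis dim_eq_0)
  then have dUN: "dim {x + y |x y. x \<in> U \<and> y \<in> N} = dim S"
    using dim_sums_Int[OF U(1,2)] U(7,8) by linarith
  have UN: "{x + y |x y. x \<in> U \<and> y \<in> N} = S"
    by (rule subspace_dim_equal[OF subspace_sums[OF U(1,2)] S])
       (use U S dUN in \<open>auto intro: subspace_add\<close>)
  have isoR: "x \<in> ?R" if x: "x \<in> N" "q x = 0" for x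
  proof -
    have "polar q x y = 0" if y: "y \<in> S" for y
    proof -
      obtain u n where "y = u + n" "u \<in> U" "n \<in> N" using y UN by blast
      then show ?thesis
        using nonpos_isotropic_in_form_radical[OF q U(2,6) x] U(9)[OF _ x(1)] polar_commute[of q x u]
        by (simp add: bilinear_radd[OF b])
    qed
    then show ?thesis using x U by (auto simp: form_radical_def)
  qed
  \<comment> \<open>The Euclidean inner product only serves to cut out a subspace of
    \<open>N\<close> that meets the radical trivially and has dimension at least
    \<open>dim N - dim ?R\<close>.\<close>
  have dC: "subspace {x\<in>N. \<forall>u\<in>?R. u \<bullet> x = 0}" "dim N \<le> dim {x\<in>N. \<forall>u\<in>?R. u \<bullet> x = 0} + dim ?R"
  proof -
    have "bilinear ((\<bullet>) :: 'a \<Rightarrow> 'a \<Rightarrow> real)"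
      by (simp add: bilinear_def linear_iff inner_add_left inner_add_right)
    from dim_annihilator[OF this sR U(2)]
    show "subspace {x\<in>N. \<forall>u\<in>?R. u \<bullet> x = 0}" "dim N \<le> dim {x\<in>N. \<forall>u\<in>?R. u \<bullet> x = 0} + dim ?R"
      by auto
  qed
  have "dim {x\<in>N. \<forall>u\<in>?R. u \<bullet> x = 0} \<le> n_minus q S" unfolding n_minus_eq
  proof (rule n_plus_ge[OF dC(1)])
    show "posdef_on (\<lambda>x. - q x) {x\<in>N. \<forall>u\<in>?R. u \<bullet> x = 0}"
      unfolding posdef_on_def
    proof (clarify)
      fix x assume x: "x \<in> N" "\<forall>u\<in>?R. u \<bullet> x = 0" "x \<noteq> 0"
      then have "q x \<noteq> 0" using isoR[of x] inner_eq_zero_iff by blast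
      then show "0 < - q x" using U(6)[OF x(1)] by simp
    qed
  qed (use U in auto)
  then show "dim S \<le> n_plus q S + n_minus q S + dim (form_radical q S)"
    using dC(2) U by simp
qed

section \<open>Behaviour of the inertia indices under perturbation\<close>

lemma posdef_on_coercive:
  fixes q :: "'a::euclidean_space \<Rightarrow> real"
  assumes q: "quadform q" and U: "subspace U" and p: "posdef_on q U"
  obtains c where "c > 0" "\<And>u. u \<in> U \<Longrightarrow> q u \<ge> c * (norm u)\<^sup>2"
proof (cases "U \<subseteq> {0}")
  case True
  show ?thesis
    by (rule that[of 1]) (use True quadform_zero[OF q] in auto)
next
  case False
  have b: "bilinear (polar q)" and d: "\<And>x. polar q x x = q x"
    using q by (auto simp: quadform_def)
  let ?K = "U \<inter> sphere 0 1"
  obtain u0 where "u0 \<in> U" "u0 \<noteq> 0" using False by auto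
  then have "(1 / norm u0) *\<^sub>R u0 \<in> ?K" using U by (auto intro: subspace_scale)
  then have ne: "?K \<noteq> {}" by blast
  have K: "compact ?K"
    by (intro closed_Int_compact closed_subspace U compact_sphere)
  have "bounded_bilinear (polar q)" using b by (simp add: bilinear_conv_bounded_bilinear)
  then have "continuous_on ?K (\<lambda>x. polar q x x)"
    by (rule bounded_bilinear.continuous_on[OF _ continuous_on_id continuous_on_id])
  then have "continuous_on ?K q" by (simp add: d)
  from continuous_attains_inf[OF K ne this] obtain x where x: "x \<in> ?K" "\<forall>y\<in>?K. q x \<le> q y" by blast
  show ?thesis
  proof (rule that[of "q x"])
    show "q x > 0" using x p by (auto simp: posdef_on_def)
    fix u assume u: "u \<in> U"
    show "q u \<ge> q x * (norm u)\<^sup>2"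
    proof (cases "u = 0")
      case False
      have "(1 / norm u) *\<^sub>R u \<in> ?K" using U u False by (auto intro: subspace_scale)
      then have "q x \<le> (1 / norm u)\<^sup>2 * q u" using x quadform_scale[OF q] by metis
      then show ?thesis using False by (simp add: field_simps power2_eq_square)
    qed (simp add: quadform_zero[OF q])
  qed
qed

text \<open>On \<open>U + P\<close> the form \<open>q + t d\<close> is of order 1 on the
  \<open>q\<close>-positive part \<open>U\<close> and of order \<open>t\<close> on the part
  \<open>P\<close> of the radical. The mixed term is of order \<open>t\<close> times the product of
  the two norms and is absorbed by Young's inequality, so positivity survives an error that is small
  compared with \<open>t\<close>.\<close>

lemma n_plus_perturb:
  fixes q d :: "'a::euclidean_space \<Rightarrow> real"
  assumes q: "quadform q" and d: "quadform d" and S: "subspace S"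
    and P: "subspace P" "P \<subseteq> form_radical q S" "posdef_on d P"
  obtains e where "e > 0"
    "\<And>t r. 0 < t \<Longrightarrow> t \<le> e \<Longrightarrow> (\<And>x. x \<in> S \<Longrightarrow> \<bar>r x - q x - t * d x\<bar> \<le> e * t * (norm x)\<^sup>2) \<Longrightarrow>
       n_plus q S + dim P \<le> n_plus r S"
proof -
  have bq: "bilinear (polar q)" and dq: "\<And>x. polar q x x = q x"
    using q by (auto simp: quadform_def)
  obtain U where U: "subspace U" "U \<subseteq> S" "posdef_on q U" "dim U = n_plus q S"
    using n_plus_attained[OF S] by blast
  obtain c where c: "c > 0" "\<And>u. u \<in> U \<Longrightarrow> q u \<ge> c * (norm u)\<^sup>2"
    using posdef_on_coercive[OF q U(1,3)] by blast
  obtain c' where c': "c' > 0" "\<And>u. u \<in> P \<Longrightarrow> d u \<ge> c' * (norm u)\<^sup>2"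
    using posdef_on_coercive[OF d P(1,3)] by blast
  obtain B where B: "B > 0" "\<And>x y. \<bar>polar d x y\<bar> \<le> B * norm x * norm y"
    using quadform_bounded[OF d] by blast
  have dd: "polar d x x = d x" for x using d by (simp add: quadform_def)
  \<comment> \<open>\<open>K\<close> collects what the coefficient of \<open>a\<^sup>2\<close> loses
    per unit of \<open>t\<close>: \<open>4 * B\<^sup>2 / c'\<close> from Young's inequality,
    \<open>B\<close> from \<open>d u\<close>, and 2 from the error term. The bounds in
    \<open>e\<close> leave \<open>c / 2\<close> on \<open>U\<close> and \<open>t * (c' / 4)\<close>
    on \<open>P\<close>.\<close>
  define K where "K = 4 * B\<^sup>2 / c' + B + 2"
  have K: "K > 0" using B c' by (simp add: K_def add_pos_pos add_nonneg_pos)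
  define e where "e = min 1 (min (c' / 4) (c / (2 * K)))"
  have e: "e > 0" "e \<le> 1" "e \<le> c' / 4" "e * K \<le> c / 2"
  proof -
    show "e > 0" using c c' K by (simp add: e_def)
    show "e \<le> 1" "e \<le> c' / 4" by (simp_all add: e_def)
    have "e \<le> c / (2 * K)" by (simp add: e_def)
    then show "e * K \<le> c / 2" using K by (simp add: field_simps)
  qed
  let ?V = "{x + y |x y. x \<in> U \<and> y \<in> P}"
  have Pq: "q x = 0" if "x \<in> P" for x using that P(2) dq[of x] by (auto simp: form_radical_def)
  have "U \<inter> P \<subseteq> {0}" using U(3) Pq by (force simp: posdef_on_def)
  then have "dim (U \<inter> P) = 0" by (metis dim_eq_0)
  then have dV: "dim ?V = n_plus q S + dim P" using dim_sums_Int[OF U(1) P(1)] U(4) by linarith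
  have VS: "?V \<subseteq> S" using U(2) P(2) S by (auto simp: form_radical_def intro: subspace_add)
  \<comment> \<open>Stated over abstract reals so that the nonlinear products below are atoms for
    linear arithmetic.\<close>
  have gen: "c0 + A' - Z \<le> r0"
    if "q0 + A - X \<le> r0" "A' \<le> A" "X \<le> Y" "Y \<le> Z" "c0 \<le> q0" for q0 A X r0 A' Y Z c0 :: real
    using that by linarith
  show ?thesis
  proof (rule that[OF e(1)])
    fix t :: real and r
    assume t: "0 < t" "t \<le> e"
      and r: "\<And>x. x \<in> S \<Longrightarrow> \<bar>r x - q x - t * d x\<bar> \<le> e * t * (norm x)\<^sup>2"
    have "posdef_on r ?V" unfolding posdef_on_def
    proof (intro ballI impI)
      fix x assume xV: "x \<in> ?V" and x0: "x \<noteq> 0"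
      then obtain u p where x: "x = u + p" "u \<in> U" "p \<in> P" by blast
      define a b where "a = norm u" and "b = norm p"
      have ab: "a \<ge> 0" "b \<ge> 0" by (simp_all add: a_def b_def)
      have "polar q u p = 0" using x U(2) P(2) polar_commute[of q u p] by (auto simp: form_radical_def)
      then have qx: "q x \<ge> c * a\<^sup>2"
        using c(2)[OF x(2)] by (simp add: x quadform_add[OF q] Pq[OF x(3)] a_def)
      have "d u \<ge> - (B * a\<^sup>2)" using B(2)[of u u] by (simp add: dd a_def power2_eq_square mult.assoc)
      moreover have "polar d u p \<ge> - (B * a * b)" using B(2)[of u p] by (simp add: a_def b_def)
      moreover have "d p \<ge> c' * b\<^sup>2" using c'(2)[OF x(3)] by (simp add: b_def)
      ultimately have dx: "d x \<ge> c' * b\<^sup>2 - 2 * (B * a * b) - B * a\<^sup>2"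
        by (simp add: x quadform_add[OF d])
      \<comment> \<open>The square is chosen so that the mixed term costs only a quarter of the
        coercivity \<open>c'\<close> on \<open>P\<close>.\<close>
      have "0 \<le> (2 * B * a - c' * b / 2)\<^sup>2" by simp
      also have "\<dots> = c' * (4 * B\<^sup>2 / c' * a\<^sup>2 + c' / 4 * b\<^sup>2 - 2 * (B * a * b))"
        using c' by (simp add: power2_eq_square field_simps)
      finally have "2 * (B * a * b) \<le> 4 * B\<^sup>2 / c' * a\<^sup>2 + c' / 4 * b\<^sup>2"
        using c'(1) by (simp add: zero_le_mult_iff)
      with dx have dx': "d x \<ge> 3 * c' / 4 * b\<^sup>2 - (4 * B\<^sup>2 / c' + B) * a\<^sup>2"
        by (simp add: distrib_right)
      have "norm x \<le> a + b" by (simp add: x a_def b_def norm_triangle_ineq)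
      then have "(norm x)\<^sup>2 \<le> (a + b)\<^sup>2" by (simp add: power_mono)
      also have "\<dots> \<le> 2 * a\<^sup>2 + 2 * b\<^sup>2"
        using sum_squares_bound[of a b] by (simp add: power2_sum)
      finally have nx: "(norm x)\<^sup>2 \<le> 2 * a\<^sup>2 + 2 * b\<^sup>2" .
      have "x \<in> S" using VS xV by blast
      then have "r x \<ge> q x + t * d x - t * (e * (norm x)\<^sup>2)"
        using r[of x] by (simp add: abs_le_iff algebra_simps)
      moreover have "t * d x \<ge> t * (3 * c' / 4 * b\<^sup>2 - (4 * B\<^sup>2 / c' + B) * a\<^sup>2)"
        using dx' t(1) by (simp add: mult_left_mono)
      moreover have "t * (e * (norm x)\<^sup>2) \<le> t * (e * (2 * a\<^sup>2 + 2 * b\<^sup>2))"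
        using nx t e by (intro mult_left_mono) auto
      moreover have "e * (2 * a\<^sup>2 + 2 * b\<^sup>2) \<le> 2 * a\<^sup>2 + c' / 2 * b\<^sup>2"
        using mult_right_mono[OF e(2), of "a\<^sup>2"] mult_right_mono[OF e(3), of "b\<^sup>2"]
        by (simp add: algebra_simps)
      then have "t * (e * (2 * a\<^sup>2 + 2 * b\<^sup>2)) \<le> t * (2 * a\<^sup>2 + c' / 2 * b\<^sup>2)"
        using t(1) by (intro mult_left_mono) auto
      ultimately have "r x \<ge> c * a\<^sup>2 + t * (3 * c' / 4 * b\<^sup>2 - (4 * B\<^sup>2 / c' + B) * a\<^sup>2)
          - t * (2 * a\<^sup>2 + c' / 2 * b\<^sup>2)"
        using qx by (rule gen)
      also have "c * a\<^sup>2 + t * (3 * c' / 4 * b\<^sup>2 - (4 * B\<^sup>2 / c' + B) * a\<^sup>2)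
          - t * (2 * a\<^sup>2 + c' / 2 * b\<^sup>2) = (c - t * K) * a\<^sup>2 + t * (c' / 4) * b\<^sup>2"
        by (simp add: K_def algebra_simps)
      finally have "r x \<ge> (c - t * K) * a\<^sup>2 + t * (c' / 4) * b\<^sup>2" .
      moreover have "c / 2 \<le> c - t * K"
        using mult_right_mono[OF t(2) less_imp_le[OF K]] e(4) by linarith
      then have "c / 2 * a\<^sup>2 \<le> (c - t * K) * a\<^sup>2" by (intro mult_right_mono) auto
      moreover have "c / 2 * a\<^sup>2 + t * (c' / 4) * b\<^sup>2 > 0"
      proof (cases "a = 0")
        case True
        then have "b \<noteq> 0" using x x0 by (auto simp: a_def b_def)
        then show ?thesis using True t c' by simp
      next
        case False
        then show ?thesis using t c c' by (intro add_pos_nonneg) auto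
      qed
      ultimately show "r x > 0" by linarith
    qed
    from n_plus_ge[OF subspace_sums[OF U(1) P(1)] VS this]
    show "n_plus q S + dim P \<le> n_plus r S" using dV by simp
  qed
qed

text \<open>The case \<open>P = {0}\<close>, \<open>d = 0\<close> of the preceding estimate at
  \<open>t = e\<close>, where the admissible error \<open>e * t\<close> becomes
  \<open>e * e\<close>.\<close>

lemma n_plus_lower_semicont:
  fixes q :: "'a::euclidean_space \<Rightarrow> real"
  assumes q: "quadform q" and S: "subspace S"
  obtains e where "e > 0"
    "\<And>r. (\<And>x. x \<in> S \<Longrightarrow> \<bar>r x - q x\<bar> \<le> e * (norm x)\<^sup>2) \<Longrightarrow> n_plus q S \<le> n_plus r S"
proof -
  have z: "quadform (\<lambda>x::'a. 0)" using quadform_bilinear[of "\<lambda>x y::'a. 0::real"]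
    by (simp add: bilinear_def linear_iff)
  have P: "subspace {0}" "{0} \<subseteq> form_radical q S" "posdef_on (\<lambda>x::'a. 0) {0}"
    using subspace_0[OF subspace_form_radical[OF q S]] by (auto simp: posdef_on_def)
  obtain e where e: "e > 0" "\<And>t r. 0 < t \<Longrightarrow> t \<le> e \<Longrightarrow>
      (\<And>x. x \<in> S \<Longrightarrow> \<bar>r x - q x - t * 0\<bar> \<le> e * t * (norm x)\<^sup>2) \<Longrightarrow> n_plus q S + dim {0::'a} \<le> n_plus r S"
    using n_plus_perturb[OF q z S P] by blast
  show ?thesis
    by (rule that[of "e * e"]) (use e(1) e(2)[of e] in auto)
qed

text \<open>Both inertia indices can only grow under a small perturbation, and together with the
  nullity they add up to \<open>dim S\<close>. If the nullity does not drop, neither index can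
  grow.\<close>

lemma n_plus_locally_constant:
  fixes q :: "'a::euclidean_space \<Rightarrow> real"
  assumes q: "quadform q" and S: "subspace S"
  obtains e where "e > 0"
    "\<And>r. quadform r \<Longrightarrow> (\<And>x. x \<in> S \<Longrightarrow> \<bar>r x - q x\<bar> \<le> e * (norm x)\<^sup>2) \<Longrightarrow>
      dim (form_radical q S) \<le> dim (form_radical r S) \<Longrightarrow> n_plus r S = n_plus q S"
proof -
  obtain e1 where e1: "e1 > 0"
    "\<And>r. (\<And>x. x \<in> S \<Longrightarrow> \<bar>r x - q x\<bar> \<le> e1 * (norm x)\<^sup>2) \<Longrightarrow> n_plus q S \<le> n_plus r S"
    using n_plus_lower_semicont[OF q S] by blast
  obtain e2 where e2: "e2 > 0"
    "\<And>r. (\<And>x. x \<in> S \<Longrightarrow> \<bar>r x - - q x\<bar> \<le> e2 * (norm x)\<^sup>2) \<Longrightarrow> n_plus (\<lambda>x. - q x) S \<le> n_plus r S"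
    using n_plus_lower_semicont[OF quadform_minus[OF q] S] by blast
  show ?thesis
  proof (rule that[of "min e1 e2"])
    fix r :: "'a \<Rightarrow> real"
    assume r: "quadform r" "\<And>x. x \<in> S \<Longrightarrow> \<bar>r x - q x\<bar> \<le> min e1 e2 * (norm x)\<^sup>2"
      and dr: "dim (form_radical q S) \<le> dim (form_radical r S)"
    have le: "min e1 e2 * (norm x)\<^sup>2 \<le> e1 * (norm x)\<^sup>2" "min e1 e2 * (norm x)\<^sup>2 \<le> e2 * (norm x)\<^sup>2" for x :: 'a
      by (auto intro: mult_right_mono)
    have "n_plus q S \<le> n_plus r S"
      using r(2) le(1) by (intro e1(2)) (meson order_trans)
    moreover have "n_minus q S \<le> n_minus r S" unfolding n_minus_eq
    proof (rule e2(2))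
      fix x assume "x \<in> S"
      then show "\<bar>- r x - - q x\<bar> \<le> e2 * (norm x)\<^sup>2" using r(2)[of x] le(2)[of x] by linarith
    qed
    ultimately show "n_plus r S = n_plus q S"
      using inertia_sum[OF q S] inertia_sum[OF r(1) S] dr by linarith
  qed (use e1 e2 in auto)
qed

text \<open>Nondegeneracy of the derivative on the nontrivial part \<open>K\<close> of the kernel makes the two
  semicontinuity estimates for the positive and the negative index sharp.\<close>

lemma n_plus_regular_perturb:
  fixes q d :: "'a::euclidean_space \<Rightarrow> real"
  assumes q: "quadform q" and d: "quadform d" and S: "subspace S"
    and K: "subspace K" "K \<subseteq> form_radical q S" "qf_nondegenerate d K"
    and k: "dim (form_radical q S) = dim K + k"
  obtains e where "e > 0"
    "\<And>t r. 0 < t \<Longrightarrow> t \<le> e \<Longrightarrow> quadform r \<Longrightarrow>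
       (\<And>x. x \<in> S \<Longrightarrow> \<bar>r x - q x - t * d x\<bar> \<le> e * t * (norm x)\<^sup>2) \<Longrightarrow>
       k \<le> dim (form_radical r S) \<Longrightarrow>
       n_plus r S = n_plus q S + n_plus d K \<and> dim (form_radical r S) = k"
proof -
  obtain P where P: "subspace P" "P \<subseteq> K" "posdef_on d P" "dim P = n_plus d K"
    using n_plus_attained[OF K(1)] by blast
  obtain M where M: "subspace M" "M \<subseteq> K" "posdef_on (\<lambda>x. - d x) M" "dim M = n_minus d K"
    unfolding n_minus_eq using n_plus_attained[OF K(1)] by blast
  have "form_radical (\<lambda>x. - q x) S = form_radical q S"
    by (auto simp: form_radical_def polar_def)
  then have sub: "P \<subseteq> form_radical q S" "M \<subseteq> form_radical (\<lambda>x. - q x) S" using P M K by auto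
  obtain e1 where e1: "e1 > 0" "\<And>t r. 0 < t \<Longrightarrow> t \<le> e1 \<Longrightarrow>
       (\<And>x. x \<in> S \<Longrightarrow> \<bar>r x - q x - t * d x\<bar> \<le> e1 * t * (norm x)\<^sup>2) \<Longrightarrow> n_plus q S + dim P \<le> n_plus r S"
    using n_plus_perturb[OF q d S P(1) sub(1) P(3)] by blast
  obtain e2 where e2: "e2 > 0" "\<And>t r. 0 < t \<Longrightarrow> t \<le> e2 \<Longrightarrow>
       (\<And>x. x \<in> S \<Longrightarrow> \<bar>r x - - q x - t * - d x\<bar> \<le> e2 * t * (norm x)\<^sup>2) \<Longrightarrow>
       n_plus (\<lambda>x. - q x) S + dim M \<le> n_plus r S"
    using n_plus_perturb[OF quadform_minus[OF q] quadform_minus[OF d] S M(1) sub(2) M(3)] by blast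
  have "form_radical d K \<subseteq> {0}" using K(3) by (auto simp: form_radical_def qf_nondegenerate_def)
  then have "dim (form_radical d K) = 0" by (metis dim_eq_0)
  then have dK: "n_plus d K + n_minus d K = dim K" using inertia_sum[OF d K(1)] by linarith
  show ?thesis
  proof (rule that[of "min e1 e2"])
    fix t :: real and r :: "'a \<Rightarrow> real"
    assume t: "0 < t" "t \<le> min e1 e2" and r: "quadform r"
      "\<And>x. x \<in> S \<Longrightarrow> \<bar>r x - q x - t * d x\<bar> \<le> min e1 e2 * t * (norm x)\<^sup>2"
      and kr: "k \<le> dim (form_radical r S)"
    have le: "min e1 e2 * t * (norm x)\<^sup>2 \<le> e1 * t * (norm x)\<^sup>2"
      "min e1 e2 * t * (norm x)\<^sup>2 \<le> e2 * t * (norm x)\<^sup>2" for x :: 'a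
      using t by (auto intro!: mult_right_mono)
    have "n_plus q S + dim P \<le> n_plus r S"
    proof (rule e1(2)[of t])
      fix x assume "x \<in> S"
      then show "\<bar>r x - q x - t * d x\<bar> \<le> e1 * t * (norm x)\<^sup>2"
        using r(2)[of x] le(1)[of x] by linarith
    qed (use t in auto)
    moreover have "n_minus q S + dim M \<le> n_minus r S" unfolding n_minus_eq
    proof (rule e2(2)[of t])
      fix x assume "x \<in> S"
      then show "\<bar>- r x - - q x - t * - d x\<bar> \<le> e2 * t * (norm x)\<^sup>2"
        using r(2)[of x] le(2)[of x] by (simp add: algebra_simps abs_le_iff)
    qed (use t in auto)
    ultimately show "n_plus r S = n_plus q S + n_plus d K \<and> dim (form_radical r S) = k"
      using inertia_sum[OF q S] inertia_sum[OF r(1) S] kr k dK P(4) M(4) by linarith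
  qed (use e1 e2 in auto)
qed

section \<open>Projections and chart forms\<close>

definition complementary :: "'a::real_vector set \<Rightarrow> 'a set \<Rightarrow> bool" where
  "complementary W l \<longleftrightarrow> subspace W \<and> subspace l \<and> W \<inter> l = {0} \<and> (\<forall>v. \<exists>w\<in>W. v - w \<in> l)"

definition pr :: "'a::real_vector set \<Rightarrow> 'a set \<Rightarrow> 'a \<Rightarrow> 'a" where
  "pr W l v = (THE w. w \<in> W \<and> v - w \<in> l)"

lemma pr_unique:
  assumes "complementary W l" "w \<in> W" "v - w \<in> l"
  shows "pr W l v = w"
  unfolding pr_def
proof (rule the_equality)
  fix w' assume w': "w' \<in> W \<and> v - w' \<in> l"
  have "w' - w \<in> W" using assms w' by (auto simp: complementary_def intro: subspace_diff)
  moreover have "(v - w) - (v - w') \<in> l"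
    using assms w' unfolding complementary_def by (blast intro: subspace_diff)
  then have "w' - w \<in> l" by (simp add: algebra_simps)
  ultimately have "w' - w \<in> W \<inter> l" by blast
  then show "w' = w" using assms(1) unfolding complementary_def by simp
qed (use assms in auto)

lemma pr_in:
  assumes "complementary W l"
  shows "pr W l v \<in> W" "v - pr W l v \<in> l"
proof -
  obtain w where "w \<in> W" "v - w \<in> l" using assms by (auto simp: complementary_def)
  then show "pr W l v \<in> W" "v - pr W l v \<in> l" using pr_unique[OF assms] by auto
qed

lemma pr_left: "complementary W l \<Longrightarrow> w \<in> W \<Longrightarrow> pr W l w = w"
  by (rule pr_unique) (auto simp: complementary_def subspace_0)

lemma pr_right: "complementary W l \<Longrightarrow> x \<in> l \<Longrightarrow> pr W l x = 0"
  by (rule pr_unique) (auto simp: complementary_def subspace_0)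

lemma linear_pr:
  assumes "complementary W l" shows "linear (pr W l)"
proof (rule linearI)
  note pr_in[OF assms]
  moreover have "subspace W" "subspace l" using assms by (auto simp: complementary_def)
  ultimately show "pr W l (x + y) = pr W l x + pr W l y" for x y
    using subspace_add[of l "x - pr W l x" "y - pr W l y"]
    by (intro pr_unique[OF assms]) (auto intro: subspace_add simp: algebra_simps)
  show "pr W l (c *\<^sub>R x) = c *\<^sub>R pr W l x" for c x
    using pr_in[OF assms] \<open>subspace W\<close> \<open>subspace l\<close> subspace_scale[of l "x - pr W l x" c]
    by (intro pr_unique[OF assms]) (auto intro: subspace_scale simp: algebra_simps)
qed

lemma complementary_if_dim:
  fixes W l :: "'a::euclidean_space set"
  assumes "subspace W" "subspace l" "W \<inter> l = {0}" "DIM('a) \<le> dim W + dim l"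
  shows "complementary W l"
proof -
  let ?S = "{x + y |x y. x \<in> W \<and> y \<in> l}"
  have "dim (W \<inter> l) = 0" using assms(3) by simp
  then have "dim ?S \<ge> DIM('a)" using dim_sums_Int[OF assms(1,2)] assms(4) by linarith
  then have "?S = UNIV"
    using dim_subset_UNIV[of ?S] subspace_dim_equal[OF subspace_sums[OF assms(1,2)] subspace_UNIV] by simp
  then have "\<exists>w\<in>W. v - w \<in> l" for v
  proof -
    have "v \<in> ?S" using \<open>?S = UNIV\<close> by simp
    then show ?thesis by force
  qed
  then show ?thesis using assms by (auto simp: complementary_def)
qed

section \<open>Lagrangian subspaces and their chart forms\<close>

locale symplectic_space =
  fixes \<omega> :: "'a::euclidean_space \<Rightarrow> 'a \<Rightarrow> real"
  assumes symplectic: "symplectic_form \<omega>"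
begin

lemma bilinear_omega: "bilinear \<omega>"
  using symplectic unfolding symplectic_form_def bilinear_def by blast

lemmas omega_simps = bilinear_ladd[OF bilinear_omega] bilinear_radd[OF bilinear_omega]
  bilinear_lsub[OF bilinear_omega] bilinear_rsub[OF bilinear_omega]
  bilinear_lmul[OF bilinear_omega] bilinear_rmul[OF bilinear_omega]
  bilinear_lneg[OF bilinear_omega] bilinear_rneg[OF bilinear_omega]
  bilinear_lzero[OF bilinear_omega] bilinear_rzero[OF bilinear_omega]

lemma omega_skew: "\<omega> x y = - \<omega> y x"
  using symplectic unfolding symplectic_form_def by blast

lemma omega_self: "\<omega> x x = 0"
  using omega_skew[of x x] by simp

lemma omega_nondegenerate: "(\<And>y. \<omega> x y = 0) \<Longrightarrow> x = 0"
  using symplectic unfolding symplectic_form_def by blast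

lemma omega_bounded: obtains B where "B > 0" "\<And>x y. \<bar>\<omega> x y\<bar> \<le> B * norm x * norm y"
  using bilinear_bounded_pos[OF bilinear_omega] by auto

lemma lagrangian_subspace: "lagrangian \<omega> L \<Longrightarrow> subspace L"
  by (simp add: lagrangian_def)

lemma lagrangian_isotropic: "lagrangian \<omega> L \<Longrightarrow> x \<in> L \<Longrightarrow> y \<in> L \<Longrightarrow> \<omega> x y = 0"
  by (auto simp: lagrangian_def symp_compl_def)

lemma lagrangian_maximal: "lagrangian \<omega> L \<Longrightarrow> (\<And>x. x \<in> L \<Longrightarrow> \<omega> x y = 0) \<Longrightarrow> y \<in> L"
  by (auto simp: lagrangian_def symp_compl_def)

lemma dim_symp_compl:
  assumes "subspace L"
  shows "dim (symp_compl \<omega> L) + dim L = DIM('a)" "subspace (symp_compl \<omega> L)"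
proof -
  obtain G where G: "linear G" "\<And>x y. \<omega> x y = G x \<bullet> y" using bilinear_repr[OF bilinear_omega] by blast
  have "inj G"
    using omega_nondegenerate G(2) by (subst linear_injective_0[OF G(1)]) auto
  then have "dim (G ` L) = dim L" by (intro dim_image_eq[OF G(1)]) (auto intro: inj_on_subset)
  moreover have "dim {y\<in>UNIV. \<forall>x\<in>G ` L. orthogonal x y} + dim (G ` L) = DIM('a)"
    using dim_subspace_orthogonal_to_vectors[OF linear_subspace_image[OF G(1) assms] subspace_UNIV] by simp
  moreover have "{y\<in>UNIV. \<forall>x\<in>G ` L. orthogonal x y} = symp_compl \<omega> L"
    by (auto simp: symp_compl_def G(2) orthogonal_def)
  ultimately show "dim (symp_compl \<omega> L) + dim L = DIM('a)" by simp
  show "subspace (symp_compl \<omega> L)" by (auto simp: subspace_def symp_compl_def omega_simps)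
qed

lemma dim_lagrangian:
  assumes "lagrangian \<omega> L" shows "2 * dim L = DIM('a)"
  using dim_symp_compl(1)[of L] assms by (simp add: lagrangian_def)

lemma lagrangianI:
  assumes "subspace L" "\<And>x y. x \<in> L \<Longrightarrow> y \<in> L \<Longrightarrow> \<omega> x y = 0" "DIM('a) \<le> 2 * dim L"
  shows "lagrangian \<omega> L"
proof -
  have "L \<subseteq> symp_compl \<omega> L" using assms(2) by (auto simp: symp_compl_def)
  then have "L = symp_compl \<omega> L"
    using dim_symp_compl[OF assms(1)] assms(1,3) by (intro subspace_dim_equal) auto
  then show ?thesis using assms(1) by (simp add: lagrangian_def)
qed

definition transversal :: "'a set \<Rightarrow> 'a set \<Rightarrow> bool" where
  "transversal W l \<longleftrightarrow> lagrangian \<omega> W \<and> lagrangian \<omega> l \<and> W \<inter> l = {0}"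

lemma transversal_complementary: "transversal W l \<Longrightarrow> complementary W l"
  using dim_lagrangian[of W] dim_lagrangian[of l]
  by (intro complementary_if_dim) (auto simp: transversal_def lagrangian_subspace)

text \<open>The unique \<open>w \<in> W\<close> with \<open>v + w \<in> l\<close> is
  \<open>- pr W l v\<close>, so this is \<open>\<omega> v w\<close>, the quantity whose derivative
  along a path defines the crossing form. It is defined on the whole space, so that it can be
  restricted to any Lagrangian.\<close>

definition chart_form :: "'a set \<Rightarrow> 'a set \<Rightarrow> 'a \<Rightarrow> real" where
  "chart_form W l v = \<omega> (pr W l v) v"

lemma quadform_chart_form:
  assumes "transversal W l" shows "quadform (chart_form W l)"
proof -
  note lin = linear_pr[OF transversal_complementary[OF assms]]
  have "bilinear (\<lambda>x y. \<omega> (pr W l x) y)"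
    unfolding bilinear_def by (auto intro!: linearI simp: omega_simps linear_add[OF lin] linear_cmul[OF lin])
  from quadform_bilinear[OF this] show ?thesis by (simp add: chart_form_def[abs_def])
qed

text \<open>Isotropy of \<open>W\<close> and of \<open>l\<close> shows that the bilinear form
  \<open>\<omega> (pr W l u) v\<close> fails to be symmetric by exactly \<open>\<omega> u v\<close>.
  It is therefore symmetric on every Lagrangian.\<close>

lemma polar_chart_form:
  assumes t: "transversal W l" and "\<omega> u v = 0"
  shows "polar (chart_form W l) u v = \<omega> (pr W l u) v"
proof -
  note c = transversal_complementary[OF t]
  note lin = linear_pr[OF c]
  have b: "bilinear (\<lambda>x y. \<omega> (pr W l x) y)"
    unfolding bilinear_def by (auto intro!: linearI simp: omega_simps linear_add[OF lin] linear_cmul[OF lin])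
  have W: "\<omega> (pr W l u) (pr W l v) = 0"
    using t pr_in[OF c] by (auto simp: transversal_def intro: lagrangian_isotropic)
  have "\<omega> (u - pr W l u) (v - pr W l v) = 0"
    using t pr_in[OF c] by (auto simp: transversal_def intro: lagrangian_isotropic)
  then have "\<omega> (pr W l u) v = - \<omega> u (pr W l v)" using W assms(2) by (simp add: omega_simps)
  then have "\<omega> (pr W l u) v = \<omega> (pr W l v) u" using omega_skew[of u "pr W l v"] by simp
  then show ?thesis using polar_bilinear[OF b, of u v] by (simp add: chart_form_def[abs_def])
qed

text \<open>A vector \<open>u\<close> of \<open>L\<close> is in the radical iff
  \<open>pr W l u\<close> is \<open>\<omega>\<close>-orthogonal to \<open>L\<close>, that is, iff it
  lies in \<open>L\<close> by maximality; then \<open>u\<close> splits into its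
  \<open>l\<close>-part and its \<open>W\<close>-part inside \<open>L\<close>. Crossings thus show
  up as nullity, on top of the constant \<open>dim (L \<inter> W)\<close>.\<close>

lemma dim_form_radical_chart_form:
  assumes t: "transversal W l" and L: "lagrangian \<omega> L"
  shows "L \<inter> l \<subseteq> form_radical (chart_form W l) L"
    and "dim (form_radical (chart_form W l) L) = dim (L \<inter> l) + dim (L \<inter> W)"
proof -
  note c = transversal_complementary[OF t]
  have sub: "subspace L" "subspace W" "subspace l" using t L by (auto simp: transversal_def lagrangian_subspace)
  have pol: "polar (chart_form W l) u v = \<omega> (pr W l u) v" if "u \<in> L" "v \<in> L" for u v
    using polar_chart_form[OF t lagrangian_isotropic[OF L that]] .
  have eq: "form_radical (chart_form W l) L = {x + y |x y. x \<in> L \<inter> l \<and> y \<in> L \<inter> W}" (is "_ = ?S")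
  proof (intro set_eqI iffI)
    fix u assume u: "u \<in> form_radical (chart_form W l) L"
    then have uL: "u \<in> L" and "\<And>v. v \<in> L \<Longrightarrow> \<omega> (pr W l u) v = 0"
      using pol by (auto simp: form_radical_def)
    then have "pr W l u \<in> L"
      using omega_skew by (intro lagrangian_maximal[OF L]) (metis neg_equal_0_iff_equal)
    then have "u - pr W l u \<in> L \<inter> l" "pr W l u \<in> L \<inter> W"
      using uL sub pr_in[OF c] by (auto intro: subspace_diff)
    moreover have "u = (u - pr W l u) + pr W l u" by simp
    ultimately show "u \<in> ?S" by blast
  next
    fix u assume "u \<in> ?S"
    then obtain x y where u: "u = x + y" "x \<in> L" "x \<in> l" "y \<in> L" "y \<in> W" by auto
    have "pr W l u = y" using u by (intro pr_unique[OF c]) auto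
    then show "u \<in> form_radical (chart_form W l) L"
      using u sub pol by (auto simp: form_radical_def subspace_add lagrangian_isotropic[OF L])
  qed
  show "L \<inter> l \<subseteq> form_radical (chart_form W l) L"
    unfolding eq using sub subspace_0[of W] subspace_0[of L] by force
  have "(L \<inter> l) \<inter> (L \<inter> W) \<subseteq> {0}" using t by (auto simp: transversal_def)
  then have "dim ((L \<inter> l) \<inter> (L \<inter> W)) = 0" by (metis dim_eq_0)
  moreover have "dim ?S + dim ((L \<inter> l) \<inter> (L \<inter> W)) = dim (L \<inter> l) + dim (L \<inter> W)"
    by (intro dim_sums_Int subspace_inter sub)
  ultimately show "dim (form_radical (chart_form W l) L) = dim (L \<inter> l) + dim (L \<inter> W)"
    unfolding eq by linarith
qed

lemma lagrangian_image:
  assumes L: "lagrangian \<omega> L" and A: "linear A" "bij A" "\<And>x y. \<omega> (A x) (A y) = \<omega> x y"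
  shows "lagrangian \<omega> (A ` L)"
proof (rule lagrangianI)
  show "subspace (A ` L)" by (rule linear_subspace_image[OF A(1) lagrangian_subspace[OF L]])
  have "dim (A ` L) = dim L"
    using A by (intro dim_image_eq[OF A(1)]) (auto simp: bij_def intro: inj_on_subset)
  then show "DIM('a) \<le> 2 * dim (A ` L)" using dim_lagrangian[OF L] by simp
qed (use L A lagrangian_isotropic in auto)

lemma chart_form_image:
  assumes t: "transversal W l" and A: "linear A" "bij A" "\<And>x y. \<omega> (A x) (A y) = \<omega> x y"
  shows "chart_form (A ` W) (A ` l) (A v) = chart_form W l v"
    and "transversal (A ` W) (A ` l)"
proof -
  note c = transversal_complementary[OF t]
  have "A ` W \<inter> A ` l = {0}"
    using A t linear_0[OF A(1)] by (simp add: image_Int[symmetric] bij_def transversal_def)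
  then show t': "transversal (A ` W) (A ` l)" using t lagrangian_image[OF _ A] by (auto simp: transversal_def)
  have "pr (A ` W) (A ` l) (A v) = A (pr W l v)"
    using pr_in[OF c] by (intro pr_unique[OF transversal_complementary[OF t']])
      (auto simp: linear_diff[OF A(1), symmetric])
  then show "chart_form (A ` W) (A ` l) (A v) = chart_form W l v"
    by (simp add: chart_form_def A)
qed

text \<open>Both sides are the positive index of one quadratic form on \<open>L \<times> W\<close>, diagonalised by
  completing the square in either variable. The last term does not depend on \<open>l\<close>.\<close>

lemma chart_change:
  assumes t1: "transversal W' L" and t2: "transversal W' l" and t3: "transversal W l"
  shows "n_plus (chart_form W l) L + n_plus (chart_form W' l) W =
         n_plus (chart_form W' l) L + n_plus (chart_form W' L) W"
proof -
  note c1 = transversal_complementary[OF t1] and c2 = transversal_complementary[OF t2]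
    and c3 = transversal_complementary[OF t3]
  note l1 = linear_pr[OF c1] and l2 = linear_pr[OF c2] and l3 = linear_pr[OF c3]
  have lag: "lagrangian \<omega> W" "lagrangian \<omega> W'" "lagrangian \<omega> l" "lagrangian \<omega> L"
    using t1 t2 t3 by (auto simp: transversal_def)
  note sub = lag[THEN lagrangian_subspace]
  note iso = lag[THEN lagrangian_isotropic]
  have key: "chart_form W l v + chart_form W' l u =
      chart_form W' l (v + (w - pr W' L w)) + chart_form W' L w"
    if "v \<in> L" "u \<in> W" "w = u - pr W l v" for v u w
  proof -
    define a x where "a = pr W l v" and "x = v - a"
    define u' where "u' = pr W' l u"
    define s where "s = pr W' L w"
    have a: "a \<in> W" "x \<in> l" using pr_in[OF c3] by (auto simp: a_def x_def)
    have u: "u' \<in> W'" "u - u' \<in> l" using pr_in[OF c2] by (auto simp: u'_def)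
    have s: "s \<in> W'" "w - s \<in> L" using pr_in[OF c1] by (auto simp: s_def)
    have wa: "w = u - a" using that by (simp add: a_def)
    have va: "pr W' l v = pr W' l a"
      using linear_add[OF l2, of a x] pr_right[OF c2 a(2)] by (simp add: x_def)
    have "pr W' l (v + (w - s)) = pr W' l v + (pr W' l u - pr W' l a - pr W' l s)"
      by (simp add: wa linear_add[OF l2] linear_diff[OF l2])
    also have "\<dots> = u' - s" using pr_left[OF c2 s(1)] va by (simp add: u'_def)
    finally have p: "pr W' l (v + (w - s)) = u' - s" .
    have e: "\<omega> u' s = 0" "\<omega> s s = 0" "\<omega> (w - s) v = 0" "\<omega> (u - u') x = 0" "\<omega> u a = 0"
      using u s a that by (auto intro: iso)
    have e1: "\<omega> s v = \<omega> u v - \<omega> a v" using e(3) by (simp add: omega_simps wa)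
    have e2: "\<omega> u' v - \<omega> u' a = \<omega> u v" using e(4,5) by (simp add: omega_simps x_def)
    have e3: "\<omega> u' w = \<omega> u' u - \<omega> u' a" by (simp add: wa omega_simps)
    have "chart_form W' l (v + (w - s)) + \<omega> s w = \<omega> (u' - s) (v + (w - s)) + \<omega> s w"
      by (simp add: chart_form_def p)
    also have "\<dots> = \<omega> u' v + \<omega> u' w - \<omega> s v" using e by (simp add: omega_simps)
    also have "\<dots> = \<omega> a v + \<omega> u' u" using e1 e2 e3 by simp
    finally show ?thesis by (simp add: chart_form_def a_def u'_def s_def)
  qed
  define P where "P = (\<lambda>(v, u). chart_form W l v + chart_form W' l u)"
  define Q where "Q = (\<lambda>(v, u). chart_form W' l v + chart_form W' L u)"
  define f where "f = (\<lambda>(v, u). (v + ((u - pr W l v) - pr W' L (u - pr W l v)), u - pr W l v))"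
  \<comment> \<open>\<open>f\<close> outputs \<open>w = u - pr W l v\<close> as its second
    component, so \<open>v\<close> can be recovered from the first one, and then
    \<open>u = w + pr W l v\<close>.\<close>
  define g where "g = (\<lambda>(v, w). (v - (w - pr W' L w), w + pr W l (v - (w - pr W' L w))))"
  have lf: "linear f" unfolding f_def
    by (rule linearI)
      (auto simp: linear_add[OF l1] linear_add[OF l3] linear_diff[OF l1] linear_diff[OF l3]
        linear_cmul[OF l1] linear_cmul[OF l3] algebra_simps)
  have lg: "linear g" unfolding g_def
    by (rule linearI)
      (auto simp: linear_add[OF l1] linear_add[OF l3] linear_diff[OF l1] linear_diff[OF l3]
        linear_cmul[OF l1] linear_cmul[OF l3] algebra_simps)
  have fim: "f ` (L \<times> W) \<subseteq> L \<times> W" unfolding f_def g_def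
    using pr_in[OF c1] pr_in[OF c3] by (auto intro!: subspace_add[OF sub(4)] subspace_diff[OF sub(1)])
  have gim: "g ` (L \<times> W) \<subseteq> L \<times> W" unfolding f_def g_def
    using pr_in(1)[OF c3]
    by (auto intro!: subspace_diff[OF sub(4) _ pr_in(2)[OF c1]] subspace_add[OF sub(1)])
  have QfP: "Q (f x) = P x" if "x \<in> L \<times> W" for x using that key by (auto simp: P_def Q_def f_def)
  have fg: "f (g x) = x" for x by (cases x) (simp add: f_def g_def)
  have PgQ: "P (g x) = Q x" if x: "x \<in> L \<times> W" for x
  proof -
    have "g x \<in> L \<times> W" using gim x by blast
    then show ?thesis using QfP[of "g x"] fg[of x] by simp
  qed
  have q: "quadform (chart_form W l)" "quadform (chart_form W' l)" "quadform (chart_form W' L)"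
    using quadform_chart_form t1 t2 t3 by auto
  have z: "P 0 \<le> 0" "Q 0 \<le> 0" by (simp_all add: P_def Q_def zero_prod_def quadform_zero q)
  have "n_plus P (L \<times> W) = n_plus Q (L \<times> W)"
  proof (rule antisym)
    show "n_plus P (L \<times> W) \<le> n_plus Q (L \<times> W)"
      by (rule n_plus_le_map[where f = f, OF subspace_Times[OF sub(4,1)] lf fim])
        (use z QfP in auto)
    show "n_plus Q (L \<times> W) \<le> n_plus P (L \<times> W)"
      by (rule n_plus_le_map[where f = g, OF subspace_Times[OF sub(4,1)] lg gim])
        (use z PgQ in auto)
  qed
  then show ?thesis
    using n_plus_Times[OF q(1,2) sub(4,1)] n_plus_Times[OF q(2,3) sub(4,1)]
    by (simp add: P_def Q_def)
qed

end

section \<open>Continuity and differentiability of chart forms\<close>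

lemma linear_bound:
  fixes f :: "'a::euclidean_space \<Rightarrow> 'b::real_normed_vector"
  assumes "linear f"
  obtains B where "B > 0" "\<And>x. norm (f x) \<le> B * norm x"
  using linear_bounded_pos[OF assms] by blast

lemma complementary_orthogonal:
  fixes l :: "'a::euclidean_space set"
  assumes "subspace l"
  shows "complementary l {y. \<forall>x\<in>l. orthogonal x y}"
proof (rule complementary_if_dim[OF assms])
  show "subspace {y. \<forall>x\<in>l. orthogonal x y}"
    by (auto simp: subspace_def orthogonal_def inner_add_right)
  show "l \<inter> {y. \<forall>x\<in>l. orthogonal x y} = {0}"
    using subspace_0[OF assms] by (auto simp: orthogonal_def)
  show "DIM('a) \<le> dim l + dim {y. \<forall>x\<in>l. orthogonal x y}"
    using dim_subspace_orthogonal_to_vectors[OF assms subspace_UNIV] by simp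
qed

lemma orthogonal_projection_dist:
  fixes l :: "'a::euclidean_space set"
  assumes "subspace l"
  shows "norm (pr l {y. \<forall>x\<in>l. orthogonal x y} x - x) \<le> infdist x l"
proof -
  let ?p = "pr l {y. \<forall>x\<in>l. orthogonal x y} x"
  have p: "?p \<in> l" "\<forall>y\<in>l. orthogonal y (x - ?p)"
    using pr_in[OF complementary_orthogonal[OF assms]] by auto
  have "norm (?p - x) \<le> dist x y" if y: "y \<in> l" for y
  proof -
    have "?p - y \<in> l" using p y assms by (auto intro: subspace_diff)
    then have "(?p - y) \<bullet> (x - ?p) = 0" using p by (auto simp: orthogonal_def)
    then have "(norm (x - ?p))\<^sup>2 + (norm (?p - y))\<^sup>2 = (norm (x - y))\<^sup>2"
      using norm_add_Pythagorean[of "x - ?p" "?p - y"] by (simp add: orthogonal_def inner_commute)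
    then have "(norm (x - ?p))\<^sup>2 \<le> (norm (x - y))\<^sup>2" by (smt (verit) zero_le_power2)
    then have "norm (x - ?p) \<le> norm (x - y)" by (simp add: power2_le_iff_abs_le)
    then show ?thesis by (simp add: dist_norm norm_minus_commute)
  qed
  moreover have "l \<noteq> {}" using p by blast
  ultimately show ?thesis by (auto simp: infdist_notempty intro: cINF_greatest)
qed

lemma infdist_gap:
  fixes L M :: "'a::euclidean_space set"
  assumes L: "subspace L" and M: "subspace M" and gap: "subspace_gap L M < e" and x: "x \<in> M"
  shows "infdist x L \<le> e * norm x"
proof (cases "x = 0")
  case True
  then show ?thesis using subspace_0[OF L] by simp
next
  case False
  define y where "y = (1 / norm x) *\<^sub>R x"
  have y: "y \<in> M" "norm y \<le> 1" using M x False by (auto simp: y_def intro: subspace_scale)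
  \<comment> \<open>A real supremum bounds its elements only if the set is bounded above; comparison
    with \<open>0 \<in> L\<close> gives the bound 1 on the unit ball.\<close>
  have "infdist z L \<le> 1" if "norm z \<le> 1" for z
    using infdist_le[OF subspace_0[OF L], of z] that by simp
  then have "bdd_above ((\<lambda>y. infdist y L) ` {y\<in>M. norm y \<le> 1})" by (auto intro!: bdd_aboveI2[where M = 1])
  then have "infdist y L \<le> (SUP y\<in>{y\<in>M. norm y \<le> 1}. infdist y L)"
    using y by (intro cSUP_upper) auto
  also have "\<dots> \<le> subspace_gap L M" by (simp add: subspace_gap_def)
  also have "\<dots> < e" by (rule gap)
  finally have ye: "infdist y L < e" .
  have "closed L" "L \<noteq> {}" using L closed_subspace subspace_0 by auto
  then obtain z where z: "z \<in> L" "infdist y L = dist y z" using infdist_attains_inf by blast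
  have "infdist x L \<le> dist x (norm x *\<^sub>R z)"
    using z L by (intro infdist_le) (auto intro: subspace_scale)
  also have "\<dots> = norm x * dist y z"
  proof -
    have "x - norm x *\<^sub>R z = norm x *\<^sub>R (y - z)" using False by (simp add: y_def algebra_simps)
    then show ?thesis by (simp add: dist_norm)
  qed
  also have "\<dots> \<le> norm x * e" using ye z by (intro mult_left_mono) auto
  finally show ?thesis by (simp add: mult.commute)
qed

lemma subspaces_continuous_on_image:
  fixes A :: "'b::metric_space \<Rightarrow> ('a::euclidean_space \<Rightarrow>\<^sub>L 'a)"
  assumes A: "continuous_on S A" and inj: "\<And>p. p \<in> S \<Longrightarrow> inj (blinfun_apply (A p))"
    and L: "subspace L"
  shows "subspaces_continuous_on S (\<lambda>p. blinfun_apply (A p) ` L)"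
  unfolding subspaces_continuous_on_def
proof (intro ballI allI impI)
  fix p and e :: real assume p: "p \<in> S" and e: "e > 0"
  have lin: "linear (blinfun_apply (A q))" for q
    by (simp add: blinfun.bounded_linear_right bounded_linear.linear)
  obtain c where c: "c > 0" "\<And>x. c * norm x \<le> norm (A p x)"
    using linear_inj_bounded_below_pos[OF lin inj[OF p]] by blast
  \<comment> \<open>The first bound keeps \<open>A q\<close> bounded below by \<open>c / 2\<close>.
    The second moves a vector whose image has norm at most 1, hence of norm at most
    \<open>2 / c\<close>, by at most \<open>e / 2\<close>; the factor 2 is spent because a supremum
    only yields a weak inequality.\<close>
  define r where "r = min (c / 2) (c * e / 4)"
  have r: "r > 0" "r \<le> c / 2" "r \<le> c * e / 4" using c e by (auto simp: r_def)
  obtain d where d: "d > 0" "\<And>q. q \<in> S \<Longrightarrow> dist q p < d \<Longrightarrow> dist (A q) (A p) < r"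
    using A p r(1) unfolding continuous_on_iff by metis
  have "subspace_gap (A q ` L) (A p ` L) < e" if q: "q \<in> S" "dist q p < d" for q
  proof -
    have nAB: "norm (A q x - A p x) \<le> r * norm x" for x
    proof -
      have "norm (A q x - A p x) \<le> norm (A q - A p) * norm x"
        using norm_blinfun[of "A q - A p" x] by (simp add: blinfun.diff_left)
      also have "\<dots> \<le> r * norm x"
        using d(2)[OF q] by (intro mult_right_mono) (auto simp: dist_norm)
      finally show ?thesis .
    qed
    have lowp: "c / 2 * norm x \<le> norm (A p x)" for x
      using c(2)[of x] c(1) by (smt (verit) mult_right_mono norm_ge_zero field_sum_of_halves)
    have lowq: "c / 2 * norm x \<le> norm (A q x)" for x
    proof -
      have "norm (A p x) \<le> norm (A q x) + r * norm x"
        using nAB[of x] norm_triangle_ineq2[of "A p x" "A q x"] by (simp add: norm_minus_commute)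
      moreover have "r * norm x \<le> c / 2 * norm x" using r by (intro mult_right_mono) auto
      ultimately show ?thesis using c(2)[of x] by linarith
    qed
    have dst: "r * norm u \<le> e / 2" if "c / 2 * norm u \<le> 1" for u :: 'a
    proof -
      have "r * norm u \<le> c * e / 4 * norm u" using r by (intro mult_right_mono) auto
      also have "\<dots> = e / 2 * (c / 2 * norm u)" by simp
      also have "\<dots> \<le> e / 2 * 1" using that e by (intro mult_left_mono) auto
      finally show ?thesis by simp
    qed
    have z: "0 \<in> {x\<in>A s ` L. norm x \<le> 1}" for s
      using image_eqI[of 0 "blinfun_apply (A s)" 0 L] subspace_0[OF L] by (simp add: blinfun.zero_right)
    have "(SUP x\<in>{x\<in>A q ` L. norm x \<le> 1}. infdist x (A p ` L)) \<le> e / 2"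
    proof (rule cSUP_least)
      fix x assume "x \<in> {x\<in>A q ` L. norm x \<le> 1}"
      then obtain u where u: "u \<in> L" "x = A q u" "norm x \<le> 1" by auto
      have "infdist x (A p ` L) \<le> dist x (A p u)" using u by (intro infdist_le) auto
      also have "\<dots> \<le> r * norm u" using nAB[of u] by (simp add: u dist_norm)
      also have "\<dots> \<le> e / 2" using lowq[of u] u by (intro dst) simp
      finally show "infdist x (A p ` L) \<le> e / 2" .
    qed (use z in blast)
    moreover have "(SUP x\<in>{x\<in>A p ` L. norm x \<le> 1}. infdist x (A q ` L)) \<le> e / 2"
    proof (rule cSUP_least)
      fix x assume "x \<in> {x\<in>A p ` L. norm x \<le> 1}"
      then obtain u where u: "u \<in> L" "x = A p u" "norm x \<le> 1" by auto
      have "infdist x (A q ` L) \<le> dist x (A q u)" using u by (intro infdist_le) auto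
      also have "\<dots> \<le> r * norm u" using nAB[of u] by (simp add: u dist_norm norm_minus_commute)
      also have "\<dots> \<le> e / 2" using lowp[of u] u by (intro dst) simp
      finally show "infdist x (A q ` L) \<le> e / 2" .
    qed (use z in blast)
    ultimately show ?thesis using e by (simp add: subspace_gap_def)
  qed
  then show "\<exists>d>0. \<forall>q\<in>S. dist q p < d \<longrightarrow> subspace_gap (A q ` L) (A p ` L) < e"
    using d(1) by blast
qed

context symplectic_space
begin

text \<open>A map fixing \<open>W\<close> and carrying \<open>l\<close> into \<open>l'\<close>
  intertwines the two projections: \<open>pr W l' (T u) = pr W l u\<close>. The dependence of the
  projection on \<open>l\<close> is thereby reduced to an estimate for
  \<open>T - id\<close>.\<close>

lemma transversal_near_identity:
  assumes t: "transversal W l" and l': "lagrangian \<omega> l'" and T: "linear T"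
    and near: "\<And>x. norm (T x - x) \<le> \<eta> * norm x" "\<eta> \<le> 1 / 2"
    and TW: "\<And>w. w \<in> W \<Longrightarrow> T w = w" and Tl: "T ` l \<subseteq> l'"
  shows "transversal W l'"
    and "\<exists>u. T u = v \<and> pr W l' v = pr W l u \<and> norm u \<le> 2 * norm v"
proof -
  have low: "norm x \<le> 2 * norm (T x)" for x
  proof -
    have "norm x \<le> norm (T x) + norm (T x - x)" using norm_triangle_ineq2[of x "T x"]
      by (simp add: norm_minus_commute)
    moreover have "\<eta> * norm x \<le> 1 / 2 * norm x" using near(2) by (intro mult_right_mono) auto
    ultimately show ?thesis using near(1)[of x] by linarith
  qed
  have inj: "inj T"
  proof (subst linear_injective_0[OF T], intro allI impI)
    fix x assume "T x = 0" then show "x = 0" using low[of x] by simp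
  qed
  have lag: "lagrangian \<omega> W" "lagrangian \<omega> l" using t by (auto simp: transversal_def)
  have "dim (T ` l) = dim l" using inj by (intro dim_image_eq[OF T]) (auto intro: inj_on_subset)
  then have "T ` l = l'"
    using dim_lagrangian[OF lag(2)] dim_lagrangian[OF l'] lag l' Tl
    by (intro subspace_dim_equal linear_subspace_image[OF T]) (auto simp: lagrangian_subspace)
  have "W \<inter> l' \<subseteq> {0}"
  proof
    fix x assume x: "x \<in> W \<inter> l'"
    then obtain y where y: "y \<in> l" "x = T y" using \<open>T ` l = l'\<close> by auto
    then have "T x = T y" using TW x by simp
    then have "x = y" using inj by (simp add: inj_eq)
    then show "x \<in> {0}" using x y t by (auto simp: transversal_def)
  qed
  then show t': "transversal W l'"
    using lag l' subspace_0[OF lagrangian_subspace] by (auto simp: transversal_def)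
  obtain u where u: "T u = v"
    using linear_injective_imp_surjective[OF T inj] by (metis surjD)
  note c = transversal_complementary[OF t]
  have "T (u - pr W l u) \<in> l'" using pr_in[OF c] Tl by auto
  then have "v - pr W l u \<in> l'" using TW[OF pr_in(1)[OF c]] by (simp add: linear_diff[OF T] u)
  then have "pr W l' v = pr W l u"
    using pr_in[OF c] by (intro pr_unique[OF transversal_complementary[OF t']])
  then show "\<exists>u. T u = v \<and> pr W l' v = pr W l u \<and> norm u \<le> 2 * norm v" using u low by blast
qed

lemma chart_form_continuous:
  assumes t: "transversal W l" and e: "e > 0"
  obtains d where "d > 0"
    "\<And>l'. lagrangian \<omega> l' \<Longrightarrow> (\<And>x. x \<in> l \<Longrightarrow> infdist x l' \<le> d * norm x) \<Longrightarrow>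
       transversal W l' \<and> (\<forall>v. \<bar>chart_form W l' v - chart_form W l v\<bar> \<le> e * (norm v)\<^sup>2)"
proof -
  note c = transversal_complementary[OF t]
  let ?p = "pr W l"
  note lp = linear_pr[OF c]
  obtain B where B: "B > 0" "\<And>x. norm (?p x) \<le> B * norm x" using linear_bound[OF lp] by blast
  obtain D where D: "D > 0" "\<And>x y. \<bar>\<omega> x y\<bar> \<le> D * norm x * norm y" using omega_bounded by blast
  \<comment> \<open>The first bound makes \<open>T\<close> deviate from the identity by at most one
    half; the second is what the final chain of estimates for the chart form consumes.\<close>
  define d where "d = min (1 / (2 * (1 + B))) (e / (2 * D * B * (1 + B)))"
  have d: "d > 0" "d * (1 + B) \<le> 1 / 2" "2 * D * B * (1 + B) * d \<le> e"
  proof -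
    show "d > 0" using B D e by (auto simp: d_def)
    have "d \<le> 1 / (2 * (1 + B))" "d \<le> e / (2 * D * B * (1 + B))" by (auto simp: d_def)
    moreover have "2 * (1 + B) > 0" "2 * D * B * (1 + B) > 0" using B D by auto
    ultimately show "d * (1 + B) \<le> 1 / 2" "2 * D * B * (1 + B) * d \<le> e"
      by (simp_all add: pos_le_divide_eq algebra_simps)
  qed
  show ?thesis
  proof (rule that[OF d(1)])
    fix l' assume l': "lagrangian \<omega> l'" and near: "\<And>x. x \<in> l \<Longrightarrow> infdist x l' \<le> d * norm x"
    let ?q = "pr l' {y. \<forall>x\<in>l'. orthogonal x y}"
    note sl' = lagrangian_subspace[OF l']
    note c' = complementary_orthogonal[OF sl']
    note lq = linear_pr[OF c']
    \<comment> \<open>The \<open>W\<close>-component is kept and the \<open>l\<close>-component is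
      projected orthogonally to \<open>l'\<close>, which moves it by no more than its distance from
      \<open>l'\<close>.\<close>
    define T where "T x = ?q (x - ?p x) + ?p x" for x
    have T: "linear T" unfolding T_def
      by (rule linearI)
        (simp_all add: linear_add[OF lp] linear_add[OF lq] linear_diff[OF lq] linear_cmul[OF lp]
          linear_cmul[OF lq] algebra_simps)
    have nT: "norm (T x - x) \<le> d * (1 + B) * norm x" for x
    proof -
      have "norm (T x - x) = norm (?q (x - ?p x) - (x - ?p x))" by (simp add: T_def algebra_simps)
      also have "\<dots> \<le> infdist (x - ?p x) l'" by (rule orthogonal_projection_dist[OF sl'])
      also have "\<dots> \<le> d * norm (x - ?p x)" by (rule near[OF pr_in(2)[OF c]])
      also have "norm (x - ?p x) \<le> (1 + B) * norm x"
        using norm_triangle_ineq4[of x "?p x"] B(2)[of x] by (simp add: algebra_simps)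
      then have "d * norm (x - ?p x) \<le> d * ((1 + B) * norm x)" using d by (intro mult_left_mono) auto
      finally show ?thesis by (simp add: mult.assoc)
    qed
    have TW: "T w = w" if "w \<in> W" for w
      using that pr_left[OF c] linear_0[OF lq] by (simp add: T_def)
    have Tl: "T ` l \<subseteq> l'" using pr_right[OF c] pr_in(1)[OF c'] by (auto simp: T_def)
    note nI = transversal_near_identity[OF t l' T nT d(2) TW Tl]
    have "\<bar>chart_form W l' v - chart_form W l v\<bar> \<le> e * (norm v)\<^sup>2" for v
    proof -
      obtain u where u: "T u = v" "pr W l' v = ?p u" "norm u \<le> 2 * norm v" using nI(2) by blast
      have "norm (u - v) \<le> d * (1 + B) * norm u" using nT[of u] u by (simp add: norm_minus_commute)
      also have "\<dots> \<le> d * (1 + B) * (2 * norm v)" using d B u by (intro mult_left_mono) auto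
      finally have uv: "norm (u - v) \<le> d * (1 + B) * (2 * norm v)" .
      have "\<bar>chart_form W l' v - chart_form W l v\<bar> = \<bar>\<omega> (?p (u - v)) v\<bar>"
        by (simp add: chart_form_def u omega_simps linear_diff[OF lp])
      also have "\<dots> \<le> D * norm (?p (u - v)) * norm v" by (rule D)
      also have "\<dots> \<le> D * (B * (d * (1 + B) * (2 * norm v))) * norm v"
        using D(1) B(2)[of "u - v"] mult_left_mono[OF uv less_imp_le[OF B(1)]]
        by (intro mult_right_mono mult_left_mono) auto
      also have "\<dots> = 2 * D * B * (1 + B) * d * (norm v)\<^sup>2" by (simp add: power2_eq_square)
      also have "\<dots> \<le> e * (norm v)\<^sup>2" using d(3) by (intro mult_right_mono) auto
      finally show ?thesis .
    qed
    then show "transversal W l' \<and> (\<forall>v. \<bar>chart_form W l' v - chart_form W l v\<bar> \<le> e * (norm v)\<^sup>2)"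
      using nI(1) by blast
  qed
qed

lemma chart_form_eventually:
  fixes H :: "'b::metric_space \<Rightarrow> 'a set"
  assumes H: "subspaces_continuous_on X H" "\<And>p. p \<in> X \<Longrightarrow> lagrangian \<omega> (H p)"
    and p: "p \<in> X" and t: "transversal W (H p)" and e: "e > 0"
  obtains d where "d > 0" "\<And>q. q \<in> X \<Longrightarrow> dist q p < d \<Longrightarrow> transversal W (H q) \<and>
     (\<forall>v. \<bar>chart_form W (H q) v - chart_form W (H p) v\<bar> \<le> e * (norm v)\<^sup>2)"
proof -
  obtain r where r: "r > 0"
    "\<And>l'. lagrangian \<omega> l' \<Longrightarrow> (\<And>x. x \<in> H p \<Longrightarrow> infdist x l' \<le> r * norm x) \<Longrightarrow>
       transversal W l' \<and> (\<forall>v. \<bar>chart_form W l' v - chart_form W (H p) v\<bar> \<le> e * (norm v)\<^sup>2)"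
    using chart_form_continuous[OF t e] by metis
  obtain d where d: "d > 0" "\<And>q. q \<in> X \<Longrightarrow> dist q p < d \<Longrightarrow> subspace_gap (H q) (H p) < r"
    using H(1) p r(1) unfolding subspaces_continuous_on_def by metis
  show ?thesis
  proof (rule that[OF d(1)], rule r(2))
    fix q x assume q: "q \<in> X" "dist q p < d"
    show "lagrangian \<omega> (H q)" by (rule H(2)[OF q(1)])
    assume "x \<in> H p"
    then show "infdist x (H q) \<le> r * norm x"
      by (rule infdist_gap[OF lagrangian_subspace[OF H(2)[OF q(1)]] lagrangian_subspace[OF H(2)[OF p]] d(2)[OF q]])
  qed
qed

text \<open>The map \<open>T\<close> sending \<open>A t0 (h x) + pr W (l t0) x\<close> to
  \<open>A t (h x) + pr W (l t0) x\<close> equals the identity plus \<open>(t - t0) * A' h\<close>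
  up to a remainder of smaller order, and it intertwines the projections; inverting it to first
  order yields \<open>d\<close>. The error is uniform in \<open>v\<close>, as the perturbation
  lemmas for inertia demand. The last clause gives \<open>d\<close> on \<open>l t0\<close> in terms
  of the velocity alone.\<close>

lemma chart_form_differentiable:
  fixes A :: "real \<Rightarrow> 'a \<Rightarrow>\<^sub>L 'a"
  assumes t: "transversal W (l t0)" and L: "subspace L" and t0: "t0 \<in> S"
    and lag: "\<And>t. t \<in> S \<Longrightarrow> lagrangian \<omega> (l t)" and l: "\<And>t. t \<in> S \<Longrightarrow> l t = A t ` L"
    and A': "(A has_vector_derivative A') (at t0 within S)"
  obtains d where "quadform d"
    "\<And>e. e > 0 \<Longrightarrow> \<forall>\<^sub>F t in at t0 within S. transversal W (l t) \<and>
       (\<forall>v. \<bar>chart_form W (l t) v - chart_form W (l t0) v - (t - t0) * d v\<bar> \<le> e * \<bar>t - t0\<bar> * (norm v)\<^sup>2)"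
    "\<And>v. v \<in> l t0 \<Longrightarrow> \<exists>u\<in>L. A t0 u = v \<and> d v = \<omega> v (A' u)"
proof -
  note c = transversal_complementary[OF t]
  let ?p = "pr W (l t0)"
  note lp = linear_pr[OF c]
  have lin: "linear (blinfun_apply F)" for F :: "'a \<Rightarrow>\<^sub>L 'a"
    by (simp add: blinfun.bounded_linear_right bounded_linear.linear)
  \<comment> \<open>\<open>A t0\<close> may have a kernel on \<open>L\<close>, as happens when a
    Lagrangian is presented as the range of an operator, so only a linear right inverse is
    available.\<close>
  obtain g where g: "range g \<subseteq> L" "linear g" "\<And>v. v \<in> A t0 ` L \<Longrightarrow> A t0 (g v) = v"
    using linear_exists_right_inverse_on[OF lin L, of "A t0"] by metis
  define h where "h x = g (x - ?p x)" for x
  have lh: "linear h" unfolding h_def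
    by (rule linearI)
      (simp_all add: linear_add[OF lp] linear_add[OF g(2)] linear_diff[OF g(2)] linear_cmul[OF lp]
        linear_cmul[OF g(2)] algebra_simps)
  have Ah: "A t0 (h x) = x - ?p x" for x
    using g(3) pr_in(2)[OF c] l[OF t0] by (simp add: h_def)
  obtain B where B: "B > 0" "\<And>x. norm (?p x) \<le> B * norm x" using linear_bound[OF lp] by blast
  obtain D where D: "D > 0" "\<And>x y. \<bar>\<omega> x y\<bar> \<le> D * norm x * norm y" using omega_bounded by blast
  obtain G where G: "G > 0" "\<And>x. norm (h x) \<le> G * norm x" using linear_bound[OF lh] by blast
  define a where "a = norm A'"
  have a0: "a \<ge> 0" by (simp add: a_def)
  define d where "d v = \<omega> (- ?p (A' (h v))) v" for v
  have "bilinear (\<lambda>x y. \<omega> (- ?p (A' (h x))) y)"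
    unfolding bilinear_def
    by (auto intro!: linearI simp: omega_simps linear_add[OF lp] linear_cmul[OF lp] linear_add[OF lh]
        linear_cmul[OF lh] blinfun.add_right blinfun.scaleR_right)
  then have qd: "quadform d" using quadform_bilinear by (simp add: d_def[abs_def])
  show ?thesis
  proof (rule that[OF qd])
    fix v assume v: "v \<in> l t0"
    have "A t0 (h v) = v" using Ah[of v] pr_right[OF c v] by simp
    \<comment> \<open>The component of the velocity along \<open>l t0\<close> pairs to zero with
      \<open>v \<in> l t0\<close>, so on \<open>l t0\<close> the derivative no longer sees
      \<open>W\<close>.\<close>
    moreover have "\<omega> v (A' (h v) - ?p (A' (h v))) = 0"
      using v pr_in(2)[OF c] lag[OF t0] by (blast intro: lagrangian_isotropic)
    then have "d v = \<omega> v (A' (h v))"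
      using omega_skew[of "?p (A' (h v))" v] by (simp add: d_def omega_simps)
    moreover have "h v \<in> L" using g(1) by (auto simp: h_def)
    ultimately show "\<exists>u\<in>L. A t0 u = v \<and> d v = \<omega> v (A' u)" by blast
  next
    fix e :: real assume e: "e > 0"
    \<comment> \<open>The first summand bounds the effect of replacing \<open>u\<close> by
      \<open>v\<close> in the linear term, the second the Taylor remainder of \<open>A\<close>; each
      carries the factor 2 from \<open>norm u \<le> 2 * norm v\<close>.\<close>
    define K where "K = D * B * (2 * a * G * G * (a + 1) + 2 * G)"
    have K: "K > 0" using D B G a0 by (simp add: K_def add_nonneg_pos)
    define r where "r = min 1 (min (e / K) (1 / (2 * (a + 1) * G)))"
    have r: "r > 0" "r \<le> 1" "K * r \<le> e" "(a + 1) * r * G \<le> 1 / 2"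
    proof -
      show "r > 0" "r \<le> 1" using e K G a0 by (auto simp: r_def)
      have "r \<le> e / K" "r \<le> 1 / (2 * (a + 1) * G)" by (auto simp: r_def)
      moreover have "2 * (a + 1) * G > 0" using G a0 by simp
      ultimately show "K * r \<le> e" "(a + 1) * r * G \<le> 1 / 2"
        using K by (simp_all add: pos_le_divide_eq algebra_simps)
    qed
    have "\<forall>\<^sub>F t in at t0 within S. norm (A t - A t0 - (t - t0) *\<^sub>R A') \<le> r * norm (t - t0)"
      using A' r(1) unfolding has_vector_derivative_def has_derivative_within_alt2 by blast
    moreover have "\<forall>\<^sub>F t in at t0 within S. dist t t0 < r"
      using r(1) by (auto simp: eventually_at)
    moreover have "\<forall>\<^sub>F t in at t0 within S. t \<in> S" by (auto simp: eventually_at_filter)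
    ultimately show "\<forall>\<^sub>F t in at t0 within S. transversal W (l t) \<and>
       (\<forall>v. \<bar>chart_form W (l t) v - chart_form W (l t0) v - (t - t0) * d v\<bar> \<le> e * \<bar>t - t0\<bar> * (norm v)\<^sup>2)"
    proof eventually_elim
      case (elim t)
      define \<tau> where "\<tau> = t - t0"
      define R where "R = A t - A t0 - \<tau> *\<^sub>R A'"
      have tau: "\<bar>\<tau>\<bar> \<le> r" using elim(2) by (simp add: \<tau>_def dist_norm)
      have R: "norm R \<le> r * \<bar>\<tau>\<bar>" using elim(1) by (simp add: R_def \<tau>_def)
      define T where "T x = A t (h x) + ?p x" for x
      have T: "linear T" unfolding T_def
        by (rule linearI)
          (simp_all add: linear_add[OF lp] linear_add[OF lh] linear_cmul[OF lp] linear_cmul[OF lh]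
            blinfun.add_right blinfun.scaleR_right algebra_simps)
      have Tx: "T x - x = \<tau> *\<^sub>R A' (h x) + R (h x)" for x
        using Ah[of x] by (simp add: T_def R_def blinfun.add_left blinfun.diff_left blinfun.scaleR_left algebra_simps)
      have Rh: "norm (R (h x)) \<le> r * \<bar>\<tau>\<bar> * (G * norm x)" for x
        using norm_blinfun[of R "h x"] mult_mono[OF R G(2)[of x]] r(1) by simp
      have Ah': "norm (A' (h x)) \<le> a * (G * norm x)" for x
        using norm_blinfun[of A' "h x"] mult_left_mono[OF G(2)[of x] a0] by (simp add: a_def)
      have nT': "norm (T x - x) \<le> (a + 1) * \<bar>\<tau>\<bar> * G * norm x" for x
      proof -
        have "norm (T x - x) \<le> \<bar>\<tau>\<bar> * (a * (G * norm x)) + r * \<bar>\<tau>\<bar> * (G * norm x)"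
          unfolding Tx using norm_triangle_ineq[of "\<tau> *\<^sub>R A' (h x)" "R (h x)"] Rh[of x]
            mult_left_mono[OF Ah'[of x], of "\<bar>\<tau>\<bar>"] by simp
        also have "r * \<bar>\<tau>\<bar> * (G * norm x) \<le> 1 * \<bar>\<tau>\<bar> * (G * norm x)"
          using r(2) G by (intro mult_right_mono) auto
        finally show ?thesis by (simp add: algebra_simps)
      qed
      have nT: "norm (T x - x) \<le> (a + 1) * r * G * norm x" for x
      proof -
        have "(a + 1) * \<bar>\<tau>\<bar> * G * norm x \<le> (a + 1) * r * G * norm x"
          using tau a0 G by (intro mult_right_mono mult_left_mono) auto
        then show ?thesis using nT'[of x] by linarith
      qed
      have TW: "T w = w" if "w \<in> W" for w
        using that pr_left[OF c] linear_0[OF g(2)] by (simp add: T_def h_def)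
      have Tl: "T ` l t0 \<subseteq> l t"
        using pr_right[OF c] g(1) l[OF elim(3)] by (auto simp: T_def h_def intro!: imageI)
      note nI = transversal_near_identity[OF t lag[OF elim(3)] T nT r(4) TW Tl]
      have "\<bar>chart_form W (l t) v - chart_form W (l t0) v - \<tau> * d v\<bar> \<le> e * \<bar>\<tau>\<bar> * (norm v)\<^sup>2" for v
      proof -
        obtain u where u: "T u = v" "pr W (l t) v = ?p u" "norm u \<le> 2 * norm v" using nI(2) by blast
        define w where "w = \<tau> *\<^sub>R A' (h (u - v)) + R (h u)"
        have "norm (u - v) \<le> (a + 1) * \<bar>\<tau>\<bar> * G * norm u"
          using nT'[of u] u by (simp add: norm_minus_commute)
        also have "\<dots> \<le> (a + 1) * \<bar>\<tau>\<bar> * G * (2 * norm v)"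
          using a0 G u by (intro mult_left_mono) auto
        also have "\<dots> \<le> (a + 1) * r * G * (2 * norm v)"
          using tau a0 G by (intro mult_right_mono mult_left_mono) auto
        finally have uv: "norm (u - v) \<le> (a + 1) * r * G * (2 * norm v)" .
        have "norm w \<le> \<bar>\<tau>\<bar> * (a * (G * norm (u - v))) + r * \<bar>\<tau>\<bar> * (G * norm u)"
          unfolding w_def using norm_triangle_ineq[of "\<tau> *\<^sub>R A' (h (u - v))" "R (h u)"] Rh[of u]
            mult_left_mono[OF Ah'[of "u - v"], of "\<bar>\<tau>\<bar>"] by simp
        also have "\<dots> \<le> \<bar>\<tau>\<bar> * (a * (G * ((a + 1) * r * G * (2 * norm v)))) + r * \<bar>\<tau>\<bar> * (G * (2 * norm v))"
          using uv u a0 G r by (intro add_mono mult_left_mono) auto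
        also have "\<dots> = (2 * a * G * G * (a + 1) + 2 * G) * r * \<bar>\<tau>\<bar> * norm v"
          by (simp add: algebra_simps)
        finally have nw: "norm w \<le> (2 * a * G * G * (a + 1) + 2 * G) * r * \<bar>\<tau>\<bar> * norm v" .
        have "u - v = - (\<tau> *\<^sub>R A' (h u) + R (h u))" using Tx[of u] u by (simp add: algebra_simps)
        then have "u - v + \<tau> *\<^sub>R A' (h v) = - w"
          by (simp add: w_def linear_diff[OF lh] blinfun.diff_right algebra_simps)
        moreover have "chart_form W (l t) v - chart_form W (l t0) v - \<tau> * d v
            = \<omega> (?p (u - v + \<tau> *\<^sub>R A' (h v))) v"
          by (simp add: chart_form_def u d_def omega_simps linear_diff[OF lp] linear_add[OF lp]
              linear_cmul[OF lp])
        ultimately have "\<bar>chart_form W (l t) v - chart_form W (l t0) v - \<tau> * d v\<bar> = \<bar>\<omega> (?p (- w)) v\<bar>"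
          by simp
        also have "\<dots> \<le> D * norm (?p (- w)) * norm v" by (rule D)
        also have "\<dots> \<le> D * (B * ((2 * a * G * G * (a + 1) + 2 * G) * r * \<bar>\<tau>\<bar> * norm v)) * norm v"
          using D(1) B(2)[of "- w"] mult_left_mono[OF nw less_imp_le[OF B(1)]]
          by (intro mult_right_mono mult_left_mono) auto
        also have "\<dots> = K * r * (\<bar>\<tau>\<bar> * (norm v)\<^sup>2)" by (simp add: power2_eq_square K_def)
        also have "\<dots> \<le> e * (\<bar>\<tau>\<bar> * (norm v)\<^sup>2)" using r(3) by (intro mult_right_mono) auto
        finally show ?thesis by (simp add: mult.assoc)
      qed
      then show ?case using nI(1) by (simp add: \<tau>_def)
    qed
  qed
qed

end

section \<open>Positive symplectic rotations\<close>

lemma linear_blinfun: "linear (blinfun_apply F)"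
  by (simp add: blinfun.bounded_linear_right bounded_linear.linear)

lemma linear_imp_blinfun:
  fixes f :: "'a::euclidean_space \<Rightarrow> 'b::real_normed_vector"
  assumes "linear f"
  obtains F where "blinfun_apply F = f"
  using bounded_linear_Blinfun_apply[of f] assms by (metis linear_conv_bounded_linear)

context symplectic_space
begin

text \<open>Up to sign convention, the linear Hamiltonian vector field of half the squared norm. The
  inner product need not be compatible with \<open>\<omega>\<close>, so this is not a complex
  structure in general; skewness is the property that remains.\<close>

definition dual_op :: "'a \<Rightarrow>\<^sub>L 'a" where
  "dual_op = (SOME X. \<forall>v w. \<omega> v (blinfun_apply X w) = v \<bullet> w)"

lemma omega_dual_op: "\<omega> v (dual_op w) = v \<bullet> w"
proof -
  obtain G where G: "linear G" "\<And>x y. \<omega> x y = G x \<bullet> y" using bilinear_repr[OF bilinear_omega] by blast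
  have "inj G" using omega_nondegenerate G(2) by (subst linear_injective_0[OF G(1)]) auto
  then obtain G' where G': "linear G'" "\<And>x. G (G' x) = x"
    using linear_injective_isomorphism[OF G(1)] by blast
  have "linear (\<lambda>w. - G' w)" using G'(1) by (simp add: linear_iff)
  then obtain X where X: "blinfun_apply X = (\<lambda>w. - G' w)" using linear_imp_blinfun by blast
  have "\<omega> v (X w) = v \<bullet> w" for v w
  proof -
    have "\<omega> v (X w) = - \<omega> (X w) v" by (rule omega_skew)
    also have "\<dots> = - (G (- G' w) \<bullet> v)" by (simp add: X G(2))
    also have "\<dots> = v \<bullet> w" by (simp add: linear_neg[OF G(1)] G'(2) inner_commute)
    finally show ?thesis .
  qed
  then have "\<exists>X. \<forall>v w. \<omega> v (blinfun_apply X w) = v \<bullet> w" by blast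
  from someI_ex[OF this] show ?thesis unfolding dual_op_def by blast
qed

lemma dual_op_skew: "dual_op v \<bullet> w = - (v \<bullet> dual_op w)"
  using omega_dual_op[of "dual_op v" w] omega_dual_op[of "dual_op w" v] omega_skew[of "dual_op v" "dual_op w"]
  by (simp add: inner_commute)

lemma omega_dual_op_skew: "\<omega> (dual_op v) w = - \<omega> v (dual_op w)"
  using omega_dual_op omega_skew by (metis inner_commute)

lemma norm_dual_op:
  "(norm (u + s *\<^sub>R dual_op u))\<^sup>2 = (norm u)\<^sup>2 + s\<^sup>2 * (norm (dual_op u))\<^sup>2"
proof -
  have "u \<bullet> dual_op u = 0" using dual_op_skew[of u u] by (simp add: inner_commute)
  then have "orthogonal u (s *\<^sub>R dual_op u)" by (simp add: orthogonal_def)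
  from norm_add_Pythagorean[OF this] show ?thesis by (simp add: power_mult_distrib)
qed

text \<open>The inverse of \<open>1 - s X\<close> with \<open>X = dual_op\<close>. It exists for
  every real \<open>s\<close> because \<open>X\<close> is skew, so \<open>1 - s X\<close> never
  shrinks a vector.\<close>

definition resolvent :: "real \<Rightarrow> 'a \<Rightarrow>\<^sub>L 'a" where
  "resolvent s = (SOME Y. \<forall>v. blinfun_apply Y v - s *\<^sub>R dual_op (Y v) = v \<and>
      Y (v - s *\<^sub>R dual_op v) = v)"

lemma resolvent_props:
  "resolvent s v - s *\<^sub>R dual_op (resolvent s v) = v" "resolvent s (v - s *\<^sub>R dual_op v) = v"
proof -
  let ?f = "\<lambda>v. v - s *\<^sub>R dual_op v"
  have f: "linear ?f" by (rule linearI) (simp_all add: blinfun.add_right blinfun.scaleR_right algebra_simps)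
  have "inj ?f"
  proof (subst linear_injective_0[OF f], intro allI impI)
    fix v assume "?f v = 0"
    then show "v = 0" using norm_dual_op[of v "- s"] by (simp add: add_nonneg_eq_0_iff)
  qed
  then obtain g where g: "linear g" "\<forall>x. g (?f x) = x" "\<forall>x. ?f (g x) = x"
    using linear_injective_isomorphism[OF f] by blast
  obtain Y where "blinfun_apply Y = g" using linear_imp_blinfun[OF g(1)] by blast
  then have "\<exists>Y. \<forall>v. blinfun_apply Y v - s *\<^sub>R dual_op (Y v) = v \<and> Y (v - s *\<^sub>R dual_op v) = v"
    using g by metis
  from someI_ex[OF this, folded resolvent_def]
  show "resolvent s v - s *\<^sub>R dual_op (resolvent s v) = v" "resolvent s (v - s *\<^sub>R dual_op v) = v"
    by auto
qed

lemma norm_resolvent_le: "norm (resolvent s v) \<le> norm v"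
proof -
  let ?u = "resolvent s v"
  have "(norm v)\<^sup>2 = (norm ?u)\<^sup>2 + s\<^sup>2 * (norm (dual_op ?u))\<^sup>2"
    using norm_dual_op[of ?u "- s"] resolvent_props(1)[of s v] by simp
  then have "(norm ?u)\<^sup>2 \<le> (norm v)\<^sup>2" by simp
  then show ?thesis by (simp add: power2_le_iff_abs_le)
qed

text \<open>The resolvent identity. It yields the Lipschitz estimate, and continuity of its
  right-hand side then gives the derivative.\<close>

lemma resolvent_diff:
  "resolvent s - resolvent r = (s - r) *\<^sub>R (resolvent s o\<^sub>L dual_op o\<^sub>L resolvent r)"
proof (rule blinfun_eqI)
  fix v
  define u where "u = resolvent r v"
  have v: "v = u - r *\<^sub>R dual_op u" using resolvent_props(1)[of r v] by (simp add: u_def)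
  have "resolvent s v = resolvent s (u - s *\<^sub>R dual_op u) + resolvent s ((s - r) *\<^sub>R dual_op u)"
    unfolding v blinfun.add_right[symmetric] by (simp add: algebra_simps)
  then show "(resolvent s - resolvent r) v = ((s - r) *\<^sub>R (resolvent s o\<^sub>L dual_op o\<^sub>L resolvent r)) v"
    by (simp add: resolvent_props(2) u_def blinfun.diff_left blinfun.scaleR_left blinfun.scaleR_right)
qed

lemma norm_resolvent: "norm (resolvent s) \<le> 1"
  by (rule norm_blinfun_bound) (simp_all add: norm_resolvent_le)

lemma resolvent_lipschitz: "norm (resolvent s - resolvent r) \<le> norm dual_op * \<bar>s - r\<bar>"
proof -
  have "norm (resolvent s o\<^sub>L dual_op o\<^sub>L resolvent r) \<le> norm (resolvent s o\<^sub>L dual_op) * norm (resolvent r)"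
    by (rule norm_blinfun_compose)
  also have "\<dots> \<le> (norm (resolvent s) * norm dual_op) * 1"
    by (intro mult_mono norm_blinfun_compose norm_resolvent) auto
  also have "\<dots> \<le> 1 * norm dual_op * 1" by (intro mult_mono norm_resolvent) auto
  finally have "norm (resolvent s o\<^sub>L dual_op o\<^sub>L resolvent r) \<le> norm dual_op" by simp
  then have "\<bar>s - r\<bar> * norm (resolvent s o\<^sub>L dual_op o\<^sub>L resolvent r) \<le> \<bar>s - r\<bar> * norm dual_op"
    by (rule mult_left_mono) simp
  then show ?thesis unfolding resolvent_diff by (simp add: mult.commute)
qed

lemma continuous_resolvent: "continuous_on S resolvent"
proof -
  have "(norm dual_op)-lipschitz_on S resolvent"
    by (rule lipschitz_onI) (auto simp: dist_norm resolvent_lipschitz)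
  then show ?thesis by (rule lipschitz_on_continuous_on)
qed

lemma resolvent_derivative:
  "(resolvent has_vector_derivative (resolvent s o\<^sub>L dual_op o\<^sub>L resolvent s)) (at s within S)"
proof -
  let ?D = "\<lambda>r. resolvent r o\<^sub>L dual_op o\<^sub>L resolvent s"
  have "continuous_on UNIV ?D" by (intro continuous_intros continuous_resolvent)
  then have "(?D \<longlongrightarrow> ?D s) (at s within S)"
    by (meson UNIV_I continuous_on_def tendsto_within_subset subset_UNIV)
  then have lim: "\<forall>\<^sub>F r in at s within S. dist (?D r) (?D s) < e" if "e > 0" for e
    using that by (simp add: tendsto_iff)
  have "\<forall>\<^sub>F r in at s within S. norm (resolvent r - resolvent s - (r - s) *\<^sub>R ?D s) \<le> e * norm (r - s)"
    if "e > 0" for e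
    using lim[OF that]
  proof eventually_elim
    case (elim r)
    have "resolvent r - resolvent s - (r - s) *\<^sub>R ?D s = (r - s) *\<^sub>R (?D r - ?D s)"
      unfolding resolvent_diff by (simp add: scaleR_diff_right)
    then show ?case using mult_right_mono[OF less_imp_le[OF elim], of "\<bar>r - s\<bar>"]
      by (simp add: dist_norm mult.commute)
  qed
  then show ?thesis
    unfolding has_vector_derivative_def has_derivative_within_alt2
    by (simp add: bounded_linear_scaleR_left)
qed

text \<open>The Cayley transform \<open>(1 + s X) (1 - s X)^(-1)\<close>, standing in for the
  exponential flow of \<open>X\<close>: it is symplectic and isometric, and its derivative comes
  from the resolvent identity alone.\<close>

definition cayley :: "real \<Rightarrow> 'a \<Rightarrow>\<^sub>L 'a" where
  "cayley s = 2 *\<^sub>R resolvent s - id_blinfun"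

definition cayley_deriv :: "real \<Rightarrow> 'a \<Rightarrow>\<^sub>L 'a" where
  "cayley_deriv s = 2 *\<^sub>R (resolvent s o\<^sub>L dual_op o\<^sub>L resolvent s)"

lemma cayley_has_derivative: "(cayley has_vector_derivative cayley_deriv s) (at s within S)"
  unfolding cayley_def[abs_def] cayley_deriv_def
  using has_vector_derivative_diff[OF bounded_linear.has_vector_derivative
      [OF bounded_linear_scaleR_right resolvent_derivative] has_vector_derivative_const]
  by simp

lemma continuous_cayley_deriv: "continuous_on S cayley_deriv"
  unfolding cayley_deriv_def[abs_def] by (intro continuous_intros continuous_resolvent)

text \<open>In terms of \<open>w\<close> a vector and its image become
  \<open>(w - s X w) / 2\<close> and \<open>(w + s X w) / 2\<close>. This symmetry makes the
  isometry and the symplectic property immediate.\<close>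

lemma cayley_param:
  assumes "w = 2 *\<^sub>R resolvent s u"
  shows "u = (1/2) *\<^sub>R (w - s *\<^sub>R dual_op w)" "cayley s u = (1/2) *\<^sub>R (w + s *\<^sub>R dual_op w)"
    "cayley_deriv s u = resolvent s (dual_op w)"
proof -
  show u: "u = (1/2) *\<^sub>R (w - s *\<^sub>R dual_op w)"
    using resolvent_props(1)[of s u] by (simp add: assms blinfun.scaleR_right algebra_simps)
  have "cayley s u = w - u" by (simp add: cayley_def assms blinfun.diff_left blinfun.scaleR_left)
  also have "\<dots> = (1/2) *\<^sub>R (w + s *\<^sub>R dual_op w)"
    by (subst u) (simp add: algebra_simps flip: scaleR_add_left)
  finally show "cayley s u = (1/2) *\<^sub>R (w + s *\<^sub>R dual_op w)" .
  show "cayley_deriv s u = resolvent s (dual_op w)"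
    by (simp add: cayley_deriv_def assms blinfun.scaleR_left blinfun.scaleR_right)
qed

lemma norm_cayley: "norm (cayley s u) = norm u"
proof -
  define w where "w = 2 *\<^sub>R resolvent s u"
  note p = cayley_param[OF w_def]
  have "(norm (w - s *\<^sub>R dual_op w))\<^sup>2 = (norm (w + s *\<^sub>R dual_op w))\<^sup>2"
    using norm_dual_op[of w s] norm_dual_op[of w "- s"] by simp
  then have "norm (w - s *\<^sub>R dual_op w) = norm (w + s *\<^sub>R dual_op w)"
    using power2_eq_imp_eq norm_ge_zero by blast
  then have "norm ((1/2) *\<^sub>R (w + s *\<^sub>R dual_op w)) = norm ((1/2) *\<^sub>R (w - s *\<^sub>R dual_op w))" by simp
  then show ?thesis using p(1,2) by simp
qed

lemma omega_cayley: "\<omega> (cayley s u) (cayley s v) = \<omega> u v"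
proof -
  define w z where "w = 2 *\<^sub>R resolvent s u" and "z = 2 *\<^sub>R resolvent s v"
  note p = cayley_param[OF w_def] and p' = cayley_param[OF z_def]
  have "\<omega> (cayley s u) (cayley s v) = (\<omega> w z + s * s * \<omega> (dual_op w) (dual_op z)) / 4"
    unfolding p(2) p'(2) by (simp add: omega_simps omega_dual_op_skew algebra_simps)
  moreover have "\<omega> u v = (\<omega> w z + s * s * \<omega> (dual_op w) (dual_op z)) / 4"
    by (subst p(1), subst p'(1)) (simp add: omega_simps omega_dual_op_skew algebra_simps)
  ultimately show ?thesis by simp
qed

text \<open>For \<open>0 \<le> s \<le> 1\<close> one has
  \<open>|u|^2 \<le> (1 + |X|^2) / 4 * |w|^2\<close>, while the speed to be bounded below is
  \<open>|w|^2 / 2\<close>; the constant is the quotient.\<close>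

definition rotation_rate :: real where
  "rotation_rate = 2 / (1 + (norm dual_op)\<^sup>2)"

lemma rotation_rate_pos: "rotation_rate > 0"
  by (simp add: rotation_rate_def add_pos_nonneg)

lemma omega_cayley_deriv:
  assumes "0 \<le> s" "s \<le> 1"
  shows "rotation_rate * (norm u)\<^sup>2 \<le> \<omega> (cayley s u) (cayley_deriv s u)"
proof -
  define w where "w = 2 *\<^sub>R resolvent s u"
  note p = cayley_param[OF w_def]
  define y where "y = resolvent s (dual_op w)"
  have y: "y - s *\<^sub>R dual_op y = dual_op w" using resolvent_props(1) by (simp add: y_def)
  have "\<omega> (cayley s u) (cayley_deriv s u) = 1 / 2 * \<omega> (w + s *\<^sub>R dual_op w) y"
    unfolding p(2,3) y_def[symmetric] by (simp add: omega_simps)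
  \<comment> \<open>Moving \<open>1 + s X\<close> to the other side of \<open>\<omega>\<close> turns
    it into \<open>1 - s X\<close>, which cancels the resolvent in the derivative.\<close>
  also have "\<omega> (w + s *\<^sub>R dual_op w) y = \<omega> w (y - s *\<^sub>R dual_op y)"
    by (simp add: omega_simps omega_dual_op_skew)
  also have "\<dots> = (norm w)\<^sup>2" by (simp add: y omega_dual_op power2_norm_eq_inner)
  finally have e: "\<omega> (cayley s u) (cayley_deriv s u) = 1 / 2 * (norm w)\<^sup>2" .
  have "(norm u)\<^sup>2 = 1 / 4 * ((norm w)\<^sup>2 + s\<^sup>2 * (norm (dual_op w))\<^sup>2)"
    using norm_dual_op[of w "- s"] by (subst p(1)) (simp add: power_mult_distrib power_divide)
  also have "s\<^sup>2 * (norm (dual_op w))\<^sup>2 \<le> 1 * (norm dual_op * norm w)\<^sup>2"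
    using assms by (intro mult_mono power_mono norm_blinfun) (auto simp: power_le_one)
  finally have "(norm u)\<^sup>2 \<le> (1 + (norm dual_op)\<^sup>2) / 4 * (norm w)\<^sup>2"
    by (simp add: power_mult_distrib algebra_simps)
  then have "rotation_rate * (norm u)\<^sup>2 \<le> rotation_rate * ((1 + (norm dual_op)\<^sup>2) / 4 * (norm w)\<^sup>2)"
    using rotation_rate_pos by (intro mult_left_mono) auto
  also have "\<dots> = 1 / 2 * (norm w)\<^sup>2"
  proof -
    have "1 + (norm dual_op)\<^sup>2 > 0" by (simp add: add_pos_nonneg)
    then show ?thesis by (simp add: rotation_rate_def field_simps)
  qed
  finally show ?thesis using e by simp
qed

lemma symplectic_map_bij:
  fixes R :: "'a \<Rightarrow>\<^sub>L 'a"
  assumes "\<And>u v. \<omega> (R u) (R v) = \<omega> u v" shows "bij (blinfun_apply R)"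
proof -
  have "inj (blinfun_apply R)"
  proof (subst linear_injective_0[OF linear_blinfun], intro allI impI)
    fix u assume "R u = 0"
    then show "u = 0" using assms[of u] by (intro omega_nondegenerate) (simp add: omega_simps)
  qed
  then show ?thesis using linear_injective_imp_surjective[OF linear_blinfun] by (auto simp: bij_def)
qed

text \<open>The \<open>N\<close>-th power of the Cayley path. Speeds measured by
  \<open>\<omega>\<close> add under composition of symplectic paths, and the isometry keeps each
  contribution at least \<open>rotation_rate * |u|^2\<close>. Speeding up the parameter of a single
  Cayley path would not do, since its speed decays for large \<open>s\<close>.\<close>

lemma fast_rotation:
  obtains R R' :: "real \<Rightarrow> 'a \<Rightarrow>\<^sub>L 'a" where
    "R 0 = id_blinfun" "\<And>s S. (R has_vector_derivative R' s) (at s within S)"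
    "\<And>S. continuous_on S R'" "\<And>s u v. \<omega> (R s u) (R s v) = \<omega> u v" "\<And>s u. norm (R s u) = norm u"
    "\<And>s u. 0 \<le> s \<Longrightarrow> s \<le> 1 \<Longrightarrow> real N * rotation_rate * (norm u)\<^sup>2 \<le> \<omega> (R s u) (R' s u)"
proof (induction N arbitrary: thesis)
  case 0
  show ?case
    by (rule 0[of "\<lambda>_. id_blinfun" "\<lambda>_. 0"]) (auto simp: omega_simps)
next
  case (Suc N)
  obtain R R' :: "real \<Rightarrow> 'a \<Rightarrow>\<^sub>L 'a" where R: "R 0 = id_blinfun"
    "\<And>s S. (R has_vector_derivative R' s) (at s within S)"
    "\<And>S. continuous_on S R'" "\<And>s u v. \<omega> (R s u) (R s v) = \<omega> u v" "\<And>s u. norm (R s u) = norm u"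
    "\<And>s u. 0 \<le> s \<Longrightarrow> s \<le> 1 \<Longrightarrow> real N * rotation_rate * (norm u)\<^sup>2 \<le> \<omega> (R s u) (R' s u)"
    using Suc.IH by blast
  have cR: "continuous_on S R" for S
    by (rule continuous_on_vector_derivative[OF R(2)])
  have cC: "continuous_on S cayley" for S
    by (rule continuous_on_vector_derivative[OF cayley_has_derivative])
  show ?case
  proof (rule Suc.prems[of "\<lambda>s. cayley s o\<^sub>L R s" "\<lambda>s. (cayley s o\<^sub>L R' s) + (cayley_deriv s o\<^sub>L R s)"])
    have "resolvent 0 v = v" for v using resolvent_props(1)[of 0 v] by simp
    then have "cayley 0 v = v" for v
      by (simp add: cayley_def blinfun.diff_left blinfun.add_left scaleR_2)
    then show "cayley 0 o\<^sub>L R 0 = id_blinfun" by (intro blinfun_eqI) (simp add: R(1))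
    show "((\<lambda>s. cayley s o\<^sub>L R s) has_vector_derivative (cayley s o\<^sub>L R' s) + (cayley_deriv s o\<^sub>L R s)) (at s within S)"
      for s S
      using bounded_bilinear.has_vector_derivative[OF bounded_bilinear_blinfun_compose
          cayley_has_derivative R(2)] .
    show "continuous_on S (\<lambda>s. (cayley s o\<^sub>L R' s) + (cayley_deriv s o\<^sub>L R s))" for S
      by (intro continuous_intros cR cC R(3) continuous_cayley_deriv)
    show "\<omega> ((cayley s o\<^sub>L R s) u) ((cayley s o\<^sub>L R s) v) = \<omega> u v" for s u v
      by (simp add: omega_cayley R(4))
    show "norm ((cayley s o\<^sub>L R s) u) = norm u" for s u by (simp add: norm_cayley R(5))
    fix s :: real and u assume s: "0 \<le> s" "s \<le> 1"
    show "real (Suc N) * rotation_rate * (norm u)\<^sup>2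
        \<le> \<omega> ((cayley s o\<^sub>L R s) u) (((cayley s o\<^sub>L R' s) + (cayley_deriv s o\<^sub>L R s)) u)"
      using R(6)[OF s, of u] omega_cayley_deriv[OF s, of "R s u"]
      by (simp add: blinfun.add_left omega_simps omega_cayley R(5) algebra_simps)
  qed
qed

text \<open>If \<open>u\<close> and \<open>v = cayley 1 u\<close> both lie in \<open>l\<close>, then
  so do \<open>w = v + u\<close> and \<open>X w = v - u\<close>, and isotropy gives
  \<open>0 = \<omega> w (X w) = |w|^2\<close>.\<close>

lemma exists_transversal:
  assumes "lagrangian \<omega> l" obtains W where "transversal W l"
proof -
  have lag: "lagrangian \<omega> (cayley 1 ` l)"
    by (rule lagrangian_image[OF assms linear_blinfun symplectic_map_bij[OF omega_cayley] omega_cayley])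
  have "v = 0" if v: "v \<in> cayley 1 ` l" "v \<in> l" for v
  proof -
    obtain u where u: "u \<in> l" "v = cayley 1 u" using v by blast
    define w where "w = 2 *\<^sub>R resolvent 1 u"
    note p = cayley_param[OF w_def]
    have p1: "u = (1/2) *\<^sub>R (w - dual_op w)" and p2: "v = (1/2) *\<^sub>R (w + dual_op w)"
      using p(1,2) by (simp_all add: u(2))
    have vu: "v + u = w" unfolding p2 by (subst p1) (simp add: algebra_simps flip: scaleR_add_left)
    have vu': "v - u = dual_op w" unfolding p2
      by (subst p1) (simp add: algebra_simps flip: scaleR_add_left)
    have "\<omega> (v + u) (v - u) = 0"
      using v u lagrangian_subspace[OF assms]
      by (intro lagrangian_isotropic[OF assms]) (auto intro: subspace_add subspace_diff)
    then have "w = 0" by (simp add: vu vu' omega_dual_op)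
    then have "v + u = 0" "v - u = 0" using vu vu' by (simp_all add: blinfun.zero_right)
    then have "(2::real) *\<^sub>R v = 0" by (metis add.right_neutral diff_eq_eq eq_iff_diff_eq_0 scaleR_2 add_cancel_left_right)
    then show ?thesis by simp
  qed
  then have "transversal (cayley 1 ` l) l"
    using lag assms subspace_0[OF lagrangian_subspace] by (auto simp: transversal_def)
  then show ?thesis by (rule that)
qed

end

section \<open>Index functions\<close>

lemma posdef_on_nondegenerate:
  assumes "quadform q" "posdef_on q S" shows "qf_nondegenerate q S"
  using assms unfolding qf_nondegenerate_def posdef_on_def quadform_def by (metis less_irrefl)

lemma negdef_on_nondegenerate:
  assumes "quadform q" "posdef_on (\<lambda>x. - q x) S" shows "qf_nondegenerate q S"
  using assms unfolding qf_nondegenerate_def posdef_on_def quadform_def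
  by (metis neg_0_equal_iff_equal less_irrefl)

text \<open>A locally defined primitive extends along rays from a base point of a compact convex set;
  a Lebesgue number makes the finite sums of local increments path independent.\<close>

lemma glue_local_primitives:
  fixes g :: "'x::euclidean_space \<Rightarrow> 'x \<Rightarrow> int"
  assumes X: "compact X" "convex X" and r: "\<And>p. p \<in> X \<Longrightarrow> r p > 0"
    and loc: "\<And>p p' x. p \<in> X \<Longrightarrow> p' \<in> X \<Longrightarrow> x \<in> X \<inter> ball p (r p) \<inter> ball p' (r p') \<Longrightarrow>
        \<forall>\<^sub>F y in at x within X \<inter> ball p (r p) \<inter> ball p' (r p'). g p y - g p' y = g p x - g p' x"
  obtains f where "\<And>p x y. p \<in> X \<Longrightarrow> x \<in> X \<inter> ball p (r p) \<Longrightarrow> y \<in> X \<inter> ball p (r p) \<Longrightarrow>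
      f y - f x = g p y - g p x"
proof (cases "X = {}")
  case True
  then show ?thesis using that[of "\<lambda>_. 0"] by blast
next
  case False
  then obtain p0 where p0: "p0 \<in> X" by blast
  have const: "g p y - g p x = g p' y - g p' x"
    if "p \<in> X" "p' \<in> X" "x \<in> X \<inter> ball p (r p) \<inter> ball p' (r p')" "y \<in> X \<inter> ball p (r p) \<inter> ball p' (r p')"
    for p p' x y
  proof -
    have "connected (X \<inter> ball p (r p) \<inter> ball p' (r p'))"
      by (intro convex_connected convex_Int X(2) convex_ball)
    then have "g p x - g p' x = g p y - g p' y"
      by (rule connected_local_const[where f = "\<lambda>z. g p z - g p' z"])
        (use that loc in \<open>auto simp: eq_commute\<close>)
    then show ?thesis by simp
  qed
  obtain e where e: "e > 0" "\<forall>x\<in>X. \<exists>B\<in>(\<lambda>p. ball p (r p)) ` X. ball x e \<subseteq> B"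
  proof (rule Heine_Borel_lemma[OF X(1), of "(\<lambda>p. ball p (r p)) ` X"])
    show "X \<subseteq> \<Union> ((\<lambda>p. ball p (r p)) ` X)" using r by force
  qed auto
  then have "\<forall>x\<in>X. \<exists>p\<in>X. ball x e \<subseteq> ball p (r p)" by blast
  then obtain c where c: "\<And>x. x \<in> X \<Longrightarrow> c x \<in> X" "\<And>x. x \<in> X \<Longrightarrow> ball x e \<subseteq> ball (c x) (r (c x))"
    by metis
  \<comment> \<open>Between points closer than the Lebesgue number \<open>e\<close>, this increment
    agrees with the one read in any common ball, by \<open>const\<close>.\<close>
  define \<delta> where "\<delta> x y = g (c x) y - g (c x) x" for x y
  have \<delta>: "\<delta> x y = g p y - g p x"
    if "p \<in> X" "x \<in> X" "y \<in> X" "x \<in> ball p (r p)" "y \<in> ball p (r p)" "dist x y < e" for p x y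
  proof -
    have "x \<in> ball x e" "y \<in> ball x e" using that e(1) by auto
    then have "x \<in> ball (c x) (r (c x))" "y \<in> ball (c x) (r (c x))"
      using c(2)[OF that(2)] by blast+
    then show ?thesis unfolding \<delta>_def using that c(1) by (intro const) auto
  qed
  obtain D where D: "\<And>x. x \<in> X \<Longrightarrow> dist p0 x \<le> D"
    using compact_imp_bounded[OF X(1)] by (metis bounded_any_center)
  \<comment> \<open>Subdivides every ray from \<open>p0\<close> into steps shorter than
    \<open>e / 2\<close>, so that the small quadrilaterals between two neighbouring rays fit into
    one ball.\<close>
  obtain N :: nat where N: "2 * D / e < real N" using reals_Archimedean2 by blast
  have D0: "D \<ge> 0" using D[OF p0] by simp
  then have N0: "N > 0" using N e(1) by (metis divide_nonneg_pos mult_nonneg_nonneg of_nat_0_less_iff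
        order_le_less_trans zero_le_numeral)
  define P where "P k x = p0 + (real k / real N) *\<^sub>R (x - p0)" for k x
  have PX: "P k x \<in> X" if "k \<le> N" "x \<in> X" for k x
  proof -
    have "P k x = (1 - real k / real N) *\<^sub>R p0 + (real k / real N) *\<^sub>R x"
      by (simp add: P_def algebra_simps)
    then show ?thesis using that N0 p0 X(2) by (simp add: convexD_alt)
  qed
  have P1: "dist (P k x) (P k y) \<le> dist x y" if "k \<le> N" for k x y
  proof -
    have "P k x - P k y = (real k / real N) *\<^sub>R (x - y)" by (simp add: P_def algebra_simps)
    then have "dist (P k x) (P k y) = real k / real N * dist x y" by (simp add: dist_norm)
    also have "\<dots> \<le> 1 * dist x y" using that N0 by (intro mult_right_mono) auto
    finally show ?thesis by simp
  qed
  have P2: "dist (P k x) (P (Suc k) x) < e / 2" if "x \<in> X" for k x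
  proof -
    have "P (Suc k) x - P k x = (1 / real N) *\<^sub>R (x - p0)"
      by (simp add: P_def add_divide_distrib algebra_simps)
    then have "norm (P (Suc k) x - P k x) = norm (x - p0) / real N" by simp
    then have "dist (P k x) (P (Suc k) x) = dist p0 x / real N" by (metis dist_commute dist_norm)
    also have "\<dots> \<le> D / real N" using D[OF that] by (simp add: divide_right_mono)
    also have "\<dots> < e / 2" using N e(1) N0 by (simp add: field_simps)
    finally show ?thesis .
  qed
  have PN: "P N x = x" "P 0 x = p0" for x using N0 by (auto simp: P_def)
  define f where "f x = (\<Sum>k<N. \<delta> (P k x) (P (Suc k) x))" for x
  have f: "f y - f x = \<delta> x y" if xy: "x \<in> X" "y \<in> X" "dist x y < e / 2" for x y
  proof -
    \<comment> \<open>All four corners lie in one ball, where the increments come from one function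
      and cancel around the quadrilateral. Summing over \<open>k\<close> telescopes to the
      increments at the two ends.\<close>
    have "\<delta> (P k y) (P (Suc k) y) - \<delta> (P k x) (P (Suc k) x) = \<delta> (P (Suc k) x) (P (Suc k) y) - \<delta> (P k x) (P k y)"
      if k: "k < N" for k
    proof -
      let ?p = "c (P k x)"
      have in_X: "P k x \<in> X" "P k y \<in> X" "P (Suc k) x \<in> X" "P (Suc k) y \<in> X" using PX k xy by auto
      have ds: "dist (P k x) (P k y) < e / 2" "dist (P (Suc k) x) (P (Suc k) y) < e / 2"
        using P1[of k x y] P1[of "Suc k" x y] k xy by auto
      have ds2: "dist (P k x) (P (Suc k) x) < e / 2" "dist (P k y) (P (Suc k) y) < e / 2" using P2 xy by auto
      have "dist (P k x) (P (Suc k) y) < e"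
        using dist_triangle[of "P k x" "P (Suc k) y" "P k y"] ds ds2 by linarith
      then have "{P k x, P k y, P (Suc k) x, P (Suc k) y} \<subseteq> ball (P k x) e" using ds ds2 e(1) by auto
      then have in_b: "P k x \<in> ball ?p (r ?p)" "P k y \<in> ball ?p (r ?p)" "P (Suc k) x \<in> ball ?p (r ?p)"
          "P (Suc k) y \<in> ball ?p (r ?p)"
        using c(2)[OF in_X(1)] by blast+
      note pX = c(1)[OF in_X(1)]
      have "dist (P k x) (P k y) < e" "dist (P (Suc k) x) (P (Suc k) y) < e"
        "dist (P k x) (P (Suc k) x) < e" "dist (P k y) (P (Suc k) y) < e" using ds ds2 e(1) by linarith+
      then show ?thesis
        using \<delta>[OF pX in_X(1,2) in_b(1,2)] \<delta>[OF pX in_X(3,4) in_b(3,4)] \<delta>[OF pX in_X(1,3) in_b(1,3)]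
          \<delta>[OF pX in_X(2,4) in_b(2,4)] by simp
    qed
    then have "f y - f x = (\<Sum>k<N. \<delta> (P (Suc k) x) (P (Suc k) y) - \<delta> (P k x) (P k y))"
      unfolding f_def sum_subtractf[symmetric] by (intro sum.cong) auto
    also have "\<dots> = \<delta> (P N x) (P N y) - \<delta> (P 0 x) (P 0 y)"
      by (rule sum_lessThan_telescope)
    finally show ?thesis by (simp add: PN \<delta>_def)
  qed
  show ?thesis
  proof (rule that)
    fix p x y assume p: "p \<in> X" and x: "x \<in> X \<inter> ball p (r p)" and y: "y \<in> X \<inter> ball p (r p)"
    have "connected (X \<inter> ball p (r p))" by (intro convex_connected convex_Int X(2) convex_ball)
    then have "f x - g p x = f y - g p y"
    proof (rule connected_local_const[where f = "\<lambda>z. f z - g p z", OF _ x y], intro ballI)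
      fix z assume z: "z \<in> X \<inter> ball p (r p)"
      show "\<forall>\<^sub>F w in at z within X \<inter> ball p (r p). f z - g p z = f w - g p w"
        unfolding eventually_at
      proof (intro exI[of _ "e / 2"] conjI ballI impI)
        fix w assume w: "w \<in> X \<inter> ball p (r p)" "w \<noteq> z \<and> dist w z < e / 2"
        then have d: "dist z w < e / 2" by (simp add: dist_commute)
        have "f w - f z = g p w - g p z"
          using f[of z w] \<delta>[of p z w] z w d p e(1) by auto
        then show "f z - g p z = f w - g p w" by simp
      qed (use e in auto)
    qed
    then show "f y - f x = g p y - g p x" by simp
  qed
qed

section \<open>Jumps at crossings and construction of index functions\<close>

context symplectic_space
begin

text \<open>On \<open>L\<close> the radical of the chart form has the persistent part
  \<open>L \<inter> W\<close> and the part \<open>l t0 \<inter> L\<close> on which the derivative is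
  nondegenerate. To the right the form is perturbed by \<open>d\<close>, to the left by
  \<open>- d\<close>, so each side resolves the second part completely. In particular the crossing
  is isolated.\<close>

lemma crossing_jump:
  assumes t: "transversal W (l t0)" and L: "lagrangian \<omega> L" and d: "quadform d"
    and ev: "\<And>e. e > 0 \<Longrightarrow> \<forall>\<^sub>F t in at t0 within S. transversal W (l t) \<and>
       (\<forall>v. \<bar>chart_form W (l t) v - chart_form W (l t0) v - (t - t0) * d v\<bar> \<le> e * \<bar>t - t0\<bar> * (norm v)\<^sup>2)"
    and nd: "qf_nondegenerate d (l t0 \<inter> L)"
  shows "\<forall>\<^sub>F t in at t0 within S. l t \<inter> L = {0} \<and>
     (t0 < t \<longrightarrow> n_plus (chart_form W (l t)) L = n_plus (chart_form W (l t0)) L + n_plus d (l t0 \<inter> L)) \<and>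
     (t < t0 \<longrightarrow> n_plus (chart_form W (l t)) L = n_plus (chart_form W (l t0)) L + n_minus d (l t0 \<inter> L))"
proof -
  let ?q = "chart_form W (l t0)" and ?K = "l t0 \<inter> L"
  note q = quadform_chart_form[OF t] and d' = quadform_minus[OF d]
  note sL = lagrangian_subspace[OF L]
  have sK: "subspace ?K" using t L by (intro subspace_inter) (auto simp: transversal_def lagrangian_subspace)
  have K: "?K \<subseteq> form_radical ?q L" "dim (form_radical ?q L) = dim ?K + dim (L \<inter> W)"
    using dim_form_radical_chart_form[OF t L] by (auto simp: Int_commute)
  have nd': "qf_nondegenerate (\<lambda>x. - d x) ?K"
  proof -
    have "polar (\<lambda>x. - d x) x y = - polar d x y" for x y by (simp add: polar_def field_simps)
    then show ?thesis using nd by (simp add: qf_nondegenerate_def)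
  qed
  obtain e1 where e1: "e1 > 0" "\<And>t r. 0 < t \<Longrightarrow> t \<le> e1 \<Longrightarrow> quadform r \<Longrightarrow>
       (\<And>x. x \<in> L \<Longrightarrow> \<bar>r x - ?q x - t * d x\<bar> \<le> e1 * t * (norm x)\<^sup>2) \<Longrightarrow>
       dim (L \<inter> W) \<le> dim (form_radical r L) \<Longrightarrow>
       n_plus r L = n_plus ?q L + n_plus d ?K \<and> dim (form_radical r L) = dim (L \<inter> W)"
    using n_plus_regular_perturb[OF q d sL sK K(1) nd K(2)] by metis
  obtain e2 where e2: "e2 > 0" "\<And>t r. 0 < t \<Longrightarrow> t \<le> e2 \<Longrightarrow> quadform r \<Longrightarrow>
       (\<And>x. x \<in> L \<Longrightarrow> \<bar>r x - ?q x - t * - d x\<bar> \<le> e2 * t * (norm x)\<^sup>2) \<Longrightarrow>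
       dim (L \<inter> W) \<le> dim (form_radical r L) \<Longrightarrow>
       n_plus r L = n_plus ?q L + n_plus (\<lambda>x. - d x) ?K \<and> dim (form_radical r L) = dim (L \<inter> W)"
    using n_plus_regular_perturb[OF q d' sL sK K(1) nd' K(2)] by metis
  define e where "e = min e1 e2"
  have e: "e > 0" "e \<le> e1" "e \<le> e2" using e1 e2 by (auto simp: e_def)
  have "\<forall>\<^sub>F t in at t0 within S. \<bar>t - t0\<bar> < e \<and> t \<noteq> t0"
    using e(1) by (auto simp: eventually_at dist_real_def)
  with ev[OF e(1)] show ?thesis
  proof eventually_elim
    case (elim t)
    then have tr: "transversal W (l t)" by blast
    note r = quadform_chart_form[OF tr]
    have rad: "dim (form_radical (chart_form W (l t)) L) = dim (L \<inter> l t) + dim (L \<inter> W)"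
      by (rule dim_form_radical_chart_form(2)[OF tr L])
    have le: "e * \<bar>t - t0\<bar> * (norm v)\<^sup>2 \<le> e1 * \<bar>t - t0\<bar> * (norm v)\<^sup>2"
      "e * \<bar>t - t0\<bar> * (norm v)\<^sup>2 \<le> e2 * \<bar>t - t0\<bar> * (norm v)\<^sup>2" for v :: 'a
      using e by (auto intro!: mult_right_mono)
    have z: "l t \<inter> L = {0}" if "dim (L \<inter> l t) = 0"
      using that tr sL subspace_0 by (auto simp: transversal_def lagrangian_subspace)
    have pos: "n_plus (chart_form W (l t)) L = n_plus ?q L + n_plus d ?K \<and>
        dim (form_radical (chart_form W (l t)) L) = dim (L \<inter> W)" if "t0 < t"
    proof (rule e1(2)[of "t - t0", OF _ _ r])
      fix x
      have "\<bar>chart_form W (l t) x - ?q x - (t - t0) * d x\<bar> \<le> e1 * \<bar>t - t0\<bar> * (norm x)\<^sup>2"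
        using elim(1) le(1)[of x] order_trans by blast
      then show "\<bar>chart_form W (l t) x - ?q x - (t - t0) * d x\<bar> \<le> e1 * (t - t0) * (norm x)\<^sup>2"
        using that by simp
    qed (use that elim e rad in auto)
    have neg: "n_plus (chart_form W (l t)) L = n_plus ?q L + n_plus (\<lambda>x. - d x) ?K \<and>
        dim (form_radical (chart_form W (l t)) L) = dim (L \<inter> W)" if "t < t0"
    proof (rule e2(2)[of "t0 - t", OF _ _ r])
      fix x
      have eq: "(t0 - t) * - d x = (t - t0) * d x" by (simp add: algebra_simps)
      have "\<bar>chart_form W (l t) x - ?q x - (t - t0) * d x\<bar> \<le> e2 * \<bar>t - t0\<bar> * (norm x)\<^sup>2"
        using elim(1) le(2)[of x] order_trans by blast
      then show "\<bar>chart_form W (l t) x - ?q x - (t0 - t) * - d x\<bar> \<le> e2 * (t0 - t) * (norm x)\<^sup>2"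
        unfolding eq using that by simp
    qed (use that elim e rad in auto)
    have "dim (L \<inter> l t) = 0"
      using pos neg rad elim by (cases "t0 < t") auto
    then show ?case using pos neg z by (auto simp: n_minus_eq)
  qed
qed

text \<open>Under a positive rotation any crossing with \<alpha> at time 0 is definite, hence
  regular, hence isolated. The statement about all small \<open>s\<close> lets finitely many
  \<alpha> be handled at once.\<close>

lemma eventually_transversal:
  assumes \<alpha>: "lagrangian \<omega> \<alpha>" and \<beta>: "lagrangian \<omega> \<beta>"
  shows "\<forall>\<^sub>F s in at_right 0. transversal (cayley s ` \<beta>) \<alpha>"
proof -
  let ?l = "\<lambda>s. cayley s ` \<beta>"
  have lag: "lagrangian \<omega> (?l s)" for s
    by (rule lagrangian_image[OF \<beta> linear_blinfun symplectic_map_bij[OF omega_cayley] omega_cayley])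
  obtain W where W: "transversal W (?l 0)" using exists_transversal[OF lag] by blast
  obtain d where d: "quadform d"
    "\<And>e. e > 0 \<Longrightarrow> \<forall>\<^sub>F t in at 0 within {0..1}. transversal W (?l t) \<and>
       (\<forall>v. \<bar>chart_form W (?l t) v - chart_form W (?l 0) v - (t - 0) * d v\<bar> \<le> e * \<bar>t - 0\<bar> * (norm v)\<^sup>2)"
    "\<And>v. v \<in> ?l 0 \<Longrightarrow> \<exists>u\<in>\<beta>. cayley 0 u = v \<and> d v = \<omega> v (cayley_deriv 0 u)"
    by (rule chart_form_differentiable[where S = "{0..1::real}" and A = cayley and l = ?l and ?t0.0 = 0, OF
        W lagrangian_subspace[OF \<beta>] _ lag refl cayley_has_derivative]) auto
  have "posdef_on d (?l 0 \<inter> \<alpha>)" unfolding posdef_on_def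
  proof (intro ballI impI)
    fix v assume "v \<in> ?l 0 \<inter> \<alpha>" "v \<noteq> 0"
    moreover then obtain u where u: "cayley 0 u = v" "d v = \<omega> v (cayley_deriv 0 u)" using d(3) by blast
    ultimately have "u \<noteq> 0" by (auto simp: blinfun.zero_right)
    then have "0 < rotation_rate * (norm u)\<^sup>2" using rotation_rate_pos by simp
    then show "d v > 0" using omega_cayley_deriv[of 0 u] u by simp
  qed
  then have "\<forall>\<^sub>F t in at 0 within {0..1}. ?l t \<inter> \<alpha> = {0}"
    using crossing_jump[OF W \<alpha> d(1,2) posdef_on_nondegenerate[OF d(1)]] by (auto elim: eventually_mono)
  then show ?thesis
    using lag \<alpha> by (simp add: at_within_Icc_at_right transversal_def)
qed

lemma common_transversal:
  assumes "finite F" "F \<noteq> {}" "\<And>\<alpha>. \<alpha> \<in> F \<Longrightarrow> lagrangian \<omega> \<alpha>"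
  obtains W where "\<And>\<alpha>. \<alpha> \<in> F \<Longrightarrow> transversal W \<alpha>"
proof -
  obtain \<beta> where "\<beta> \<in> F" using assms(2) by blast
  then have "\<forall>\<^sub>F s in at_right 0. \<forall>\<alpha>\<in>F. transversal (cayley s ` \<beta>) \<alpha>"
    using assms by (intro eventually_ball_finite) (auto intro: eventually_transversal)
  then have "\<exists>s. \<forall>\<alpha>\<in>F. transversal (cayley s ` \<beta>) \<alpha>"
    by (rule eventually_happens'[OF trivial_limit_at_right_real])
  then show ?thesis using that by blast
qed

text \<open>As long as \<open>W\<close> is transversal to \<open>H q\<close>, the radical on
  \<open>W\<close> is exactly \<open>W \<inter> W'\<close>, so the nullity is constant and the index
  cannot jump.\<close>

lemma n_plus_chart_form_locally_constant:
  fixes H :: "'b::metric_space \<Rightarrow> 'a set"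
  assumes H: "subspaces_continuous_on X H" "\<And>p. p \<in> X \<Longrightarrow> lagrangian \<omega> (H p)"
    and p: "p \<in> X" and t: "transversal W' (H p)" "transversal W (H p)"
  obtains d where "d > 0" "\<And>q. q \<in> X \<Longrightarrow> dist q p < d \<Longrightarrow> transversal W (H q) \<and> transversal W' (H q) \<and>
     n_plus (chart_form W' (H q)) W = n_plus (chart_form W' (H p)) W"
proof -
  have W: "lagrangian \<omega> W" using t by (auto simp: transversal_def)
  obtain e where e: "e > 0" "\<And>r. quadform r \<Longrightarrow>
      (\<And>x. x \<in> W \<Longrightarrow> \<bar>r x - chart_form W' (H p) x\<bar> \<le> e * (norm x)\<^sup>2) \<Longrightarrow>
      dim (form_radical (chart_form W' (H p)) W) \<le> dim (form_radical r W) \<Longrightarrow>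
      n_plus r W = n_plus (chart_form W' (H p)) W"
    using n_plus_locally_constant[OF quadform_chart_form[OF t(1)] lagrangian_subspace[OF W]] by metis
  obtain d1 where d1: "d1 > 0" "\<And>q. q \<in> X \<Longrightarrow> dist q p < d1 \<Longrightarrow> transversal W' (H q) \<and>
     (\<forall>v. \<bar>chart_form W' (H q) v - chart_form W' (H p) v\<bar> \<le> e * (norm v)\<^sup>2)"
    using chart_form_eventually[OF H p t(1) e(1)] by metis
  obtain d2 where d2: "d2 > 0" "\<And>q. q \<in> X \<Longrightarrow> dist q p < d2 \<Longrightarrow> transversal W (H q) \<and>
     (\<forall>v. \<bar>chart_form W (H q) v - chart_form W (H p) v\<bar> \<le> 1 * (norm v)\<^sup>2)"
    using chart_form_eventually[OF H p t(2), of 1] by (metis zero_less_one)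
  show ?thesis
  proof (rule that[of "min d1 d2"])
    fix q assume q: "q \<in> X" "dist q p < min d1 d2"
    then have tq: "transversal W' (H q)" "transversal W (H q)" using d1(2) d2(2) by auto
    have rad: "dim (form_radical (chart_form W' (H s)) W) = dim (W \<inter> W')"
      if "transversal W' (H s)" "transversal W (H s)" for s
      using dim_form_radical_chart_form(2)[OF that(1) W] that(2) by (simp add: transversal_def)
    have "n_plus (chart_form W' (H q)) W = n_plus (chart_form W' (H p)) W"
      using q d1(2) rad[OF t] rad[OF tq] by (intro e(2) quadform_chart_form tq) auto
    then show "transversal W (H q) \<and> transversal W' (H q) \<and>
     n_plus (chart_form W' (H q)) W = n_plus (chart_form W' (H p)) W" using tq by blast
  qed (use d1 d2 in auto)
qed

text \<open>Passing from each of the two charts to a third chart \<open>W'\<close> leaves only terms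
  restricted to \<open>W1\<close> or \<open>W2\<close> instead of \<open>L\<close>, and these are
  locally constant. \<open>W'\<close> has to be transversal to \<open>L\<close> as well for the
  change of chart to apply.\<close>

lemma chart_difference_locally_constant:
  fixes H :: "'b::metric_space \<Rightarrow> 'a set"
  assumes H: "subspaces_continuous_on X H" "\<And>p. p \<in> X \<Longrightarrow> lagrangian \<omega> (H p)"
    and L: "lagrangian \<omega> L"
    and p: "p \<in> X" and t: "transversal W1 (H p)" "transversal W2 (H p)"
  obtains d where "d > 0" "\<And>q. q \<in> X \<Longrightarrow> dist q p < d \<Longrightarrow> transversal W1 (H q) \<and> transversal W2 (H q) \<and>
     int (n_plus (chart_form W1 (H q)) L) - int (n_plus (chart_form W2 (H q)) L) =
     int (n_plus (chart_form W1 (H p)) L) - int (n_plus (chart_form W2 (H p)) L)"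
proof -
  obtain W' where "\<And>\<alpha>. \<alpha> \<in> {L, H p} \<Longrightarrow> transversal W' \<alpha>"
    by (rule common_transversal[of "{L, H p}"]) (use L H(2)[OF p] in auto)
  then have W': "transversal W' L" "transversal W' (H p)" by auto
  obtain d1 where d1: "d1 > 0" "\<And>q. q \<in> X \<Longrightarrow> dist q p < d1 \<Longrightarrow> transversal W1 (H q) \<and> transversal W' (H q) \<and>
     n_plus (chart_form W' (H q)) W1 = n_plus (chart_form W' (H p)) W1"
    using n_plus_chart_form_locally_constant[OF H p W'(2) t(1)] by metis
  obtain d2 where d2: "d2 > 0" "\<And>q. q \<in> X \<Longrightarrow> dist q p < d2 \<Longrightarrow> transversal W2 (H q) \<and> transversal W' (H q) \<and>
     n_plus (chart_form W' (H q)) W2 = n_plus (chart_form W' (H p)) W2"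
    using n_plus_chart_form_locally_constant[OF H p W'(2) t(2)] by metis
  show ?thesis
  proof (rule that[of "min d1 d2"])
    fix q assume q: "q \<in> X" "dist q p < min d1 d2"
    then have tq: "transversal W' (H q)" "transversal W1 (H q)" "transversal W2 (H q)" using d1(2) d2(2) by auto
    have n: "n_plus (chart_form W' (H q)) W1 = n_plus (chart_form W' (H p)) W1"
      "n_plus (chart_form W' (H q)) W2 = n_plus (chart_form W' (H p)) W2" using q d1(2) d2(2) by auto
    show "transversal W1 (H q) \<and> transversal W2 (H q) \<and>
     int (n_plus (chart_form W1 (H q)) L) - int (n_plus (chart_form W2 (H q)) L) =
     int (n_plus (chart_form W1 (H p)) L) - int (n_plus (chart_form W2 (H p)) L)"
      using n tq chart_change[OF W' t(1)] chart_change[OF W' t(2)]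
        chart_change[OF W'(1) tq(1,2)] chart_change[OF W'(1) tq(1,3)] by linarith
  qed (use d1 d2 in auto)
qed

text \<open>A primitive of the local index increments, determined up to a constant on connected
  sets. Increments are prescribed only against the centre \<open>p\<close>, but for every admissible
  chart, so later arguments may use whichever \<open>W\<close> they are given.\<close>

definition index_function :: "'a set \<Rightarrow> 'b::metric_space set \<Rightarrow> ('b \<Rightarrow> 'a set) \<Rightarrow> ('b \<Rightarrow> int) \<Rightarrow> bool" where
  "index_function L X H f \<longleftrightarrow> (\<forall>p\<in>X. \<forall>W. transversal W (H p) \<longrightarrow>
     (\<exists>d>0. \<forall>q\<in>X. dist q p < d \<longrightarrow> transversal W (H q) \<and>
       f q - f p = int (n_plus (chart_form W (H q)) L) - int (n_plus (chart_form W (H p)) L)))"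

lemma index_functionE:
  assumes "index_function L X H f" "p \<in> X" "transversal W (H p)"
  obtains d where "d > 0" "\<And>q. q \<in> X \<Longrightarrow> dist q p < d \<Longrightarrow> transversal W (H q) \<and>
       f q - f p = int (n_plus (chart_form W (H q)) L) - int (n_plus (chart_form W (H p)) L)"
  using assms unfolding index_function_def by metis

text \<open>Local constancy of chart differences is the compatibility needed to glue the increments
  of one chosen chart per point; any other chart at \<open>p\<close> is then compared with the
  chosen one.\<close>

theorem exists_index_function:
  fixes H :: "'b::euclidean_space \<Rightarrow> 'a set"
  assumes H: "subspaces_continuous_on X H" "\<And>p. p \<in> X \<Longrightarrow> lagrangian \<omega> (H p)"
    and L: "lagrangian \<omega> L" and X: "compact X" "convex X"
  obtains f where "index_function L X H f"
proof -
  have "\<forall>p\<in>X. \<exists>W. transversal W (H p)" using exists_transversal H(2) by metis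
  then obtain W where W: "\<And>p. p \<in> X \<Longrightarrow> transversal (W p) (H p)" by metis
  have "\<exists>d>0. \<forall>q\<in>X. dist q p < d \<longrightarrow> transversal (W p) (H q)" if p: "p \<in> X" for p
    using chart_form_eventually[OF H p W[OF p], of 1] by (metis zero_less_one)
  then obtain r where r: "\<And>p. p \<in> X \<Longrightarrow> r p > 0"
    "\<And>p q. p \<in> X \<Longrightarrow> q \<in> X \<Longrightarrow> dist q p < r p \<Longrightarrow> transversal (W p) (H q)" by metis
  define g where "g p x = int (n_plus (chart_form (W p) (H x)) L)" for p x
  have loc: "\<forall>\<^sub>F y in at x within X \<inter> ball p (r p) \<inter> ball p' (r p'). g p y - g p' y = g p x - g p' x"
    if pp: "p \<in> X" "p' \<in> X" "x \<in> X \<inter> ball p (r p) \<inter> ball p' (r p')" for p p' x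
  proof -
    have x: "x \<in> X" "transversal (W p) (H x)" "transversal (W p') (H x)"
      using pp r(2) by (auto simp: dist_commute)
    obtain d where d: "d > 0" "\<And>q. q \<in> X \<Longrightarrow> dist q x < d \<Longrightarrow>
        transversal (W p) (H q) \<and> transversal (W p') (H q) \<and> g p q - g p' q = g p x - g p' x"
      unfolding g_def using chart_difference_locally_constant[OF H L x] by metis
    show ?thesis unfolding eventually_at using d by auto
  qed
  obtain f where f: "\<And>p x y. p \<in> X \<Longrightarrow> x \<in> X \<inter> ball p (r p) \<Longrightarrow> y \<in> X \<inter> ball p (r p) \<Longrightarrow>
      f y - f x = g p y - g p x"
    using glue_local_primitives[where g = g and r = r and X = X, OF X r(1) loc] by metis
  have "index_function L X H f" unfolding index_function_def
  proof (intro ballI allI impI)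
    fix p V assume p: "p \<in> X" and V: "transversal V (H p)"
    obtain d where d: "d > 0" "\<And>q. q \<in> X \<Longrightarrow> dist q p < d \<Longrightarrow> transversal V (H q) \<and> transversal (W p) (H q) \<and>
      int (n_plus (chart_form V (H q)) L) - int (n_plus (chart_form (W p) (H q)) L) =
      int (n_plus (chart_form V (H p)) L) - int (n_plus (chart_form (W p) (H p)) L)"
      using chart_difference_locally_constant[OF H L p V W[OF p]] by metis
    show "\<exists>d>0. \<forall>q\<in>X. dist q p < d \<longrightarrow> transversal V (H q) \<and>
       f q - f p = int (n_plus (chart_form V (H q)) L) - int (n_plus (chart_form V (H p)) L)"
    proof (intro exI[of _ "min d (r p)"] conjI ballI impI)
      fix q assume q: "q \<in> X" "dist q p < min d (r p)"
      then show "transversal V (H q)" using d(2) by auto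
      have "f q - f p = g p q - g p p"
        using q p r(1)[OF p] by (intro f) (auto simp: dist_commute)
      then show "f q - f p = int (n_plus (chart_form V (H q)) L) - int (n_plus (chart_form V (H p)) L)"
        using d(2)[of q] q by (auto simp: g_def)
    qed (use d r(1)[OF p] in auto)
  qed
  then show ?thesis by (rule that)
qed

text \<open>Used to restrict an index function to the four edges of a homotopy rectangle, which are
  parametrised without increasing distances.\<close>

lemma index_function_compose:
  fixes \<gamma> :: "'c::metric_space \<Rightarrow> 'b::metric_space"
  assumes f: "index_function L X H f" and \<gamma>: "\<gamma> ` S \<subseteq> X" "\<And>p q. p \<in> S \<Longrightarrow> q \<in> S \<Longrightarrow> dist (\<gamma> q) (\<gamma> p) \<le> dist q p"
    and l: "\<And>p. p \<in> S \<Longrightarrow> l p = H (\<gamma> p)"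
  shows "index_function L S l (\<lambda>p. f (\<gamma> p))"
  unfolding index_function_def
proof (intro ballI allI impI)
  fix p W assume p: "p \<in> S" and W: "transversal W (l p)"
  have gp: "\<gamma> p \<in> X" "transversal W (H (\<gamma> p))" using p \<gamma> W l by auto
  obtain d where d: "d > 0" "\<And>q. q \<in> X \<Longrightarrow> dist q (\<gamma> p) < d \<Longrightarrow> transversal W (H q) \<and>
     f q - f (\<gamma> p) = int (n_plus (chart_form W (H q)) L) - int (n_plus (chart_form W (H (\<gamma> p))) L)"
    using index_functionE[OF f gp] by metis
  show "\<exists>d>0. \<forall>q\<in>S. dist q p < d \<longrightarrow> transversal W (l q) \<and>
     f (\<gamma> q) - f (\<gamma> p) = int (n_plus (chart_form W (l q)) L) - int (n_plus (chart_form W (l p)) L)"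
  proof (intro exI[of _ d] conjI d(1) ballI impI)
    fix q assume q: "q \<in> S" "dist q p < d"
    then have "dist (\<gamma> q) (\<gamma> p) < d" using \<gamma>(2)[OF p q(1)] by simp
    from d(2)[OF _ this] show "transversal W (l q)"
      "f (\<gamma> q) - f (\<gamma> p) = int (n_plus (chart_form W (l q)) L) - int (n_plus (chart_form W (l p)) L)"
      using q p l \<gamma>(1) by auto
  qed
qed

lemma index_function_unique:
  assumes f: "index_function L X H f" and g: "index_function L X H g"
    and H: "\<And>p. p \<in> X \<Longrightarrow> lagrangian \<omega> (H p)"
    and X: "connected X" "p \<in> X" "q \<in> X"
  shows "f q - f p = g q - g p"
proof -
  have "f p - g p = f q - g q"
  proof (rule connected_local_const[where f = "\<lambda>z. f z - g z", OF X], intro ballI)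
    fix z assume z: "z \<in> X"
    obtain W where W: "transversal W (H z)" using exists_transversal[OF H[OF z]] by blast
    obtain d1 where d1: "d1 > 0" "\<And>q. q \<in> X \<Longrightarrow> dist q z < d1 \<Longrightarrow> transversal W (H q) \<and>
       f q - f z = int (n_plus (chart_form W (H q)) L) - int (n_plus (chart_form W (H z)) L)"
      using index_functionE[OF f z W] by metis
    obtain d2 where d2: "d2 > 0" "\<And>q. q \<in> X \<Longrightarrow> dist q z < d2 \<Longrightarrow> transversal W (H q) \<and>
       g q - g z = int (n_plus (chart_form W (H q)) L) - int (n_plus (chart_form W (H z)) L)"
      using index_functionE[OF g z W] by metis
    show "\<forall>\<^sub>F w in at z within X. f z - g z = f w - g w"
      unfolding eventually_at
      by (rule exI[of _ "min d1 d2"]) (use d1 d2 in \<open>force\<close>)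
  qed
  then show ?thesis by simp
qed

lemma index_function_constant_path:
  assumes f: "index_function L X H f" and l: "lagrangian \<omega> l" "\<And>p. p \<in> X \<Longrightarrow> H p = l"
    and X: "connected X" "p \<in> X" "q \<in> X"
  shows "f q = f p"
proof -
  have "index_function L X H (\<lambda>_. 0)"
    unfolding index_function_def by (auto simp: l intro: exI[of _ 1])
  from index_function_unique[OF f this _ X] show ?thesis using l by simp
qed

text \<open>An index function exists on the whole parameter rectangle. The two edges on which the
  endpoints are fixed are constant paths, so it takes equal values at their ends and the increments
  along the other two edges agree.\<close>

theorem index_function_homotopic:
  assumes L: "lagrangian \<omega> L" and h: "lag_homotopic \<omega> l m a b" and ab: "a \<le> b"
    and f: "index_function L {a..b} l f"
  obtains g where "index_function L {a..b} m g" "g b - g a = f b - f a"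
proof -
  obtain H :: "real \<times> real \<Rightarrow> 'a set" where H:
    "\<And>s t. s \<in> {0..1} \<Longrightarrow> t \<in> {a..b} \<Longrightarrow> lagrangian \<omega> (H (s,t))"
    "subspaces_continuous_on ({0..1} \<times> {a..b}) H"
    "\<And>t. t \<in> {a..b} \<Longrightarrow> H (0,t) = l t" "\<And>t. t \<in> {a..b} \<Longrightarrow> H (1,t) = m t"
    "\<And>s. s \<in> {0..1} \<Longrightarrow> H (s,a) = l a" "\<And>s. s \<in> {0..1} \<Longrightarrow> H (s,b) = l b"
    using h unfolding lag_homotopic_def by blast
  obtain F where F: "index_function L ({0..1} \<times> {a..b}) H F"
    by (rule exists_index_function[OF H(2) _ L]) (use H(1) in \<open>auto intro: compact_Times convex_Times\<close>)
  have F0: "index_function L {a..b} l (\<lambda>t. F (0, t))"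
    by (rule index_function_compose[OF F]) (auto simp: H dist_Pair_Pair)
  have F1: "index_function L {a..b} m (\<lambda>t. F (1, t))"
    by (rule index_function_compose[OF F]) (auto simp: H dist_Pair_Pair)
  have Fa: "index_function L {0..1} (\<lambda>s. H (s, a)) (\<lambda>s. F (s, a))"
    by (rule index_function_compose[OF F]) (use ab in \<open>auto simp: dist_Pair_Pair\<close>)
  have Fb: "index_function L {0..1} (\<lambda>s. H (s, b)) (\<lambda>s. F (s, b))"
    by (rule index_function_compose[OF F]) (use ab in \<open>auto simp: dist_Pair_Pair\<close>)
  have lag: "lagrangian \<omega> (l t)" "lagrangian \<omega> (m t)" if "t \<in> {a..b}" for t
    using H(1)[of 0 t] H(1)[of 1 t] H(3,4)[OF that] that by auto
  have "F (1, a) = F (0, a)"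
    by (rule index_function_constant_path[OF Fa lag(1)[of a]]) (use ab H in auto)
  moreover have "F (1, b) = F (0, b)"
    by (rule index_function_constant_path[OF Fb lag(1)[of b]]) (use ab H in auto)
  moreover have "f b - f a = F (0, b) - F (0, a)"
    by (rule index_function_unique[OF f F0]) (use ab lag in auto)
  ultimately show ?thesis by (intro that[OF F1]) simp
qed

end

section \<open>The crossing formula\<close>

text \<open>An integer function with one-sided jumps \<open>p\<close> and \<open>m\<close> changes
  by the sum of its jumps. Isolation of the exceptional points together with compactness of the
  interval makes them finite in number.\<close>

lemma jump_sum:
  fixes f p m :: "real \<Rightarrow> int"
  assumes ab: "a < b"
    and ev: "\<And>t. t \<in> {a..b} \<Longrightarrow> \<forall>\<^sub>F s in at t within {a..b}.
        \<not> C s \<and> (t < s \<longrightarrow> f s = f t + p t) \<and> (s < t \<longrightarrow> f s = f t + m t)"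
    and zero: "\<And>t. t \<in> {a..b} \<Longrightarrow> \<not> C t \<Longrightarrow> p t = 0 \<and> m t = 0"
  shows "p a + (\<Sum>t\<in>{t\<in>{a<..<b}. C t}. p t - m t) - m b = f b - f a"
proof -
  have rad: "\<exists>d>0. \<forall>s\<in>{a..b}. s \<noteq> t \<and> dist s t < d \<longrightarrow>
      \<not> C s \<and> (t < s \<longrightarrow> f s = f t + p t) \<and> (s < t \<longrightarrow> f s = f t + m t)" if "t \<in> {a..b}" for t
    using ev[OF that] by (simp add: eventually_at)
  have fin: "finite {t\<in>{a..b}. C t}"
  proof (rule ccontr)
    assume "infinite {t\<in>{a..b}. C t}"
    then obtain x where x: "x \<in> {a..b}" "x islimpt {t\<in>{a..b}. C t}"
      using compact_eq_Bolzano_Weierstrass[of "{a..b}"] compact_Icc by blast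
    obtain d where "d > 0" "\<forall>s\<in>{a..b}. s \<noteq> x \<and> dist s x < d \<longrightarrow> \<not> C s" using rad[OF x(1)] by blast
    then show False using x(2) unfolding islimpt_approachable by blast
  qed
  define E where "E t = {c\<in>{a<..<t}. C c}" for t
  have finE: "finite (E t)" if "t \<le> b" for t
    by (rule finite_subset[OF _ fin]) (use that in \<open>auto simp: E_def\<close>)
  \<comment> \<open>\<open>f t + m t\<close> is the left limit of \<open>f\<close> at
    \<open>t\<close>; all jumps strictly before \<open>t\<close> are subtracted, so \<open>g\<close>
    should be constant. At \<open>a\<close> there is no left limit, hence the separate
    value.\<close>
  define g where "g t = (if t = a then f a else f t + m t - p a - (\<Sum>c\<in>E t. p c - m c))" for t
  have "g a = g b"
  proof (rule connected_local_const[where A = "{a..b}" and f = g], intro connected_Icc)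
    show "\<forall>t\<in>{a..b}. \<forall>\<^sub>F s in at t within {a..b}. g t = g s"
    proof
      fix t assume t: "t \<in> {a..b}"
      obtain d0 where d0: "d0 > 0" "\<And>s. s \<in> {a..b} \<Longrightarrow> s \<noteq> t \<Longrightarrow> dist s t < d0 \<Longrightarrow>
          \<not> C s \<and> (t < s \<longrightarrow> f s = f t + p t) \<and> (s < t \<longrightarrow> f s = f t + m t)"
        using rad[OF t] by blast
      \<comment> \<open>For \<open>t > a\<close> the neighbourhood must avoid \<open>a\<close>,
        where \<open>g\<close> is given by the other clause.\<close>
      define d where "d = (if t = a then d0 else min d0 (t - a))"
      have dpos: "d > 0" using d0(1) t by (auto simp: d_def)
      have "d \<le> d0" by (simp add: d_def)
      then have d: "\<not> C s \<and> (t < s \<longrightarrow> f s = f t + p t) \<and> (s < t \<longrightarrow> f s = f t + m t)"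
        if "s \<in> {a..b}" "s \<noteq> t" "dist s t < d" for s
        by (intro d0(2)) (use that in simp_all)
      have nC: "\<not> C c" if "c \<in> {a..b}" "c \<noteq> t" "\<bar>c - t\<bar> < d" for c
        using d[of c] that by (auto simp: dist_real_def)
      have "g t = g s" if s: "s \<in> {a..b}" "s \<noteq> t" "dist s t < d" for s
      proof -
        have ms: "m s = 0" using d[OF s] zero[OF s(1)] by blast
        have st: "\<bar>s - t\<bar> < d" using s(3) by (simp add: dist_real_def)
        show ?thesis
        proof (cases "t < s")
          case True
          then have fs: "f s = f t + p t" using d[OF s] by blast
          show ?thesis
          proof (cases "t = a")
            case ta: True
            have "\<not> C c" if "c \<in> {a<..<s}" for c
              by (rule nC) (use that ta st s(1) in auto)
            then have "E s = {}" by (auto simp: E_def)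
            then show ?thesis using ta True fs ms by (simp add: g_def)
          next
            case False
            then have ta: "a < t" using t by auto
            \<comment> \<open>The point \<open>t\<close> itself may or may not be exceptional.
              Adding it to both sets treats the two cases together, since its contribution
              \<open>p t - m t\<close> vanishes when it is not.\<close>
            have "insert t (E s) = insert t (E t)"
            proof (intro set_eqI iffI)
              fix c assume c: "c \<in> insert t (E s)"
              show "c \<in> insert t (E t)"
              proof (rule ccontr)
                assume "c \<notin> insert t (E t)"
                then have "t < c" "c < s" "C c" using c ta by (auto simp: E_def)
                then show False using nC[of c] st s(1) t by auto
              qed
            qed (use True ta in \<open>auto simp: E_def\<close>)
            moreover have tE: "t \<notin> E t" by (simp add: E_def)
            ultimately have "(\<Sum>c\<in>insert t (E s). p c - m c) = (p t - m t) + (\<Sum>c\<in>E t. p c - m c)"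
              using finE[of t] t by simp
            moreover have "(\<Sum>c\<in>insert t (E s). p c - m c) = (\<Sum>c\<in>E s. p c - m c)"
            proof (cases "t \<in> E s")
              case True then show ?thesis by (simp add: insert_absorb)
            next
              case False
              then have "\<not> C t" using ta True by (auto simp: E_def)
              then show ?thesis using False finE[of s] s(1) zero[OF t] by simp
            qed
            ultimately show ?thesis using ta True fs ms by (simp add: g_def)
          qed
        next
          case False
          then have st': "s < t" using s by simp
          then have fs: "f s = f t + m t" using d[OF s] by blast
          have Es: "E t = E s"
          proof (intro set_eqI iffI)
            fix c assume c: "c \<in> E t"
            show "c \<in> E s"
            proof (rule ccontr)
              assume "c \<notin> E s"
              then have "s \<le> c" "c < t" "C c" using c by (auto simp: E_def)
              then show False using nC[of c] st s(1) t by auto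
            qed
          qed (use st' in \<open>auto simp: E_def\<close>)
          have "t \<noteq> a" using st' s(1) by auto
          moreover from this have "s \<noteq> a" using st st' by (auto simp: d_def)
          ultimately show ?thesis using fs ms Es by (simp add: g_def)
        qed
      qed
      then show "\<forall>\<^sub>F s in at t within {a..b}. g t = g s"
        unfolding eventually_at using dpos by auto
    qed
  qed (use ab in auto)
  then show ?thesis using ab by (simp add: g_def E_def)
qed

context symplectic_space
begin

text \<open>The Lagrangian hidden in the choice operator of \<open>crossing_form\<close> is brought
  out, and the uniform expansion in that chart identifies the derivative within the interval. The
  formula by the velocity makes the sign of the form accessible without knowing
  \<open>W\<close>.\<close>

lemma crossing_form_expansion:
  fixes A :: "real \<Rightarrow> 'a \<Rightarrow>\<^sub>L 'a"
  assumes ab: "a < b" and t0: "t0 \<in> {a..b}" and L: "subspace L"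
    and lag: "\<And>t. t \<in> {a..b} \<Longrightarrow> lagrangian \<omega> (l t)" and l: "\<And>t. t \<in> {a..b} \<Longrightarrow> l t = A t ` L"
    and A': "(A has_vector_derivative A') (at t0 within {a..b})"
  obtains W d where "transversal W (l t0)" "quadform d" "\<And>v. crossing_form \<omega> l a b t0 v = d v"
    "\<And>e. e > 0 \<Longrightarrow> \<forall>\<^sub>F t in at t0 within {a..b}. transversal W (l t) \<and>
       (\<forall>v. \<bar>chart_form W (l t) v - chart_form W (l t0) v - (t - t0) * d v\<bar> \<le> e * \<bar>t - t0\<bar> * (norm v)\<^sup>2)"
    "\<And>v. v \<in> l t0 \<Longrightarrow> \<exists>u\<in>L. A t0 u = v \<and> d v = \<omega> v (A' u)"
proof -
  define W where "W = (SOME W. lagrangian \<omega> W \<and> W \<inter> l t0 = {0})"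
  have "\<exists>W. lagrangian \<omega> W \<and> W \<inter> l t0 = {0}"
    using exists_transversal[OF lag[OF t0]] unfolding transversal_def by blast
  from someI_ex[OF this, folded W_def] have W: "transversal W (l t0)"
    using lag[OF t0] by (simp add: transversal_def)
  obtain d where d: "quadform d"
    "\<And>e. e > 0 \<Longrightarrow> \<forall>\<^sub>F t in at t0 within {a..b}. transversal W (l t) \<and>
       (\<forall>v. \<bar>chart_form W (l t) v - chart_form W (l t0) v - (t - t0) * d v\<bar> \<le> e * \<bar>t - t0\<bar> * (norm v)\<^sup>2)"
    "\<And>v. v \<in> l t0 \<Longrightarrow> \<exists>u\<in>L. A t0 u = v \<and> d v = \<omega> v (A' u)"
    by (rule chart_form_differentiable[where S = "{a..b}" and A = A and l = l, OF W L t0 lag l A']) blast+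
  have "crossing_form \<omega> l a b t0 v = d v" for v
  proof -
    let ?F = "\<lambda>t. \<omega> v (THE w. w \<in> W \<and> v + w \<in> l t)"
    have F: "?F t = chart_form W (l t) v" if t: "transversal W (l t)" for t
    proof -
      note c = transversal_complementary[OF t]
      have sW: "subspace W" using c by (simp add: complementary_def)
      have "(THE w. w \<in> W \<and> v + w \<in> l t) = - pr W (l t) v"
      proof (rule the_equality)
        show "- pr W (l t) v \<in> W \<and> v + - pr W (l t) v \<in> l t"
          using pr_in[OF c] subspace_neg[OF sW] by simp
        fix w assume w: "w \<in> W \<and> v + w \<in> l t"
        then have "pr W (l t) v = - w" using subspace_neg[OF sW] by (intro pr_unique[OF c]) auto
        then show "w = - pr W (l t) v" by simp
      qed
      then show ?thesis using omega_skew[of v "pr W (l t) v"] by (simp add: chart_form_def omega_simps)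
    qed
    have "\<forall>\<^sub>F t in at t0 within {a..b}. norm (?F t - ?F t0 - (t - t0) *\<^sub>R d v) \<le> e * norm (t - t0)"
      if e: "e > 0" for e
    proof -
      \<comment> \<open>The summand 1 keeps the quotient meaningful for
        \<open>v = 0\<close>.\<close>
      define e' where "e' = e / ((norm v)\<^sup>2 + 1)"
      have p: "(norm v)\<^sup>2 + 1 > 0" by (simp add: add_nonneg_pos)
      then have e': "e' > 0" "e' * (norm v)\<^sup>2 \<le> e" using e by (auto simp: e'_def field_simps)
      from d(2)[OF e'(1)] show ?thesis
      proof eventually_elim
        case (elim t)
        have "\<bar>?F t - ?F t0 - (t - t0) * d v\<bar> \<le> e' * \<bar>t - t0\<bar> * (norm v)\<^sup>2"
          using elim F[of t] F[of t0] W by simp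
        also have "\<dots> = e' * (norm v)\<^sup>2 * \<bar>t - t0\<bar>" by simp
        also have "\<dots> \<le> e * \<bar>t - t0\<bar>" using e' by (intro mult_right_mono) auto
        finally show ?case by simp
      qed
    qed
    then have "(?F has_vector_derivative d v) (at t0 within {a..b})"
      unfolding has_vector_derivative_def has_derivative_within_alt2
      by (simp add: bounded_linear_mult_left)
    then have "vector_derivative ?F (at t0 within {a..b}) = d v"
      using ab t0 by (intro vector_derivative_within_closed_interval) auto
    then show ?thesis by (simp add: crossing_form_def W_def Let_def)
  qed
  then show ?thesis using that[OF W d(1) _ d(2,3)] by blast
qed

lemma n_plus_trivial:
  assumes "quadform q" shows "n_plus q {0} = 0" "n_minus q {0} = 0"
  unfolding n_minus_eq by (intro n_plus_eq_0; simp add: quadform_zero[OF assms])+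

text \<open>The right and left jumps of the index function are \<open>n_plus\<close> and
  \<open>n_minus\<close> of the crossing form, so an interior crossing contributes their difference,
  the signature, while each endpoint shows only one of its two jumps.\<close>

theorem crossing_sum_eq_index:
  assumes L: "lagrangian \<omega> L" and ab: "a < b" and m: "lag_C1 \<omega> m a b"
    and reg: "regular_crossings \<omega> L m a b" and f: "index_function L {a..b} m f"
  shows "crossing_sum \<omega> L m a b = f b - f a"
proof -
  obtain Z :: "real \<Rightarrow> 'a \<Rightarrow>\<^sub>L 'a" and Z' where lag: "\<And>t. t \<in> {a..b} \<Longrightarrow> lagrangian \<omega> (m t)"
    and Z: "\<And>t. t \<in> {a..b} \<Longrightarrow> m t = range (Z t)"
      "\<And>t. t \<in> {a..b} \<Longrightarrow> (Z has_vector_derivative Z' t) (at t within {a..b})"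
    using m unfolding lag_C1_def C1_on_def by blast
  let ?\<Gamma> = "crossing_form \<omega> m a b"
  let ?p = "\<lambda>t. int (n_plus (?\<Gamma> t) (m t \<inter> L))" and ?m = "\<lambda>t. int (n_minus (?\<Gamma> t) (m t \<inter> L))"
  have exp: "quadform (?\<Gamma> t) \<and> (\<forall>\<^sub>F s in at t within {a..b}. \<not> is_crossing L m s \<and>
      (t < s \<longrightarrow> f s = f t + ?p t) \<and> (s < t \<longrightarrow> f s = f t + ?m t))" if t: "t \<in> {a..b}" for t
  proof -
    obtain W d where d: "transversal W (m t)" "quadform d" "\<And>v. ?\<Gamma> t v = d v"
      "\<And>e. e > 0 \<Longrightarrow> \<forall>\<^sub>F s in at t within {a..b}. transversal W (m s) \<and>
       (\<forall>v. \<bar>chart_form W (m s) v - chart_form W (m t) v - (s - t) * d v\<bar> \<le> e * \<bar>s - t\<bar> * (norm v)\<^sup>2)"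
      by (rule crossing_form_expansion[where l = m and A = Z, OF ab t subspace_UNIV lag Z(1) Z(2)[OF t]]) blast+
    have \<Gamma>: "?\<Gamma> t = d" using d(3) by (intro ext)
    have nd: "qf_nondegenerate d (m t \<inter> L)"
    proof (cases "is_crossing L m t")
      case True
      then show ?thesis using reg t unfolding regular_crossings_def \<Gamma>[symmetric] by blast
    next
      case False
      then show ?thesis by (auto simp: is_crossing_def qf_nondegenerate_def)
    qed
    obtain r where r: "r > 0" "\<And>s. s \<in> {a..b} \<Longrightarrow> dist s t < r \<Longrightarrow> transversal W (m s) \<and>
       f s - f t = int (n_plus (chart_form W (m s)) L) - int (n_plus (chart_form W (m t)) L)"
      using index_functionE[OF f t d(1)] by metis
    have "\<forall>\<^sub>F s in at t within {a..b}. s \<in> {a..b} \<and> dist s t < r"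
      unfolding eventually_at using r(1) by blast
    moreover have "\<forall>\<^sub>F s in at t within {a..b}. m s \<inter> L = {0} \<and>
     (t < s \<longrightarrow> n_plus (chart_form W (m s)) L = n_plus (chart_form W (m t)) L + n_plus d (m t \<inter> L)) \<and>
     (s < t \<longrightarrow> n_plus (chart_form W (m s)) L = n_plus (chart_form W (m t)) L + n_minus d (m t \<inter> L))"
      by (rule crossing_jump[where l = m and ?t0.0 = t, OF d(1) L d(2) _ nd]) (rule d(4))
    ultimately have "\<forall>\<^sub>F s in at t within {a..b}. \<not> is_crossing L m s \<and>
      (t < s \<longrightarrow> f s = f t + ?p t) \<and> (s < t \<longrightarrow> f s = f t + ?m t)"
    proof eventually_elim
      case (elim s)
      then have e: "f s - f t = int (n_plus (chart_form W (m s)) L) - int (n_plus (chart_form W (m t)) L)"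
        using r(2) by blast
      show ?case unfolding \<Gamma> is_crossing_def
      proof (intro conjI impI)
        show "\<not> m s \<inter> L \<noteq> {0}" using elim(2) by blast
        show "f s = f t + int (n_plus d (m t \<inter> L))" if "t < s" using elim(2) that e by linarith
        show "f s = f t + int (n_minus d (m t \<inter> L))" if "s < t" using elim(2) that e by linarith
      qed
    qed
    then show ?thesis using d(2) \<Gamma> by simp
  qed
  have z: "?p t = 0 \<and> ?m t = 0" if "t \<in> {a..b}" "\<not> is_crossing L m t" for t
    using that(2) n_plus_trivial[OF conjunct1[OF exp[OF that(1)]]] by (simp add: is_crossing_def)
  have "?p a + (\<Sum>t\<in>{t\<in>{a<..<b}. is_crossing L m t}. ?p t - ?m t) - ?m b = f b - f a"
    by (rule jump_sum[OF ab]) (use exp z in auto)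
  then show ?thesis by (simp add: crossing_sum_def qf_signature_def)
qed

text \<open>Both halves of the definite description: homotopy invariance gives every regular
  representative the same count, and \<open>m\<close> supplies existence.\<close>

theorem iota_CLM_eq_index:
  assumes L: "lagrangian \<omega> L" and ab: "a < b" and f: "index_function L {a..b} l f"
    and m: "lag_C1 \<omega> m a b" "regular_crossings \<omega> L m a b" "lag_homotopic \<omega> l m a b"
  shows "iota_CLM \<omega> L l a b = f b - f a"
  unfolding iota_CLM_def
proof (rule the_equality)
  have cs: "crossing_sum \<omega> L m' a b = f b - f a"
    if m': "lag_C1 \<omega> m' a b" "regular_crossings \<omega> L m' a b" "lag_homotopic \<omega> l m' a b" for m'
  proof -
    obtain g where g: "index_function L {a..b} m' g" "g b - g a = f b - f a"
      using index_function_homotopic[OF L m'(3) less_imp_le[OF ab] f] by blast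
    then show ?thesis using crossing_sum_eq_index[OF L ab m'(1,2) g(1)] by simp
  qed
  show "\<exists>m. lag_C1 \<omega> m a b \<and> regular_crossings \<omega> L m a b \<and> lag_homotopic \<omega> l m a b \<and>
      f b - f a = crossing_sum \<omega> L m a b"
    using cs[OF m] m by metis
  fix k assume "\<exists>m. lag_C1 \<omega> m a b \<and> regular_crossings \<omega> L m a b \<and> lag_homotopic \<omega> l m a b \<and>
      k = crossing_sum \<omega> L m a b"
  then show "k = f b - f a" using cs by auto
qed

section \<open>Regular representatives\<close>

lemma symplectic_comp_lagrangian:
  fixes A :: "'a \<Rightarrow>\<^sub>L 'a"
  assumes "\<And>u v. \<omega> (A u) (A v) = \<omega> u v" "lagrangian \<omega> L"
  shows "lagrangian \<omega> (A ` L)"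
  by (rule lagrangian_image[OF assms(2) linear_blinfun symplectic_map_bij[OF assms(1)] assms(1)])

text \<open>\<open>lag_C1\<close> asks for ranges of operators on the whole space; composing with
  the orthogonal projection onto \<open>L\<close> turns the image of \<open>L\<close> into such a
  range.\<close>

lemma lag_C1_image:
  fixes A :: "real \<Rightarrow> 'a \<Rightarrow>\<^sub>L 'a"
  assumes A: "C1_on {a..b} A" and lag: "\<And>t. t \<in> {a..b} \<Longrightarrow> lagrangian \<omega> (A t ` L)" and L: "subspace L"
  shows "lag_C1 \<omega> (\<lambda>t. A t ` L) a b"
proof -
  note c = complementary_orthogonal[OF L]
  let ?p = "pr L {y. \<forall>x\<in>L. orthogonal x y}"
  obtain P where P: "blinfun_apply P = ?p" using linear_imp_blinfun[OF linear_pr[OF c]] by blast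
  have rP: "range (blinfun_apply P) = L"
    using pr_in(1)[OF c] pr_left[OF c] unfolding P by (metis (no_types, lifting) image_subset_iff
        rangeI subsetI subset_antisym)
  obtain A' where A': "\<And>t. t \<in> {a..b} \<Longrightarrow> (A has_vector_derivative A' t) (at t within {a..b})"
    "continuous_on {a..b} A'" using A unfolding C1_on_def by blast
  have "C1_on {a..b} (\<lambda>t. A t o\<^sub>L P)" unfolding C1_on_def
  proof (intro exI[of _ "\<lambda>t. A' t o\<^sub>L P"] conjI ballI)
    fix t assume "t \<in> {a..b}"
    from bounded_linear.has_vector_derivative[OF
        bounded_bilinear.bounded_linear_left[OF bounded_bilinear_blinfun_compose] A'(1)[OF this]]
    show "((\<lambda>t. A t o\<^sub>L P) has_vector_derivative (A' t o\<^sub>L P)) (at t within {a..b})" .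
  next
    show "continuous_on {a..b} (\<lambda>t. A' t o\<^sub>L P)" by (intro continuous_intros A'(2))
  qed
  moreover have "A t ` L = range (blinfun_apply (A t o\<^sub>L P))" for t
    using rP by (auto simp: image_image[symmetric])
  ultimately show ?thesis unfolding lag_C1_def using lag by blast
qed

text \<open>The amount by which the given path can move in the negative direction, which a fast
  rotation has to outweigh. It is measured against \<open>\<psi> t u\<close>, so a uniform lower
  bound for \<open>\<psi> t\<close> is needed.\<close>

lemma symplectic_velocity_bound:
  fixes \<psi> \<psi>' :: "real \<Rightarrow> 'a \<Rightarrow>\<^sub>L 'a"
  assumes S: "compact S" and c: "continuous_on S \<psi>" "continuous_on S \<psi>'"
    and sp: "\<And>t u v. t \<in> S \<Longrightarrow> \<omega> (\<psi> t u) (\<psi> t v) = \<omega> u v"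
  obtains K where "K > 0" "\<And>t u. t \<in> S \<Longrightarrow> \<bar>\<omega> (\<psi> t u) (\<psi>' t u)\<bar> \<le> K * (norm (\<psi> t u))\<^sup>2"
proof -
  obtain D where D: "D > 0" "\<And>x y. \<bar>\<omega> x y\<bar> \<le> D * norm x * norm y" using omega_bounded by blast
  obtain M where M: "M > 0" "\<And>t. t \<in> S \<Longrightarrow> norm (\<psi> t) \<le> M"
    using compact_imp_bounded[OF compact_continuous_image[OF c(1) S]] unfolding bounded_pos by auto
  obtain M' where M': "M' > 0" "\<And>t. t \<in> S \<Longrightarrow> norm (\<psi>' t) \<le> M'"
    using compact_imp_bounded[OF compact_continuous_image[OF c(2) S]] unfolding bounded_pos by auto
  define c where "c = D * (M * norm dual_op)"
  have c0: "c \<ge> 0" using D M by (simp add: c_def)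
  have low: "norm u \<le> c * norm (\<psi> t u)" if t: "t \<in> S" for t u
  proof (cases "u = 0")
    case False
    \<comment> \<open>Symplecticity itself bounds the inverse:
      \<open>|u|^2 = \<omega> u (X u)\<close> is preserved by \<open>\<psi> t\<close>.\<close>
    have "(norm u)\<^sup>2 = \<omega> (\<psi> t u) (\<psi> t (dual_op u))"
      by (simp add: sp[OF t] omega_dual_op power2_norm_eq_inner)
    also have "\<dots> \<le> D * norm (\<psi> t u) * norm (\<psi> t (dual_op u))"
      using D(2)[of "\<psi> t u" "\<psi> t (dual_op u)"] by simp
    also have "norm (\<psi> t (dual_op u)) \<le> M * (norm dual_op * norm u)"
      using norm_blinfun[of "\<psi> t" "dual_op u"] M t norm_blinfun[of dual_op u]
      by (meson less_imp_le mult_mono norm_ge_zero order_trans)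
    then have "D * norm (\<psi> t u) * norm (\<psi> t (dual_op u)) \<le> D * norm (\<psi> t u) * (M * (norm dual_op * norm u))"
      using D by (intro mult_left_mono) auto
    finally have "norm u * norm u \<le> (c * norm (\<psi> t u)) * norm u"
      by (simp add: c_def power2_eq_square mult_ac)
    then show ?thesis using False by simp
  qed (simp add: c0)
  show ?thesis
  proof (rule that[of "D * (M' * c) + 1"])
    show "D * (M' * c) + 1 > 0" using D M' c0 by (simp add: add_nonneg_pos)
    fix t u assume t: "t \<in> S"
    have "norm (\<psi>' t u) \<le> M' * (c * norm (\<psi> t u))"
      using norm_blinfun[of "\<psi>' t" u] M'(2)[OF t] low[OF t, of u] M'(1)
      by (meson less_imp_le mult_mono norm_ge_zero order_trans)
    then have "D * norm (\<psi> t u) * norm (\<psi>' t u) \<le> D * norm (\<psi> t u) * (M' * (c * norm (\<psi> t u)))"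
      using D by (intro mult_left_mono) auto
    also have "\<dots> = D * (M' * c) * (norm (\<psi> t u))\<^sup>2" by (simp add: power2_eq_square)
    also have "\<dots> \<le> (D * (M' * c) + 1) * (norm (\<psi> t u))\<^sup>2" by (intro mult_right_mono) auto
    finally show "\<bar>\<omega> (\<psi> t u) (\<psi>' t u)\<bar> \<le> (D * (M' * c) + 1) * (norm (\<psi> t u))\<^sup>2"
      using D(2)[of "\<psi> t u" "\<psi>' t u"] by linarith
  qed
qed

text \<open>A smoothing of the tent \<open>c * (T/2 - |t - T/2|)\<close>, with the absolute value of
  \<open>x\<close> replaced by \<open>sqrt (x\<^sup>2 + \<delta>\<^sup>2)\<close>. For
  \<open>|x| \<ge> \<delta>\<close> the slope of this root is still at least one half in absolute
  value, and the peak deviates from \<open>c * (T/2)\<close> by a multiple of \<delta>.\<close>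

lemma tent_function:
  fixes T c \<delta> :: real
  assumes T: "T > 0" and c: "c > 0" and \<delta>: "\<delta> > 0"
  obtains \<phi> \<phi>' where "\<phi> 0 = 0" "\<phi> T = 0" "\<And>t. t \<in> {0..T} \<Longrightarrow> \<phi> t \<in> {0..c * (T/2)}"
    "\<And>t S. (\<phi> has_vector_derivative \<phi>' t) (at t within S)" "\<And>S. continuous_on S \<phi>'"
    "\<And>t. t \<le> T/2 - \<delta> \<Longrightarrow> \<phi>' t \<ge> c / 2" "\<And>t. t \<ge> T/2 + \<delta> \<Longrightarrow> \<phi>' t \<le> - (c / 2)"
    "\<And>t. \<bar>t - T/2\<bar> \<le> \<delta> \<Longrightarrow> \<bar>\<phi> t - c * (T/2)\<bar> \<le> 3 * c * \<delta>"
proof -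
  define s where "s x = sqrt (x\<^sup>2 + \<delta>\<^sup>2)" for x
  have pos: "x\<^sup>2 + \<delta>\<^sup>2 > 0" for x using \<delta> by (simp add: add_nonneg_pos)
  then have s0: "s x > 0" for x by (simp add: s_def)
  have s1: "s x \<le> \<bar>x\<bar> + \<delta>" for x
    using sqrt_sum_squares_le_sum_abs[of x \<delta>] \<delta> by (simp add: s_def)
  have s2: "\<delta> \<le> s x" for x using \<delta> by (simp add: s_def real_le_rsqrt)
  have s3: "\<bar>x\<bar> \<le> s x" for x by (simp add: s_def real_le_rsqrt)
  have s4: "s x \<le> s y" if "\<bar>x\<bar> \<le> \<bar>y\<bar>" for x y
    using that by (simp add: s_def abs_le_square_iff)
  define \<phi> where "\<phi> t = c * (sqrt ((T/2)\<^sup>2 + \<delta>\<^sup>2) - sqrt ((t - T/2)\<^sup>2 + \<delta>\<^sup>2))" for t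
  have \<phi>: "\<phi> t = c * (s (T/2) - s (t - T/2))" for t by (simp add: \<phi>_def s_def)
  define \<phi>' where "\<phi>' t = c * ((T/2 - t) / s (t - T/2))" for t
  show ?thesis
  proof (rule that[of \<phi> \<phi>'])
    show "\<phi> 0 = 0" "\<phi> T = 0" by (simp_all add: \<phi>_def)
    show "\<phi> t \<in> {0..c * (T/2)}" if "t \<in> {0..T}" for t
    proof -
      have "s (t - T/2) \<le> s (T/2)" using that T by (intro s4) (auto simp: abs_if)
      moreover have "s (T/2) - s (t - T/2) \<le> T/2" using s1[of "T/2"] s2[of "t - T/2"] T by simp
      ultimately show ?thesis using c by (simp add: \<phi> mult_left_mono)
    qed
    show "(\<phi> has_vector_derivative \<phi>' t) (at t within S)" for t S
    proof -
      have "(\<phi> has_real_derivative \<phi>' t) (at t)"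
        unfolding \<phi>_def \<phi>'_def s_def using pos[of "t - T/2"]
        by (auto intro!: derivative_eq_intros simp: field_simps)
      then show ?thesis
        using has_field_derivative_at_within has_real_derivative_iff_has_vector_derivative by blast
    qed
    show "continuous_on S \<phi>'" for S
      unfolding \<phi>'_def s_def using pos by (intro continuous_intros) (metis less_irrefl real_sqrt_eq_zero_cancel_iff)
    have half: "1 / 2 \<le> \<bar>x\<bar> / s x" if "\<delta> \<le> \<bar>x\<bar>" for x
      using s1[of x] s0[of x] that by (simp add: field_simps)
    show "\<phi>' t \<ge> c / 2" if "t \<le> T/2 - \<delta>" for t
    proof -
      have "1 / 2 \<le> (T/2 - t) / s (t - T/2)" using half[of "t - T/2"] that \<delta> by simp
      then have "c * (1 / 2) \<le> c * ((T/2 - t) / s (t - T/2))" using c by (intro mult_left_mono) auto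
      then show ?thesis by (simp add: \<phi>'_def)
    qed
    show "\<phi>' t \<le> - (c / 2)" if "t \<ge> T/2 + \<delta>" for t
    proof -
      have "1 / 2 \<le> (t - T/2) / s (t - T/2)" using half[of "t - T/2"] that \<delta> by simp
      then have "c * (1 / 2) \<le> c * ((t - T/2) / s (t - T/2))" using c by (intro mult_left_mono) auto
      moreover have "(T/2 - t) / s (t - T/2) = - ((t - T/2) / s (t - T/2))"
        by (simp add: diff_divide_distrib)
      ultimately show ?thesis by (simp add: \<phi>'_def)
    qed
    show "\<bar>\<phi> t - c * (T/2)\<bar> \<le> 3 * c * \<delta>" if "\<bar>t - T/2\<bar> \<le> \<delta>" for t
    proof -
      have "\<bar>s (T/2) - s (t - T/2) - T/2\<bar> \<le> 3 * \<delta>"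
        using s1[of "T/2"] s3[of "T/2"] s1[of "t - T/2"] s2[of "t - T/2"] that T \<delta> by linarith
      then have "c * \<bar>s (T/2) - s (t - T/2) - T/2\<bar> \<le> c * (3 * \<delta>)" using c by (intro mult_left_mono) auto
      moreover have "\<phi> t - c * (T/2) = c * (s (T/2) - s (t - T/2) - T/2)" by (simp add: \<phi> algebra_simps)
      ultimately show ?thesis using c by (simp add: abs_mult mult_ac)
    qed
  qed
qed

text \<open>Composing the path with a fast positive rotation that is wound up and then down again makes
  all crossing forms definite; the turning point is placed off the Maslov cycle.\<close>

theorem exists_regular_representative:
  fixes \<psi> :: "real \<Rightarrow> 'a \<Rightarrow>\<^sub>L 'a"
  assumes T: "0 < T" and L: "lagrangian \<omega> L" and M: "lagrangian \<omega> M"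
    and sp: "\<And>t u v. t \<in> {0..T} \<Longrightarrow> \<omega> (\<psi> t u) (\<psi> t v) = \<omega> u v" and C1: "C1_on {0..T} \<psi>"
  obtains m where "lag_C1 \<omega> m 0 T" "regular_crossings \<omega> L m 0 T" "lag_homotopic \<omega> (\<lambda>t. \<psi> t ` M) m 0 T"
proof -
  note sM = lagrangian_subspace[OF M]
  obtain \<psi>' where \<psi>': "\<And>t. t \<in> {0..T} \<Longrightarrow> (\<psi> has_vector_derivative \<psi>' t) (at t within {0..T})"
    "continuous_on {0..T} \<psi>'" using C1 unfolding C1_on_def by blast
  have c\<psi>: "continuous_on {0..T} \<psi>" by (rule continuous_on_vector_derivative[OF \<psi>'(1)])
  obtain K where K: "K > 0" "\<And>t u. t \<in> {0..T} \<Longrightarrow> \<bar>\<omega> (\<psi> t u) (\<psi>' t u)\<bar> \<le> K * (norm (\<psi> t u))\<^sup>2"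
    by (rule symplectic_velocity_bound[OF compact_Icc c\<psi> \<psi>'(2) sp]) blast+
  \<comment> \<open>The tent will have slope at least \<open>1 / (2 * T)\<close> in absolute value
    away from its peak, so this \<open>N\<close> makes the rotation beat the velocity bound
    \<open>K\<close> there.\<close>
  obtain N :: nat where N: "2 * T * K / rotation_rate < real N" using reals_Archimedean2 by blast
  have N': "K < real N * rotation_rate / (2 * T)"
    using N T rotation_rate_pos by (simp add: field_simps)
  obtain R R' where R0: "R 0 = id_blinfun" and RD: "\<And>s S. (R has_vector_derivative R' s) (at s within S)"
    and cR': "\<And>S. continuous_on S R'" and Rsp: "\<And>s u v. \<omega> (R s u) (R s v) = \<omega> u v"
    and Rpos: "\<And>s u. 0 \<le> s \<Longrightarrow> s \<le> 1 \<Longrightarrow> real N * rotation_rate * (norm u)\<^sup>2 \<le> \<omega> (R s u) (R' s u)"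
    by (rule fast_rotation[of N]) blast
  have cR: "continuous_on S R" for S by (rule continuous_on_vector_derivative[OF RD])
  have N0: "real N * rotation_rate > 0"
    using less_trans[OF K(1) N'] T by (simp add: zero_less_divide_iff)
  have Bsp: "\<omega> ((R s o\<^sub>L \<psi> t) u) ((R s o\<^sub>L \<psi> t) v) = \<omega> u v" if "t \<in> {0..T}" for s t u v
    using that by (simp add: Rsp sp)
  have Blag: "lagrangian \<omega> ((R s o\<^sub>L \<psi> t) ` M)" if "t \<in> {0..T}" for s t
    by (rule symplectic_comp_lagrangian[OF Bsp[OF that] M])
  have mid: "T/2 \<in> {0..T}" using T by simp
  \<comment> \<open>The height of the tent. A positive rotation leaves the Maslov cycle immediately,
    so a value just above \<open>1/2\<close> works. The lower bound keeps the tent steep, and the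
    upper bound keeps the rotation parameter in the range where its speed is controlled.\<close>
  obtain h where h: "1/2 \<le> h" "h \<le> 1" "((R h o\<^sub>L \<psi> (T/2)) ` M) \<inter> L = {0}"
  proof -
    let ?A = "\<lambda>s. R s o\<^sub>L \<psi> (T/2)" and ?S = "{1/2..1::real}"
    let ?l = "\<lambda>s. ?A s ` M"
    have lag: "lagrangian \<omega> (?l s)" for s by (rule Blag[OF mid])
    obtain W where W: "transversal W (?l (1/2))" using exists_transversal[OF lag] by blast
    have AD: "(?A has_vector_derivative (R' (1/2) o\<^sub>L \<psi> (T/2))) (at (1/2) within ?S)"
      using bounded_linear.has_vector_derivative[OF
          bounded_bilinear.bounded_linear_left[OF bounded_bilinear_blinfun_compose] RD] .
    obtain d where d: "quadform d"
      "\<And>e. e > 0 \<Longrightarrow> \<forall>\<^sub>F t in at (1/2) within ?S. transversal W (?l t) \<and>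
         (\<forall>v. \<bar>chart_form W (?l t) v - chart_form W (?l (1/2)) v - (t - 1/2) * d v\<bar> \<le> e * \<bar>t - 1/2\<bar> * (norm v)\<^sup>2)"
      "\<And>v. v \<in> ?l (1/2) \<Longrightarrow> \<exists>u\<in>M. ?A (1/2) u = v \<and> d v = \<omega> v ((R' (1/2) o\<^sub>L \<psi> (T/2)) u)"
      by (rule chart_form_differentiable[where S = ?S and A = ?A and l = ?l and ?t0.0 = "1/2", OF
          W sM _ lag refl AD]) auto
    have "posdef_on d (?l (1/2) \<inter> L)" unfolding posdef_on_def
    proof (intro ballI impI)
      fix v assume v: "v \<in> ?l (1/2) \<inter> L" "v \<noteq> 0"
      then obtain u where u: "?A (1/2) u = v" "d v = \<omega> v ((R' (1/2) o\<^sub>L \<psi> (T/2)) u)" using d(3) by blast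
      have "\<psi> (T/2) u \<noteq> 0" using u(1) v(2) by (auto simp: blinfun.zero_right)
      then have "0 < real N * rotation_rate * (norm (\<psi> (T/2) u))\<^sup>2" using N0 by simp
      also have "\<dots> \<le> \<omega> (R (1/2) (\<psi> (T/2) u)) (R' (1/2) (\<psi> (T/2) u))" by (rule Rpos) auto
      also have "\<dots> = d v" using u by simp
      finally show "d v > 0" .
    qed
    from posdef_on_nondegenerate[OF d(1) this]
    have "\<forall>\<^sub>F t in at (1/2) within ?S. ?l t \<inter> L = {0} \<and>
     (1/2 < t \<longrightarrow> n_plus (chart_form W (?l t)) L = n_plus (chart_form W (?l (1/2))) L + n_plus d (?l (1/2) \<inter> L)) \<and>
     (t < 1/2 \<longrightarrow> n_plus (chart_form W (?l t)) L = n_plus (chart_form W (?l (1/2))) L + n_minus d (?l (1/2) \<inter> L))"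
      by (intro crossing_jump[where l = ?l and ?t0.0 = "1/2", OF W L d(1)]) (use d(2) in auto)
    moreover have "\<forall>\<^sub>F t in at (1/2) within ?S. t \<in> ?S" by (auto simp: eventually_at_filter)
    ultimately have "\<forall>\<^sub>F t in at (1/2) within ?S. t \<in> ?S \<and> ?l t \<inter> L = {0}"
      by eventually_elim auto
    moreover have "at (1/2) within ?S \<noteq> bot" by (simp add: at_within_Icc_at_right)
    ultimately obtain t where "t \<in> ?S \<and> ?l t \<inter> L = {0}" using eventually_happens' by blast
    then show ?thesis using that by auto
  qed
  define X where "X = (UNIV :: real set) \<times> {0..T}"
  define H where "H p = (R (fst p) o\<^sub>L \<psi> (snd p)) ` M" for p
  have Hlag: "lagrangian \<omega> (H p)" if "p \<in> X" for p using that Blag by (auto simp: H_def X_def)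
  have inj: "inj (blinfun_apply (R s o\<^sub>L \<psi> t))" if "t \<in> {0..T}" for s t
    using symplectic_map_bij[OF Bsp[OF that]] by (auto simp: bij_def)
  have cB: "continuous_on X (\<lambda>p. R (fst p) o\<^sub>L \<psi> (snd p))"
    by (intro continuous_intros continuous_on_compose2[OF cR[of UNIV]] continuous_on_compose2[OF c\<psi>])
      (auto simp: X_def)
  have Hcont: "subspaces_continuous_on X H" unfolding H_def
    by (rule subspaces_continuous_on_image[OF cB _ sM]) (auto simp: X_def inj)
  have pX: "(h, T/2) \<in> X" using mid by (simp add: X_def)
  have "transversal L (H (h, T/2))"
    using h(3) L Hlag[OF pX] by (auto simp: transversal_def H_def)
  from chart_form_eventually[OF Hcont Hlag pX this, of 1] obtain \<eta> where \<eta>: "\<eta> > 0"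
    "\<And>q. q \<in> X \<Longrightarrow> dist q (h, T/2) < \<eta> \<Longrightarrow> transversal L (H q)"
    by (metis zero_less_one)
  define c where "c = 2 * h / T"
  have c: "c > 0" "c * (T/2) = h" "1 / T \<le> c" using h T by (auto simp: c_def field_simps)
  \<comment> \<open>While \<open>|t - T/2| \<le> \<delta>\<close>, the pair
    \<open>(\<phi> t, t)\<close> stays within
    \<open>3 * c * \<delta> + \<delta> = \<eta> / 2\<close> of \<open>(h, T/2)\<close>, hence off
    the Maslov cycle. The part where the slope of the tent changes sign thus contains no
    crossing.\<close>
  define \<delta> where "\<delta> = \<eta> / (2 * (3 * c + 1))"
  have \<delta>: "\<delta> > 0" "3 * c * \<delta> + \<delta> < \<eta>"
  proof -
    show "\<delta> > 0" using \<eta> c by (simp add: \<delta>_def)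
    have "3 * c * \<delta> + \<delta> = (3 * c + 1) * \<delta>" by (simp add: algebra_simps)
    also have "\<dots> = \<eta> / 2" using c(1) by (simp add: \<delta>_def field_simps)
    finally show "3 * c * \<delta> + \<delta> < \<eta>" using \<eta>(1) by simp
  qed
  obtain \<phi> \<phi>' where \<phi>0: "\<phi> 0 = 0" "\<phi> T = 0" and \<phi>r: "\<And>t. t \<in> {0..T} \<Longrightarrow> \<phi> t \<in> {0..c * (T/2)}"
    and \<phi>D: "\<And>t S. (\<phi> has_vector_derivative \<phi>' t) (at t within S)" and c\<phi>': "\<And>S. continuous_on S \<phi>'"
    and \<phi>l: "\<And>t. t \<le> T/2 - \<delta> \<Longrightarrow> \<phi>' t \<ge> c / 2" and \<phi>u: "\<And>t. t \<ge> T/2 + \<delta> \<Longrightarrow> \<phi>' t \<le> - (c / 2)"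
    and \<phi>m: "\<And>t. \<bar>t - T/2\<bar> \<le> \<delta> \<Longrightarrow> \<bar>\<phi> t - c * (T/2)\<bar> \<le> 3 * c * \<delta>"
    by (rule tent_function[OF T c(1) \<delta>(1)]) blast
  have \<phi>1: "0 \<le> \<phi> t" "\<phi> t \<le> 1" if "t \<in> {0..T}" for t using \<phi>r[OF that] c h by auto
  have c\<phi>: "continuous_on S \<phi>" for S by (rule continuous_on_vector_derivative[OF \<phi>D])
  define A where "A t = R (\<phi> t) o\<^sub>L \<psi> t" for t
  define A' where "A' t = (R (\<phi> t) o\<^sub>L \<psi>' t) + ((\<phi>' t *\<^sub>R R' (\<phi> t)) o\<^sub>L \<psi> t)" for t
  have AD: "(A has_vector_derivative A' t) (at t within {0..T})" if t: "t \<in> {0..T}" for t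
  proof -
    have "((\<lambda>t. R (\<phi> t)) has_vector_derivative \<phi>' t *\<^sub>R R' (\<phi> t)) (at t within {0..T})"
      using vector_diff_chain_within[OF \<phi>D RD, of t "{0..T}"] by (simp add: o_def)
    from bounded_bilinear.has_vector_derivative[OF bounded_bilinear_blinfun_compose this \<psi>'(1)[OF t]]
    show ?thesis by (simp add: A_def[abs_def] A'_def)
  qed
  have cA': "continuous_on {0..T} A'"
    unfolding A'_def
    by (intro continuous_intros c\<phi>' \<psi>'(2) c\<psi> continuous_on_compose2[OF cR[of UNIV] c\<phi>]
        continuous_on_compose2[OF cR'[of UNIV] c\<phi>]) auto
  let ?m = "\<lambda>t. A t ` M"
  have mlag: "lagrangian \<omega> (?m t)" if "t \<in> {0..T}" for t unfolding A_def by (rule Blag[OF that])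
  have "C1_on {0..T} A" unfolding C1_on_def using AD cA' by blast
  from lag_C1_image[OF this mlag sM] have m1: "lag_C1 \<omega> ?m 0 T" .
  have m2: "regular_crossings \<omega> L ?m 0 T" unfolding regular_crossings_def
  proof (intro ballI impI)
    fix t assume t: "t \<in> {0..T}" and cr: "is_crossing L ?m t"
    obtain W d where d: "transversal W (?m t)" "quadform d" "\<And>v. crossing_form \<omega> ?m 0 T t v = d v"
      "\<And>v. v \<in> ?m t \<Longrightarrow> \<exists>u\<in>M. A t u = v \<and> d v = \<omega> v (A' t u)"
      by (rule crossing_form_expansion[where l = ?m and A = A, OF T t sM mlag refl AD[OF t]]) blast+
    have \<Gamma>: "crossing_form \<omega> ?m 0 T t = d" using d(3) by (intro ext)
    \<comment> \<open>Up to an error controlled by \<open>K\<close>, the crossing form is the slope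
      of the tent times the positive speed of the rotation, evaluated at
      \<open>w = \<psi> t u\<close>.\<close>
    have val: "\<exists>w. w \<noteq> 0 \<and> \<bar>d v - \<phi>' t * \<omega> (R (\<phi> t) w) (R' (\<phi> t) w)\<bar> \<le> K * (norm w)\<^sup>2"
      if v: "v \<in> ?m t" "v \<noteq> 0" for v
    proof -
      obtain u where u: "A t u = v" "d v = \<omega> v (A' t u)" using d(4)[OF v(1)] by blast
      have "\<psi> t u \<noteq> 0" using u(1) v(2) by (auto simp: A_def blinfun.zero_right)
      moreover have "d v = \<omega> (A t u) (A' t u)" using u by simp
      then have "d v = \<omega> (\<psi> t u) (\<psi>' t u) + \<phi>' t * \<omega> (R (\<phi> t) (\<psi> t u)) (R' (\<phi> t) (\<psi> t u))"
        by (simp add: A_def A'_def blinfun.add_left blinfun.scaleR_left omega_simps Rsp)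
      ultimately show ?thesis using K(2)[OF t, of u] by (intro exI[of _ "\<psi> t u"]) auto
    qed
    have out: "\<not> \<bar>t - T/2\<bar> \<le> \<delta>"
    proof
      assume w: "\<bar>t - T/2\<bar> \<le> \<delta>"
      have "dist (\<phi> t, t) (h, T/2) \<le> dist (\<phi> t) h + dist t (T/2)"
        unfolding dist_Pair_Pair using sqrt_sum_squares_le_sum_abs[of "dist (\<phi> t) h" "dist t (T/2)"] by simp
      also have "\<dots> \<le> 3 * c * \<delta> + \<delta>" using \<phi>m[OF w] w c(2) by (simp add: dist_real_def)
      finally have "dist (\<phi> t, t) (h, T/2) < \<eta>" using \<delta>(2) by simp
      then have "transversal L (H (\<phi> t, t))" using \<eta>(2)[of "(\<phi> t, t)"] t by (simp add: X_def)
      then show False using cr by (auto simp: transversal_def H_def is_crossing_def A_def Int_commute)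
    qed
    have main: "K * (norm w)\<^sup>2 < c / 2 * \<omega> (R (\<phi> t) w) (R' (\<phi> t) w)" "0 \<le> \<omega> (R (\<phi> t) w) (R' (\<phi> t) w)"
      if w: "w \<noteq> 0" for w
    proof -
      have "K * (norm w)\<^sup>2 < real N * rotation_rate / (2 * T) * (norm w)\<^sup>2"
        using N' w by (intro mult_strict_right_mono) auto
      also have "\<dots> = (1 / T) / 2 * (real N * rotation_rate * (norm w)\<^sup>2)" by simp
      also have "\<dots> \<le> c / 2 * (real N * rotation_rate * (norm w)\<^sup>2)"
        using c(3) N0 by (intro mult_right_mono) auto
      also have "\<dots> \<le> c / 2 * \<omega> (R (\<phi> t) w) (R' (\<phi> t) w)"
        using Rpos[OF \<phi>1[OF t], of w] c(1) by (intro mult_left_mono) auto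
      finally show "K * (norm w)\<^sup>2 < c / 2 * \<omega> (R (\<phi> t) w) (R' (\<phi> t) w)" .
      show "0 \<le> \<omega> (R (\<phi> t) w) (R' (\<phi> t) w)"
        using Rpos[OF \<phi>1[OF t], of w] mult_nonneg_nonneg[OF less_imp_le[OF N0] zero_le_power2[of "norm w"]]
        by linarith
    qed
    show "qf_nondegenerate (crossing_form \<omega> ?m 0 T t) (?m t \<inter> L)"
    proof (cases "t \<le> T/2")
      case True
      then have sl: "\<phi>' t \<ge> c / 2" using out by (intro \<phi>l) auto
      have "posdef_on d (?m t \<inter> L)" unfolding posdef_on_def
      proof (intro ballI impI)
        fix v assume "v \<in> ?m t \<inter> L" "v \<noteq> 0"
        then obtain w where w: "w \<noteq> 0" "\<bar>d v - \<phi>' t * \<omega> (R (\<phi> t) w) (R' (\<phi> t) w)\<bar> \<le> K * (norm w)\<^sup>2"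
          using val by blast
        then show "d v > 0" using main[OF w(1)] mult_right_mono[OF sl main(2)[OF w(1)]] by linarith
      qed
      then show ?thesis unfolding \<Gamma> by (rule posdef_on_nondegenerate[OF d(2)])
    next
      case False
      then have sl: "\<phi>' t \<le> - (c / 2)" using out by (intro \<phi>u) auto
      have "posdef_on (\<lambda>v. - d v) (?m t \<inter> L)" unfolding posdef_on_def
      proof (intro ballI impI)
        fix v assume "v \<in> ?m t \<inter> L" "v \<noteq> 0"
        then obtain w where w: "w \<noteq> 0" "\<bar>d v - \<phi>' t * \<omega> (R (\<phi> t) w) (R' (\<phi> t) w)\<bar> \<le> K * (norm w)\<^sup>2"
          using val by blast
        then show "- d v > 0" using main[OF w(1)] mult_right_mono[OF sl main(2)[OF w(1)]] by linarith
      qed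
      then show ?thesis unfolding \<Gamma> by (rule negdef_on_nondegenerate[OF d(2)])
    qed
  qed
  \<comment> \<open>The height of the tent is scaled from 0 to 1; the endpoints stay fixed because
    the tent vanishes there and \<open>R 0\<close> is the identity.\<close>
  have m3: "lag_homotopic \<omega> (\<lambda>t. \<psi> t ` M) ?m 0 T" unfolding lag_homotopic_def
  proof (intro exI[of _ "\<lambda>p. (R (fst p * \<phi> (snd p)) o\<^sub>L \<psi> (snd p)) ` M"] conjI ballI)
    show "subspaces_continuous_on ({0..1} \<times> {0..T}) (\<lambda>p. (R (fst p * \<phi> (snd p)) o\<^sub>L \<psi> (snd p)) ` M)"
      by (rule subspaces_continuous_on_image[OF _ _ sM])
        (auto intro!: inj continuous_intros continuous_on_compose2[OF cR[of UNIV]]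
          continuous_on_compose2[OF c\<psi>] continuous_on_compose2[OF c\<phi>[of UNIV]])
    have id: "id_blinfun o\<^sub>L F = F" for F :: "'a \<Rightarrow>\<^sub>L 'a" by (rule blinfun_eqI) simp
    fix s t :: real
    assume t: "t \<in> {0..T}"
    show "(R (fst (0, t) * \<phi> (snd (0, t))) o\<^sub>L \<psi> (snd (0, t))) ` M = \<psi> t ` M" by (simp add: R0 id)
    show "(R (fst (1, t) * \<phi> (snd (1, t))) o\<^sub>L \<psi> (snd (1, t))) ` M = A t ` M" by (simp add: A_def)
    assume "s \<in> {0..1}"
    show "lagrangian \<omega> ((R (fst (s, t) * \<phi> (snd (s, t))) o\<^sub>L \<psi> (snd (s, t))) ` M)"
      using Blag[OF t] by simp
  next
    have id: "id_blinfun o\<^sub>L F = F" for F :: "'a \<Rightarrow>\<^sub>L 'a" by (rule blinfun_eqI) simp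
    fix s :: real
    show "(R (fst (s, 0) * \<phi> (snd (s, 0))) o\<^sub>L \<psi> (snd (s, 0))) ` M = \<psi> 0 ` M" by (simp add: R0 id \<phi>0)
    show "(R (fst (s, T) * \<phi> (snd (s, T))) o\<^sub>L \<psi> (snd (s, T))) ` M = \<psi> T ` M" by (simp add: R0 id \<phi>0)
  qed
  show ?thesis by (rule that[OF m1 m2 m3])
qed

section \<open>The triple index and comparison of two paths\<close>

text \<open>Two decompositions differ by a vector \<open>e\<close> of \<beta> \<inter> \<gamma>,
  which pairs to zero with both components, so the choice operator has only one possible
  value.\<close>

lemma triple_Q_eq:
  assumes \<beta>: "lagrangian \<omega> \<beta>" and \<gamma>: "lagrangian \<omega> \<gamma>" and "y \<in> \<beta>" "z \<in> \<gamma>"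
  shows "triple_Q \<omega> \<alpha> \<beta> \<gamma> (y + z) = \<omega> y z"
  unfolding triple_Q_def
proof (rule some_equality)
  fix r assume "\<exists>y' z'. y' \<in> \<beta> \<and> z' \<in> \<gamma> \<and> y + z = y' + z' \<and> r = \<omega> y' z'"
  then obtain y' z' where r: "y' \<in> \<beta>" "z' \<in> \<gamma>" "y + z = y' + z'" "r = \<omega> y' z'" by blast
  define e where "e = y - y'"
  have e: "e = z' - z" using r(3) by (simp add: e_def algebra_simps)
  have "e \<in> \<beta>" using r assms lagrangian_subspace[OF \<beta>] by (auto simp: e_def intro: subspace_diff)
  moreover have "e \<in> \<gamma>" unfolding e using r assms lagrangian_subspace[OF \<gamma>] by (auto intro: subspace_diff)
  ultimately have "\<omega> y e = 0" "\<omega> e z = 0" "\<omega> e e = 0"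
    using assms lagrangian_isotropic[OF \<beta>] lagrangian_isotropic[OF \<gamma>] by auto
  moreover have "y' = y - e" by (simp add: e_def)
  moreover have "z' = z + e" by (simp add: e)
  ultimately show "r = \<omega> y z" by (simp add: r(4) omega_simps)
qed (use assms in blast)

text \<open>Maximality of the triple index means that a positive subspace together with the kernel
  \<open>\<alpha> \<inter> \<beta> + \<alpha> \<inter> \<gamma>\<close> already fills \<open>\<alpha>\<close>.\<close>

lemma triple_index_maximal:
  assumes \<alpha>: "lagrangian \<omega> \<alpha>" and \<beta>: "lagrangian \<omega> \<beta>" and \<gamma>: "lagrangian \<omega> \<gamma>"
    and max: "triple_index \<omega> \<alpha> \<beta> \<gamma> = dim \<alpha> - dim (\<alpha> \<inter> \<beta>)" and x: "x \<in> \<alpha>"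
  shows "\<exists>y\<in>\<beta>. \<exists>z\<in>\<gamma>. x = y + z" and "\<And>y z. y \<in> \<beta> \<Longrightarrow> z \<in> \<gamma> \<Longrightarrow> x = y + z \<Longrightarrow> 0 \<le> \<omega> y z"
proof -
  note sub = lagrangian_subspace[OF \<alpha>] lagrangian_subspace[OF \<beta>] lagrangian_subspace[OF \<gamma>]
  note iso = lagrangian_isotropic[OF \<alpha>] lagrangian_isotropic[OF \<beta>] lagrangian_isotropic[OF \<gamma>]
  let ?Q = "triple_Q \<omega> \<alpha> \<beta> \<gamma>" and ?S = "\<alpha> \<inter> {y + z | y z. y \<in> \<beta> \<and> z \<in> \<gamma>}"
  have sS: "subspace ?S" by (intro subspace_inter sub subspace_sums)
  obtain U where U: "subspace U" "U \<subseteq> ?S" "posdef_on ?Q U" "dim U = n_plus ?Q ?S"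
    using n_plus_attained[OF sS] by blast
  let ?R = "{y + z | y z. y \<in> \<alpha> \<inter> \<beta> \<and> z \<in> \<alpha> \<inter> \<gamma>}"
  have sR: "subspace ?R" by (intro subspace_inter sub subspace_sums)
  have dR: "dim ?R + dim (\<alpha> \<inter> \<beta> \<inter> \<gamma>) = dim (\<alpha> \<inter> \<beta>) + dim (\<alpha> \<inter> \<gamma>)"
  proof -
    have "(\<alpha> \<inter> \<beta>) \<inter> (\<alpha> \<inter> \<gamma>) = \<alpha> \<inter> \<beta> \<inter> \<gamma>" by blast
    then show ?thesis using dim_sums_Int[of "\<alpha> \<inter> \<beta>" "\<alpha> \<inter> \<gamma>"] sub by (simp add: subspace_inter)
  qed
  \<comment> \<open>The subspace \<open>?R\<close> does not affect the form: isotropy of the three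
    Lagrangians cancels all mixed terms.\<close>
  have QUR: "?Q (u + r) = ?Q u" if u: "u \<in> ?S" and r: "r \<in> ?R" for u r
  proof -
    obtain b c where u': "u \<in> \<alpha>" "b \<in> \<beta>" "c \<in> \<gamma>" "u = b + c" using u by blast
    obtain y z where r': "y \<in> \<alpha>" "y \<in> \<beta>" "z \<in> \<alpha>" "z \<in> \<gamma>" "r = y + z" using r by blast
    have "\<omega> u y = 0" "\<omega> b y = 0" "\<omega> u z = 0" "\<omega> c z = 0" "\<omega> y z = 0" using u' r' iso by auto
    then have "\<omega> y c = 0" "\<omega> b z = 0" "\<omega> y z = 0"
      using u'(4) omega_skew[of y c] by (auto simp: omega_simps)
    then have "\<omega> (b + y) (c + z) = \<omega> b c" by (simp add: omega_simps)
    moreover have "u + r = (b + y) + (c + z)" by (simp add: u' r')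
    ultimately show ?thesis
      using triple_Q_eq[OF \<beta> \<gamma>, of "b + y" "c + z" \<alpha>] triple_Q_eq[OF \<beta> \<gamma> u'(2,3), of \<alpha>] u' r' sub
      by (simp add: subspace_add add_ac)
  qed
  have Q0: "?Q 0 = 0"
    using triple_Q_eq[OF \<beta> \<gamma>, of 0 0 \<alpha>] sub by (simp add: subspace_0 omega_simps)
  have "U \<inter> ?R \<subseteq> {0}"
  proof
    fix r assume r: "r \<in> U \<inter> ?R"
    have "?Q (0 + r) = ?Q 0" by (rule QUR) (use r subspace_0[OF sS] in auto)
    then have "?Q r = 0" using Q0 by simp
    moreover have "r \<noteq> 0 \<longrightarrow> ?Q r > 0" using U(3) IntD1[OF r] unfolding posdef_on_def by blast
    ultimately have "r = 0" by (metis less_irrefl)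
    then show "r \<in> {0}" by simp
  qed
  then have "dim (U \<inter> ?R) = 0" by (simp only: dim_eq_0)
  then have "dim {u + r | u r. u \<in> U \<and> r \<in> ?R} = dim U + dim ?R"
    using dim_sums_Int[OF U(1) sR] by linarith
  \<comment> \<open>The subtractions in the triple index and in \<open>max\<close> are truncated;
    these inequalities make them exact. The count then gives
    \<open>dim U + dim ?R = dim \<alpha>\<close>.\<close>
  moreover have "dim (\<alpha> \<inter> \<beta> \<inter> \<gamma>) \<le> dim (\<alpha> \<inter> \<gamma>)" "dim (\<alpha> \<inter> \<beta>) \<le> dim \<alpha>" by (auto intro: dim_subset)
  ultimately have dUR: "dim {u + r | u r. u \<in> U \<and> r \<in> ?R} = dim \<alpha>"
    using max dR U(4) unfolding triple_index_def by linarith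
  have UR: "{u + r | u r. u \<in> U \<and> r \<in> ?R} = \<alpha>"
  proof (rule subspace_dim_equal[OF subspace_sums[OF U(1) sR] sub(1)])
    show "{u + r | u r. u \<in> U \<and> r \<in> ?R} \<subseteq> \<alpha>"
      using U(2) sub(1) by (auto intro!: subspace_add)
  qed (use dUR in simp)
  obtain u r where ur: "u \<in> U" "r \<in> ?R" "x = u + r" using x UR by blast
  have "?Q x = ?Q u" unfolding ur(3) by (rule QUR[OF subsetD[OF U(2) ur(1)] ur(2)])
  moreover have "?Q u \<ge> 0"
    using U(3) ur(1) Q0 unfolding posdef_on_def by (metis less_imp_le order_refl)
  ultimately have "?Q x \<ge> 0" by simp
  then show "0 \<le> \<omega> y z" if "y \<in> \<beta>" "z \<in> \<gamma>" "x = y + z" for y z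
    using triple_Q_eq[OF \<beta> \<gamma> that(1,2), of \<alpha>] that(3) by simp
  obtain b c where "b \<in> \<beta>" "c \<in> \<gamma>" "u = b + c" using ur(1) U(2) by blast
  moreover obtain y z where "y \<in> \<beta>" "z \<in> \<gamma>" "r = y + z" using ur(2) by blast
  ultimately have "b + y \<in> \<beta>" "c + z \<in> \<gamma>" "x = (b + y) + (c + z)"
    using ur(3) sub by (auto intro: subspace_add)
  then show "\<exists>y\<in>\<beta>. \<exists>z\<in>\<gamma>. x = y + z" by blast
qed

text \<open>Both projections fix \<open>W\<close>, and \<open>W\<close> is isotropic. The difference
  of the two forms is therefore the second form pulled back along the projection onto
  \<open>l1\<close>, so its index is governed by \<open>l1\<close>.\<close>

lemma chart_form_difference:
  assumes t1: "transversal W l1" and t2: "transversal W l2"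
  shows "chart_form W l2 (v - pr W l1 v) = chart_form W l2 v - chart_form W l1 v"
proof -
  note c1 = transversal_complementary[OF t1] and c2 = transversal_complementary[OF t2]
  have W: "lagrangian \<omega> W" using t1 by (simp add: transversal_def)
  have "pr W l2 (v - pr W l1 v) = pr W l2 v - pr W l1 v"
    using linear_diff[OF linear_pr[OF c2]] pr_left[OF c2 pr_in(1)[OF c1]] by simp
  moreover have "\<omega> (pr W l2 v) (pr W l1 v) = 0" "\<omega> (pr W l1 v) (pr W l1 v) = 0"
    using lagrangian_isotropic[OF W] pr_in(1)[OF c1] pr_in(1)[OF c2] by auto
  ultimately show ?thesis by (simp add: chart_form_def omega_simps)
qed

text \<open>For \<open>p \<in> L3\<close> and \<open>n \<in> L1\<close> put
  \<open>x = p - pr W L1 p - n\<close>, a vector of \<open>L1\<close>, and split it as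
  \<open>y + z\<close> with \<open>y \<in> L2\<close>, \<open>z \<in> L3\<close>. Then
  \<open>q2 (p - z) = q1 p + q2 n + \<omega> y z\<close>, and the last term is nonnegative. Hence
  \<open>(p, n)\<close> goes to \<open>p - z\<close> in \<open>L3\<close> without losing positivity,
  and \<open>n_plus q2 L1\<close> dominates the index of \<open>q2 - q1\<close>.\<close>

lemma n_plus_difference_lower:
  assumes t1: "transversal W L1" and t2: "transversal W L2" and L3: "lagrangian \<omega> L3"
    and split: "\<And>x. x \<in> L1 \<Longrightarrow> \<exists>y\<in>L2. \<exists>z\<in>L3. x = y + z"
    and nonneg: "\<And>y z. y \<in> L2 \<Longrightarrow> z \<in> L3 \<Longrightarrow> y + z \<in> L1 \<Longrightarrow> 0 \<le> \<omega> y z"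
  shows "n_plus (chart_form W L1) L3 + n_plus (\<lambda>v. chart_form W L2 v - chart_form W L1 v) UNIV
    \<le> n_plus (chart_form W L2) L3"
proof -
  let ?q1 = "chart_form W L1" and ?q2 = "chart_form W L2" and ?p1 = "pr W L1" and ?p2 = "pr W L2"
  note c1 = transversal_complementary[OF t1] and c2 = transversal_complementary[OF t2]
  note l1 = linear_pr[OF c1] and l2 = linear_pr[OF c2]
  note q1 = quadform_chart_form[OF t1] and q2 = quadform_chart_form[OF t2]
  have lag: "lagrangian \<omega> W" "lagrangian \<omega> L1" "lagrangian \<omega> L2" using t1 t2 by (auto simp: transversal_def)
  note iso = lag[THEN lagrangian_isotropic] lagrangian_isotropic[OF L3]
  note sub = lag[THEN lagrangian_subspace] lagrangian_subspace[OF L3]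
  have "n_plus (\<lambda>v. ?q2 v - ?q1 v) UNIV \<le> n_plus ?q2 L1"
  proof (rule n_plus_le_map[where f = "\<lambda>v. v - ?p1 v"])
    show "linear (\<lambda>v. v - ?p1 v)"
      by (rule linearI) (simp_all add: linear_add[OF l1] linear_cmul[OF l1] algebra_simps)
    show "range (\<lambda>v. v - ?p1 v) \<subseteq> L1" using pr_in(2)[OF c1] by blast
  qed (auto simp: quadform_zero[OF q2] chart_form_difference[OF t1 t2])
  moreover have "n_plus (\<lambda>(p, n). ?q1 p + ?q2 n) (L3 \<times> L1) \<le> n_plus ?q2 L3"
  proof -
    let ?s = "\<lambda>(y, z). y + z :: 'a"
    have ls: "linear ?s" by (rule linearI) (auto simp: algebra_simps)
    \<comment> \<open>The splitting is ambiguous by \<open>L2 \<inter> L3\<close>; a right inverse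
      of the sum map selects it linearly, as the comparison of indices requires a linear
      map.\<close>
    obtain g where g: "range g \<subseteq> L2 \<times> L3" "linear g" "\<And>v. v \<in> ?s ` (L2 \<times> L3) \<Longrightarrow> ?s (g v) = v"
      using linear_exists_right_inverse_on[OF ls subspace_Times[OF sub(3,4)]] by metis
    define \<zeta> where "\<zeta> x = snd (g x)" for x
    have \<zeta>: "linear \<zeta>" unfolding \<zeta>_def using g(2) by (intro linearI) (auto simp: linear_add linear_cmul)
    have \<zeta>3: "\<zeta> x \<in> L3" for x using g(1) unfolding \<zeta>_def by (metis mem_Times_iff rangeI subsetD)
    have \<zeta>2: "x - \<zeta> x \<in> L2" if "x \<in> L1" for x
    proof -
      have "x \<in> ?s ` (L2 \<times> L3)" using split[OF that] by force
      then have "fst (g x) + snd (g x) = x" using g(3) by (metis case_prod_unfold)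
      moreover have "fst (g x) \<in> L2" using g(1) by (metis mem_Times_iff rangeI subsetD)
      ultimately show ?thesis by (metis \<zeta>_def add_diff_cancel_right')
    qed
    have key: "?q1 p + ?q2 n \<le> ?q2 (p - \<zeta> (p - ?p1 p - n))" if p: "p \<in> L3" and n: "n \<in> L1" for p n
    proof -
      define x z y where "x = p - ?p1 p - n" and "z = \<zeta> x" and "y = x - z"
      define a b where "a = ?p1 p" and "b = ?p2 n"
      have ab: "a \<in> W" "p - a \<in> L1" "b \<in> W" "n - b \<in> L2"
        using pr_in[OF c1] pr_in[OF c2] by (auto simp: a_def b_def)
      have x: "x \<in> L1" unfolding x_def using pr_in(2)[OF c1] n sub by (auto intro: subspace_diff)
      have y: "y \<in> L2" and z: "z \<in> L3" using \<zeta>2[OF x] \<zeta>3 by (auto simp: y_def z_def)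
      have xe: "x = p - a - n" by (simp add: x_def a_def)
      have Q: "0 \<le> \<omega> y z" by (rule nonneg[OF y z]) (simp add: y_def x)
      have "?p2 z = ?p2 x"
        using linear_add[OF l2, of y z] pr_right[OF c2 y] by (simp add: y_def)
      then have p2: "?p2 (p - z) = a + b"
        using pr_left[OF c2 ab(1)] by (simp add: linear_diff[OF l2] xe b_def)
      have "p - z - (a + b) \<in> L2" using pr_in(2)[OF c2, of "p - z"] by (simp add: p2)
      then have e: "\<omega> (p - z - (a + b)) y = 0" "\<omega> (p - a) n = 0" "\<omega> p z = 0" "\<omega> a a = 0" "\<omega> b a = 0"
        "\<omega> a b = 0" "\<omega> b b = 0"
        using y ab n p z by (auto intro: iso)
      have zz: "z = p - a - n - y" by (simp add: y_def xe)
      have e1: "\<omega> (a + b) y = \<omega> p y - \<omega> z y" using e(1) by (simp add: omega_simps)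
      have "\<omega> p z = - \<omega> p a - \<omega> p n - \<omega> p y" by (subst zz) (simp add: omega_simps omega_self)
      then have e2: "\<omega> p y = \<omega> a p - \<omega> p n" using e(3) omega_skew[of p a] by simp
      have e3: "\<omega> p n = \<omega> a n" using e(2) by (simp add: omega_simps)
      have "?q2 (p - z) = \<omega> (a + b) (p - z)" by (simp add: chart_form_def p2)
      also have "\<dots> = \<omega> (a + b) (a + n + y)" by (subst zz) (simp add: algebra_simps)
      also have "\<dots> = \<omega> a n + \<omega> b n + \<omega> (a + b) y" using e(4,5) by (simp add: omega_simps)
      also have "\<dots> = \<omega> a p + \<omega> b n + \<omega> y z"
        using e1 e2 e3 omega_skew[of z y] by simp
      finally show ?thesis using Q by (simp add: chart_form_def a_def b_def x_def z_def)
    qed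
    show ?thesis
    proof (rule n_plus_le_map[where f = "\<lambda>(p, n). p - \<zeta> (p - ?p1 p - n)"])
      show "subspace (L3 \<times> L1)" by (rule subspace_Times[OF sub(4,2)])
      show "linear (\<lambda>(p, n). p - \<zeta> (p - ?p1 p - n))"
        by (rule linearI)
          (auto simp: linear_add[OF l1] linear_cmul[OF l1] linear_add[OF \<zeta>] linear_diff[OF \<zeta>]
            linear_cmul[OF \<zeta>] algebra_simps)
      show "(\<lambda>(p, n). p - \<zeta> (p - ?p1 p - n)) ` (L3 \<times> L1) \<subseteq> L3"
        using \<zeta>3 sub(4) by (auto intro: subspace_diff)
      show "?q2 0 \<le> 0" by (simp add: quadform_zero[OF q2])
      fix x assume "x \<in> L3 \<times> L1" and "0 < (case x of (p, n) \<Rightarrow> ?q1 p + ?q2 n)"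
      then show "0 < ?q2 (case x of (p, n) \<Rightarrow> p - \<zeta> (p - ?p1 p - n))"
        using key by (cases x) (force intro: less_le_trans)
    qed
  qed
  ultimately show ?thesis using n_plus_Times[OF q1 q2 sub(4,2)] by simp
qed

lemma n_plus_difference_upper:
  assumes t1: "transversal W L1" and t2: "transversal W L2" and S: "subspace S"
  shows "n_plus (chart_form W L2) S
    \<le> n_plus (chart_form W L1) S + n_plus (\<lambda>v. chart_form W L2 v - chart_form W L1 v) UNIV"
proof -
  note q1 = quadform_chart_form[OF t1] and q2 = quadform_chart_form[OF t2]
  note d = quadform_diff[OF q2 q1]
  have "n_plus (chart_form W L2) S
      \<le> n_plus (chart_form W L1) S + n_plus (\<lambda>v. chart_form W L2 v - chart_form W L1 v) S"
    using n_plus_add_le[OF q1 d S] by simp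
  also have "n_plus (\<lambda>v. chart_form W L2 v - chart_form W L1 v) S
      \<le> n_plus (\<lambda>v. chart_form W L2 v - chart_form W L1 v) UNIV"
    by (rule n_plus_mono[OF S]) (auto simp: quadform_zero[OF d])
  finally show ?thesis by simp
qed

text \<open>Pulled back to the fixed space \<open>W0\<close>, the form is nondegenerate: its radical
  could only come from intersections of \<open>A p W0\<close> with \<open>H p\<close> and with
  \<open>W\<close>, and both are trivial. A nondegenerate form has locally constant index.\<close>

lemma n_plus_moving_locally_constant:
  fixes H :: "'b::metric_space \<Rightarrow> 'a set" and A :: "'b \<Rightarrow> 'a \<Rightarrow>\<^sub>L 'a"
  assumes H: "subspaces_continuous_on X H" "\<And>p. p \<in> X \<Longrightarrow> lagrangian \<omega> (H p)"
    and A: "continuous_on X A" "\<And>p u v. p \<in> X \<Longrightarrow> \<omega> (A p u) (A p v) = \<omega> u v"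
    and p: "p \<in> X" and t: "transversal W (H p)" "transversal (A p ` W0) (H p)" "transversal W (A p ` W0)"
    and W0: "lagrangian \<omega> W0"
  obtains d where "d > 0" "\<And>q. q \<in> X \<Longrightarrow> dist q p < d \<Longrightarrow> transversal W (H q) \<and>
     n_plus (chart_form W (H q)) (A q ` W0) = n_plus (chart_form W (H p)) (A p ` W0)"
proof -
  let ?q = "\<lambda>s. chart_form W (H s)"
  note sW0 = lagrangian_subspace[OF W0]
  note q0 = quadform_chart_form[OF t(1)]
  have inj: "inj (blinfun_apply (A s))" if "s \<in> X" for s
    using symplectic_map_bij[OF A(2)[OF that]] by (simp add: bij_def)
  have pull: "n_plus (?q s) (A s ` W0) = n_plus (\<lambda>x. ?q s (A s x)) W0"
    if "s \<in> X" "transversal W (H s)" for s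
    using inj[OF that(1)] quadform_zero[OF quadform_chart_form[OF that(2)]]
    by (intro n_plus_image[OF sW0 linear_blinfun]) (auto intro: inj_on_subset)
  have AW: "lagrangian \<omega> (A p ` W0)" using t(2) by (simp add: transversal_def)
  have "dim (form_radical (?q p) (A p ` W0)) = 0"
    using dim_form_radical_chart_form(2)[OF t(1) AW] t(2,3) by (simp add: transversal_def Int_commute)
  then have r0: "form_radical (?q p) (A p ` W0) \<subseteq> {0}" by simp
  have "form_radical (\<lambda>x. ?q p (A p x)) W0 \<subseteq> {0}"
  proof
    fix x assume x: "x \<in> form_radical (\<lambda>x. ?q p (A p x)) W0"
    have "polar (\<lambda>x. ?q p (A p x)) x y = polar (?q p) (A p x) (A p y)" for y
      by (simp add: polar_def blinfun.add_right)
    then have "A p x \<in> form_radical (?q p) (A p ` W0)" using x by (auto simp: form_radical_def)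
    then have "A p x = A p 0" using r0 by (auto simp: blinfun.zero_right)
    then show "x \<in> {0}" using injD[OF inj[OF p]] by blast
  qed
  then have rad: "dim (form_radical (\<lambda>x. ?q p (A p x)) W0) = 0" by (metis dim_eq_0)
  obtain e where e: "e > 0" "\<And>r. quadform r \<Longrightarrow>
      (\<And>x. x \<in> W0 \<Longrightarrow> \<bar>r x - ?q p (A p x)\<bar> \<le> e * (norm x)\<^sup>2) \<Longrightarrow>
      dim (form_radical (\<lambda>x. ?q p (A p x)) W0) \<le> dim (form_radical r W0) \<Longrightarrow>
      n_plus r W0 = n_plus (\<lambda>x. ?q p (A p x)) W0"
    using n_plus_locally_constant[OF quadform_comp_linear[OF q0 linear_blinfun] sW0] by metis
  obtain B where B: "B > 0" "\<And>x y. \<bar>polar (?q p) x y\<bar> \<le> B * norm x * norm y"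
    using quadform_bounded[OF q0] by blast
  define M where "M = norm (A p) + 1"
  have M: "M > 0" by (simp add: M_def add_nonneg_pos)
  \<comment> \<open>Half of the tolerance is spent on the change of the form, measured by
    \<open>e1\<close>, and half on the change of its argument, measured by
    \<open>e2\<close>.\<close>
  define e1 where "e1 = e / (2 * M\<^sup>2)"
  have e1: "e1 > 0" "e1 * M\<^sup>2 = e / 2" using e M by (auto simp: e1_def)
  define e2 where "e2 = min 1 (e / (4 * B * M))"
  have e2: "e2 > 0" "e2 \<le> 1" "B * e2 * (2 * M) \<le> e / 2"
  proof -
    show "e2 > 0" "e2 \<le> 1" using e B M by (auto simp: e2_def)
    have "e2 \<le> e / (4 * B * M)" by (simp add: e2_def)
    then show "B * e2 * (2 * M) \<le> e / 2" using B M by (simp add: field_simps)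
  qed
  obtain d1 where d1: "d1 > 0" "\<And>s. s \<in> X \<Longrightarrow> dist s p < d1 \<Longrightarrow> transversal W (H s) \<and>
     (\<forall>v. \<bar>?q s v - ?q p v\<bar> \<le> e1 * (norm v)\<^sup>2)"
    using chart_form_eventually[OF H p t(1) e1(1)] by metis
  obtain d2 where d2: "d2 > 0" "\<And>s. s \<in> X \<Longrightarrow> dist s p < d2 \<Longrightarrow> dist (A s) (A p) < e2"
    using A(1) p e2(1) unfolding continuous_on_iff by metis
  show ?thesis
  proof (rule that[of "min d1 d2"])
    fix s assume s: "s \<in> X" "dist s p < min d1 d2"
    then have ts: "transversal W (H s)" and cs: "\<And>v. \<bar>?q s v - ?q p v\<bar> \<le> e1 * (norm v)\<^sup>2"
      and as: "norm (A s - A p) < e2" using d1(2) d2(2) by (auto simp: dist_norm)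
    have "\<bar>?q s (A s x) - ?q p (A p x)\<bar> \<le> e * (norm x)\<^sup>2" for x
    proof -
      have "norm (A s) \<le> M" using as e2(2) norm_triangle_sub[of "A s" "A p"] by (simp add: M_def)
      then have nA: "norm (A s x) \<le> M * norm x" "norm (A p x) \<le> M * norm x"
        using norm_blinfun[of "A s" x] norm_blinfun[of "A p" x]
          mult_right_mono[of "norm (A s)" M "norm x"] mult_right_mono[of "norm (A p)" M "norm x"]
        by (auto simp: M_def)
      have "\<bar>?q s (A s x) - ?q p (A s x)\<bar> \<le> e1 * (norm (A s x))\<^sup>2" by (rule cs)
      also have "\<dots> \<le> e1 * (M * norm x)\<^sup>2" using nA e1 by (intro mult_left_mono power_mono) auto
      also have "\<dots> = e / 2 * (norm x)\<^sup>2" by (simp add: power_mult_distrib e1(2) flip: mult.assoc)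
      finally have h1: "\<bar>?q s (A s x) - ?q p (A s x)\<bar> \<le> e / 2 * (norm x)\<^sup>2" .
      have bil: "bilinear (polar (?q p))" and dg: "\<And>x. polar (?q p) x x = ?q p x"
        using q0 by (auto simp: quadform_def)
      have "?q p (A s x) - ?q p (A p x) = polar (?q p) (A s x - A p x) (A s x + A p x)"
        using polar_commute[of "?q p" "A s x" "A p x"]
        by (simp add: bilinear_lsub[OF bil] bilinear_radd[OF bil] dg)
      also have "\<bar>\<dots>\<bar> \<le> B * norm (A s x - A p x) * norm (A s x + A p x)" by (rule B)
      also have "\<dots> \<le> B * (e2 * norm x) * (2 * M * norm x)"
      proof (intro mult_mono)
        have "norm (A s x - A p x) \<le> norm (A s - A p) * norm x"
          using norm_blinfun[of "A s - A p" x] by (simp add: blinfun.diff_left)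
        also have "\<dots> \<le> e2 * norm x" using as by (intro mult_right_mono) auto
        finally show "norm (A s x - A p x) \<le> e2 * norm x" .
        show "norm (A s x + A p x) \<le> 2 * M * norm x"
          using norm_triangle_ineq[of "A s x" "A p x"] nA by linarith
      qed (use B e2 in auto)
      also have "\<dots> = B * e2 * (2 * M) * (norm x)\<^sup>2" by (simp add: power2_eq_square)
      also have "\<dots> \<le> e / 2 * (norm x)\<^sup>2" using e2(3) by (intro mult_right_mono) auto
      finally show ?thesis using h1 by linarith
    qed
    then have "n_plus (\<lambda>x. ?q s (A s x)) W0 = n_plus (\<lambda>x. ?q p (A p x)) W0"
      by (intro e(2) quadform_comp_linear[OF quadform_chart_form[OF ts] linear_blinfun]) (simp_all add: rad)
    then show "transversal W (H s) \<and> n_plus (?q s) (A s ` W0) = n_plus (?q p) (A p ` W0)"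
      using ts pull[OF s(1) ts] pull[OF p t(1)] by simp
  qed (use d1 d2 in auto)
qed

text \<open>The chart \<open>\<psi> t ` W0\<close> moves with both paths. Changing to a fixed chart produces the same
  \<open>L3\<close>-dependent term for either path, so it cancels in the difference.\<close>

lemma index_difference:
  fixes \<psi> :: "real \<Rightarrow> 'a \<Rightarrow>\<^sub>L 'a"
  assumes sp: "\<And>t u v. t \<in> {a..b} \<Longrightarrow> \<omega> (\<psi> t u) (\<psi> t v) = \<omega> u v" and c: "continuous_on {a..b} \<psi>"
    and ab: "a \<le> b" and L3: "lagrangian \<omega> L3"
    and t1: "transversal W0 L1" and t2: "transversal W0 L2"
    and f1: "index_function L3 {a..b} (\<lambda>t. \<psi> t ` L1) f1"
    and f2: "index_function L3 {a..b} (\<lambda>t. \<psi> t ` L2) f2"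
  defines "D \<equiv> \<lambda>t. int (n_plus (chart_form (\<psi> t ` W0) (\<psi> t ` L2)) L3)
                   - int (n_plus (chart_form (\<psi> t ` W0) (\<psi> t ` L1)) L3)"
  shows "(f2 b - f2 a) - (f1 b - f1 a) = D b - D a"
proof -
  have lag: "lagrangian \<omega> W0" "lagrangian \<omega> L1" "lagrangian \<omega> L2" using t1 t2 by (auto simp: transversal_def)
  have lagp: "lagrangian \<omega> (\<psi> t ` M)" if "t \<in> {a..b}" "lagrangian \<omega> M" for t M
    by (rule symplectic_comp_lagrangian[OF sp[OF that(1)] that(2)])
  have inj: "inj (blinfun_apply (\<psi> t))" if "t \<in> {a..b}" for t
    using symplectic_map_bij[OF sp[OF that]] by (simp add: bij_def)
  have cont: "subspaces_continuous_on {a..b} (\<lambda>t. \<psi> t ` M)" if "lagrangian \<omega> M" for M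
    by (rule subspaces_continuous_on_image[OF c inj lagrangian_subspace[OF that]])
  have tr: "transversal (\<psi> t ` W0) (\<psi> t ` M)" if "t \<in> {a..b}" "transversal W0 M" for t M
    by (rule chart_form_image(2)[OF that(2) linear_blinfun symplectic_map_bij[OF sp[OF that(1)]] sp[OF that(1)]])
  have "f2 a - f1 a - D a = f2 b - f1 b - D b"
  proof (rule connected_local_const[where f = "\<lambda>t. f2 t - f1 t - D t" and A = "{a..b}"], goal_cases)
    case 4
    show ?case
    proof
      fix t assume t: "t \<in> {a..b}"
      \<comment> \<open>Transversality to \<open>L3\<close> and to the two moving Lagrangians is
        what the change of chart requires. Transversality to \<open>\<psi> t W0\<close> makes the
        form of \<open>W\<close> restricted to the moving chart nondegenerate, hence of locally
        constant index.\<close>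
      obtain W where "\<And>\<alpha>. \<alpha> \<in> {L3, \<psi> t ` L1, \<psi> t ` L2, \<psi> t ` W0} \<Longrightarrow> transversal W \<alpha>"
        by (rule common_transversal[of "{L3, \<psi> t ` L1, \<psi> t ` L2, \<psi> t ` W0}"])
          (use L3 lagp[OF t] lag in auto)
      then have W: "transversal W L3" "transversal W (\<psi> t ` L1)" "transversal W (\<psi> t ` L2)"
        "transversal W (\<psi> t ` W0)" by auto
      have near: "\<exists>d>0. \<forall>s\<in>{a..b}. dist s t < d \<longrightarrow>
          int (n_plus (chart_form (\<psi> s ` W0) (\<psi> s ` M)) L3) - int (n_plus (chart_form (\<psi> t ` W0) (\<psi> t ` M)) L3)
          = f s - f t + int (n_plus (chart_form W L3) (\<psi> s ` W0)) - int (n_plus (chart_form W L3) (\<psi> t ` W0))"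
        if M: "transversal W0 M" "transversal W (\<psi> t ` M)" and f: "index_function L3 {a..b} (\<lambda>t. \<psi> t ` M) f" for M f
      proof -
        have lM: "lagrangian \<omega> M" using M(1) by (simp add: transversal_def)
        obtain d1 where d1: "d1 > 0" "\<And>s. s \<in> {a..b} \<Longrightarrow> dist s t < d1 \<Longrightarrow> transversal W (\<psi> s ` M) \<and>
            n_plus (chart_form W (\<psi> s ` M)) (\<psi> s ` W0) = n_plus (chart_form W (\<psi> t ` M)) (\<psi> t ` W0)"
          by (rule n_plus_moving_locally_constant[where A = \<psi> and H = "\<lambda>t. \<psi> t ` M", OF cont[OF lM]
              lagp[OF _ lM] c sp t M(2) tr[OF t M(1)] W(4) lag(1)]) blast+
        obtain d2 where d2: "d2 > 0" "\<And>s. s \<in> {a..b} \<Longrightarrow> dist s t < d2 \<Longrightarrow> transversal W (\<psi> s ` M) \<and>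
            f s - f t = int (n_plus (chart_form W (\<psi> s ` M)) L3) - int (n_plus (chart_form W (\<psi> t ` M)) L3)"
          using index_functionE[OF f t M(2)] by metis
        show ?thesis
        proof (intro exI[of _ "min d1 d2"] conjI ballI impI)
          fix s assume s: "s \<in> {a..b}" "dist s t < min d1 d2"
          have s1: "transversal W (\<psi> s ` M)"
            "n_plus (chart_form W (\<psi> s ` M)) (\<psi> s ` W0) = n_plus (chart_form W (\<psi> t ` M)) (\<psi> t ` W0)"
            using d1(2)[of s] s by auto
          have s2: "f s - f t = int (n_plus (chart_form W (\<psi> s ` M)) L3) - int (n_plus (chart_form W (\<psi> t ` M)) L3)"
            using d2(2)[of s] s by auto
          show "int (n_plus (chart_form (\<psi> s ` W0) (\<psi> s ` M)) L3) - int (n_plus (chart_form (\<psi> t ` W0) (\<psi> t ` M)) L3)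
            = f s - f t + int (n_plus (chart_form W L3) (\<psi> s ` W0)) - int (n_plus (chart_form W L3) (\<psi> t ` W0))"
            using chart_change[OF W(1) s1(1) tr[OF s(1) M(1)]] chart_change[OF W(1) M(2) tr[OF t M(1)]] s1(2) s2
            by linarith
        qed (use d1 d2 in auto)
      qed
      obtain d1 where d1: "d1 > 0" "\<And>s. s \<in> {a..b} \<Longrightarrow> dist s t < d1 \<Longrightarrow>
          int (n_plus (chart_form (\<psi> s ` W0) (\<psi> s ` L1)) L3) - int (n_plus (chart_form (\<psi> t ` W0) (\<psi> t ` L1)) L3)
          = f1 s - f1 t + int (n_plus (chart_form W L3) (\<psi> s ` W0)) - int (n_plus (chart_form W L3) (\<psi> t ` W0))"
        using near[OF t1 W(2) f1] by blast
      obtain d2 where d2: "d2 > 0" "\<And>s. s \<in> {a..b} \<Longrightarrow> dist s t < d2 \<Longrightarrow>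
          int (n_plus (chart_form (\<psi> s ` W0) (\<psi> s ` L2)) L3) - int (n_plus (chart_form (\<psi> t ` W0) (\<psi> t ` L2)) L3)
          = f2 s - f2 t + int (n_plus (chart_form W L3) (\<psi> s ` W0)) - int (n_plus (chart_form W L3) (\<psi> t ` W0))"
        using near[OF t2 W(3) f2] by blast
      show "\<forall>\<^sub>F s in at t within {a..b}. f2 t - f1 t - D t = f2 s - f1 s - D s"
        unfolding eventually_at
      proof (intro exI[of _ "min d1 d2"] conjI ballI impI)
        fix s assume s: "s \<in> {a..b}" "s \<noteq> t \<and> dist s t < min d1 d2"
        show "f2 t - f1 t - D t = f2 s - f1 s - D s"
          using d1(2)[of s] d2(2)[of s] s unfolding D_def by auto
      qed (use d1 d2 in auto)
    qed
  qed (use ab in auto)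
  then show ?thesis by simp
qed

lemma crossing_sum_nonneg:
  assumes pc: "plus_curve \<omega> L l a b" and ab: "a \<le> b" and L: "lagrangian \<omega> L"
    and q0: "\<And>t. t \<in> {a..b} \<Longrightarrow> crossing_form \<omega> l a b t 0 = 0"
  shows "0 \<le> crossing_sum \<omega> L l a b"
proof -
  have n: "n_minus (crossing_form \<omega> l a b t) (l t \<inter> L) = 0" if t: "t \<in> {a..b}" for t
  proof -
    have "subspace (l t \<inter> L)"
      using pc t L unfolding plus_curve_def lag_C1_def by (blast intro: subspace_inter lagrangian_subspace)
    moreover have "- crossing_form \<omega> l a b t v \<le> 0" if v: "v \<in> l t \<inter> L" for v
    proof (cases "v = 0")
      case True then show ?thesis using q0[OF t] by simp
    next
      case False
      then have "is_crossing L l t" using v by (auto simp: is_crossing_def)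
      then show ?thesis using pc t v False unfolding plus_curve_def by force
    qed
    ultimately show ?thesis unfolding n_minus_eq by (rule n_plus_eq_0)
  qed
  have "0 \<le> (\<Sum>t\<in>{t\<in>{a<..<b}. is_crossing L l t}. qf_signature (crossing_form \<omega> l a b t) (l t \<inter> L))"
    by (rule sum_nonneg) (auto simp: qf_signature_def n)
  then show ?thesis unfolding crossing_sum_def using n[of b] ab by simp
qed

end

theorem theorem4p1:
  fixes \<omega> :: "'a::euclidean_space \<Rightarrow> 'a \<Rightarrow> real"
    and n :: nat and T :: real
    and L1 L2 L3 :: "'a set"
    and \<psi> :: "real \<Rightarrow> ('a \<Rightarrow>\<^sub>L 'a)"
  assumes symp: "symplectic_form \<omega>"
    and dimV: "DIM('a) = 2 * n"
    and T: "0 < T"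
    and lag1: "lagrangian \<omega> L1" and lag2: "lagrangian \<omega> L2" and lag3: "lagrangian \<omega> L3"
    and psi_symp: "\<forall>t\<in>{0..T}. symplectic_map \<omega> (\<psi> t)"
    and psi_C1: "C1_on {0..T} \<psi>"
    and psi0: "\<psi> 0 = id_blinfun"
    and h1: "plus_curve \<omega> L3 (\<lambda>t. blinfun_apply (\<psi> t) ` L2) 0 T"
    and h2: "triple_index \<omega> L1 L2 L3 = n - dim (L1 \<inter> L2)"
    and h3: "iota_CLM \<omega> L3 (\<lambda>t. blinfun_apply (\<psi> t) ` L1) 0 T = 0"
  shows "iota_CLM \<omega> L3 (\<lambda>t. blinfun_apply (\<psi> t) ` L2) 0 T = 0"
proof -
  interpret symplectic_space \<omega> by unfold_locales (rule symp)
  have sp: "\<omega> (\<psi> t u) (\<psi> t v) = \<omega> u v" if "t \<in> {0..T}" for t u v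
    using psi_symp that by (simp add: symplectic_map_def)
  obtain \<psi>' where \<psi>': "\<And>t. t \<in> {0..T} \<Longrightarrow> (\<psi> has_vector_derivative \<psi>' t) (at t within {0..T})"
    using psi_C1 unfolding C1_on_def by blast
  have c: "continuous_on {0..T} \<psi>" by (rule continuous_on_vector_derivative[OF \<psi>'])
  have bij: "bij (blinfun_apply (\<psi> t))" if "t \<in> {0..T}" for t by (rule symplectic_map_bij[OF sp[OF that]])
  have lagp: "lagrangian \<omega> (\<psi> t ` M)" if "t \<in> {0..T}" "lagrangian \<omega> M" for t M
    by (rule symplectic_comp_lagrangian[OF sp[OF that(1)] that(2)])
  have idx: "\<exists>f. index_function L3 {0..T} (\<lambda>t. \<psi> t ` M) f" if M: "lagrangian \<omega> M" for M
  proof -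
    have "subspaces_continuous_on {0..T} (\<lambda>t. \<psi> t ` M)"
      by (rule subspaces_continuous_on_image[OF c _ lagrangian_subspace[OF M]]) (use bij in \<open>auto simp: bij_def\<close>)
    from exists_index_function[OF this lagp[OF _ M] lag3] show ?thesis by (metis compact_Icc convex_closed_interval)
  qed
  obtain f1 where f1: "index_function L3 {0..T} (\<lambda>t. \<psi> t ` L1) f1" using idx[OF lag1] by blast
  obtain f2 where f2: "index_function L3 {0..T} (\<lambda>t. \<psi> t ` L2) f2" using idx[OF lag2] by blast
  \<comment> \<open>Without such a representative \<open>h3\<close> would say nothing about
    \<open>f1\<close>.\<close>
  obtain m where m: "lag_C1 \<omega> m 0 T" "regular_crossings \<omega> L3 m 0 T" "lag_homotopic \<omega> (\<lambda>t. \<psi> t ` L1) m 0 T"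
    by (rule exists_regular_representative[OF T lag3 lag1 sp psi_C1]) blast+
  have i1: "f1 T - f1 0 = 0" using iota_CLM_eq_index[OF lag3 T f1 m] h3 by simp
  have qf: "quadform (crossing_form \<omega> (\<lambda>t. \<psi> t ` L2) 0 T t)" if t: "t \<in> {0..T}" for t
  proof -
    obtain W d where "quadform d" "\<And>v. crossing_form \<omega> (\<lambda>t. \<psi> t ` L2) 0 T t v = d v"
      by (rule crossing_form_expansion[where l = "\<lambda>t. \<psi> t ` L2" and A = \<psi>, OF T t
          lagrangian_subspace[OF lag2] lagp[OF _ lag2] refl \<psi>'[OF t]]) blast+
    then show ?thesis by (metis (no_types, lifting) ext)
  qed
  have r2: "regular_crossings \<omega> L3 (\<lambda>t. \<psi> t ` L2) 0 T"
    unfolding regular_crossings_def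
    using h1 qf unfolding plus_curve_def by (intro ballI impI posdef_on_nondegenerate) (auto simp: posdef_on_def)
  have C2: "lag_C1 \<omega> (\<lambda>t. \<psi> t ` L2) 0 T" using h1 by (simp add: plus_curve_def)
  \<comment> \<open>The constant homotopy: the plus curve has only regular crossings and is its own
    representative.\<close>
  have hom2: "lag_homotopic \<omega> (\<lambda>t. \<psi> t ` L2) (\<lambda>t. \<psi> t ` L2) 0 T"
    unfolding lag_homotopic_def
  proof (intro exI[of _ "\<lambda>p. \<psi> (snd p) ` L2"] conjI ballI)
    show "subspaces_continuous_on ({0..1} \<times> {0..T}) (\<lambda>p. \<psi> (snd p) ` L2)"
      by (rule subspaces_continuous_on_image[OF _ _ lagrangian_subspace[OF lag2]])
        (use bij in \<open>auto simp: bij_def intro!: continuous_on_compose2[OF c] continuous_intros\<close>)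
  qed (use lagp[OF _ lag2] in auto)
  have i2: "iota_CLM \<omega> L3 (\<lambda>t. \<psi> t ` L2) 0 T = f2 T - f2 0"
    by (rule iota_CLM_eq_index[OF lag3 T f2 C2 r2 hom2])
  have ge: "0 \<le> f2 T - f2 0"
    using crossing_sum_nonneg[OF h1 less_imp_le[OF T] lag3] quadform_zero[OF qf] T
      crossing_sum_eq_index[OF lag3 T C2 r2 f2] by simp
  obtain W where "\<And>\<alpha>. \<alpha> \<in> {L1, L2} \<Longrightarrow> transversal W \<alpha>"
    by (rule common_transversal[of "{L1, L2}"]) (use lag1 lag2 in auto)
  then have W: "transversal W L1" "transversal W L2" by auto
  define D where "D t = int (n_plus (chart_form (\<psi> t ` W) (\<psi> t ` L2)) L3)
                   - int (n_plus (chart_form (\<psi> t ` W) (\<psi> t ` L1)) L3)" for t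
  let ?d = "\<lambda>v. chart_form W L2 v - chart_form W L1 v"
  have diff: "(f2 T - f2 0) - (f1 T - f1 0) = D T - D 0"
    unfolding D_def by (rule index_difference[OF sp c less_imp_le[OF T] lag3 W f1 f2])
  have "dim L1 = n" using dim_lagrangian[OF lag1] dimV by simp
  with h2 have max: "triple_index \<omega> L1 L2 L3 = dim L1 - dim (L1 \<inter> L2)" by simp
  have "n_plus (chart_form W L1) L3 + n_plus ?d UNIV \<le> n_plus (chart_form W L2) L3"
    by (rule n_plus_difference_lower[OF W lag3])
      (use triple_index_maximal[OF lag1 lag2 lag3 max] in blast)+
  \<comment> \<open>At time 0 the moving chart is \<open>W\<close> itself, by \<open>psi0\<close>;
    here the universal upper bound for \<open>D\<close> is attained.\<close>
  then have D0: "int (n_plus ?d UNIV) \<le> D 0" by (simp add: D_def psi0)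
  have TT: "T \<in> {0..T}" using T by simp
  note tr = chart_form_image[OF _ linear_blinfun bij[OF TT] sp[OF TT]]
  let ?e = "\<lambda>v. chart_form (\<psi> T ` W) (\<psi> T ` L2) v - chart_form (\<psi> T ` W) (\<psi> T ` L1) v"
  have qe: "quadform ?e" by (intro quadform_diff quadform_chart_form tr(2) W)
  \<comment> \<open>At time \<open>T\<close> all three Lagrangians of the charts are carried along
    by \<open>\<psi> T\<close>, so the difference form is conjugate to the one at time 0 and the
    upper bound is the same number.\<close>
  have "n_plus ?e (\<psi> T ` UNIV) = n_plus (\<lambda>v. ?e (\<psi> T v)) UNIV"
    using bij[OF TT] quadform_zero[OF qe] by (intro n_plus_image linear_blinfun) (auto simp: bij_def)
  then have "n_plus ?e UNIV = n_plus ?d UNIV"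
    using bij[OF TT] tr(1)[OF W(1)] tr(1)[OF W(2)] by (simp add: bij_def)
  then have "D T \<le> int (n_plus ?d UNIV)"
    using n_plus_difference_upper[OF tr(2)[OF W(1)] tr(2)[OF W(2)] lagrangian_subspace[OF lag3]]
    by (simp add: D_def)
  \<comment> \<open>The index of the second path equals \<open>D T - D 0\<close>, which is at most
    0, while positivity of its crossings makes it at least 0.\<close>
  with D0 diff i1 ge i2 show ?thesis by simp
qed

end
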